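(* Let $1<p<\infty$, $0\le m<p-1$, $\alpha+1+m>0$, and let $u$ be a non-negative entire weak solution of $$\Delta_p u=|x|^\alpha u^m(x)\quad\text{in }\mathbb R^n.$$ Suppose that $$\limsup_{|x|\to\infty}\frac{u(x)}{|x|^{1+\frac{1+\alpha+m}{p-1-m}}}<\tau(n,p,m,\alpha),$$ where $$\tau(n,p,m,\alpha):=\left(\frac{p-1-m}{(1+\alpha+m)(p-1)+(n-1)(p-1-m)}\right)^{\frac1{p-1-m}}\left(\frac{p-1-m}{p+\alpha}\right)^{\frac{p-1}{p-1-m}}.$$ Then $u\equiv0$.
   Context: $n\ge2$ and $\Delta_pu=\operatorname{div}(|\nabla u|^{p-2}\nabla u)$. "Entire weak solution" means $u\in W^{1,p}_{loc}(\mathbb R^n)$ and $\int|\nabla u|^{p-2}\nabla u\cdot\nabla\Psi\,dx=-\int|x|^\alpha u^m\Psi\,dx$ for all compactly supported $\Psi\in W^{1,p}(\mathbb R^n)$. *)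

theory Defs
  imports "HOL-Analysis.Analysis"
begin

definition compactly_supported :: "('a::topological_space \<Rightarrow> real) \<Rightarrow> bool" where
  "compactly_supported f \<longleftrightarrow> compact (closure {x. f x \<noteq> 0})"

primrec C_k :: "nat \<Rightarrow> ('a::euclidean_space \<Rightarrow> real) \<Rightarrow> bool" where
  "C_k 0 f \<longleftrightarrow> continuous_on UNIV f"
| "C_k (Suc k) f \<longleftrightarrow>
     (\<forall>x. f differentiable (at x)) \<and>
     (\<forall>b\<in>Basis. C_k k (\<lambda>x. frechet_derivative f (at x) b))"

definition test_function :: "('a::euclidean_space \<Rightarrow> real) \<Rightarrow> bool" where
  "test_function \<phi> \<longleftrightarrow> (\<forall>k. C_k k \<phi>) \<and> compactly_supported \<phi>"

definition locally_integrable ::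
    "('a::euclidean_space \<Rightarrow> 'b::{banach,second_countable_topology}) \<Rightarrow> bool" where
  "locally_integrable f \<longleftrightarrow> (\<forall>K. compact K \<longrightarrow> set_integrable lebesgue K f)"

definition has_weak_gradient ::
    "('a::euclidean_space \<Rightarrow> real) \<Rightarrow> ('a \<Rightarrow> 'a) \<Rightarrow> bool" where
  "has_weak_gradient u G \<longleftrightarrow>
     locally_integrable u \<and> locally_integrable G \<and>
     (\<forall>\<phi>. test_function \<phi> \<longrightarrow>
       (\<forall>b\<in>Basis. (LINT x|lebesgue. u x * frechet_derivative \<phi> (at x) b)
                 = - (LINT x|lebesgue. (G x \<bullet> b) * \<phi> x)))"

definition L_p :: "real \<Rightarrow>
    ('a::euclidean_space \<Rightarrow> 'b::{banach,second_countable_topology}) \<Rightarrow> bool" where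
  "L_p p f \<longleftrightarrow> f \<in> borel_measurable lebesgue \<and> integrable lebesgue (\<lambda>x. norm (f x) powr p)"

definition L_p_loc :: "real \<Rightarrow>
    ('a::euclidean_space \<Rightarrow> 'b::{banach,second_countable_topology}) \<Rightarrow> bool" where
  "L_p_loc p f \<longleftrightarrow> f \<in> borel_measurable lebesgue \<and>
     (\<forall>K. compact K \<longrightarrow> set_integrable lebesgue K (\<lambda>x. norm (f x) powr p))"

text \<open>
  The Sobolev spaces are rendered as relations between a function and a representative of
  its weak gradient, which is unique up to null sets: a function belongs to the space iff it is
  related to some vector field.
\<close>

definition W_1p ::
    "real \<Rightarrow> ('a::euclidean_space \<Rightarrow> real) \<Rightarrow> ('a \<Rightarrow> 'a) \<Rightarrow> bool" where
  "W_1p p u G \<longleftrightarrow> has_weak_gradient u G \<and> L_p p u \<and> L_p p G"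

definition W_1p_loc ::
    "real \<Rightarrow> ('a::euclidean_space \<Rightarrow> real) \<Rightarrow> ('a \<Rightarrow> 'a) \<Rightarrow> bool" where
  "W_1p_loc p u G \<longleftrightarrow> has_weak_gradient u G \<and> L_p_loc p u \<and> L_p_loc p G"

text \<open>
  The power \<open>t\<^sup>m\<close> for \<open>t \<ge> 0\<close>, \<open>m \<ge> 0\<close>, with an explicit value \<open>z\<close> for \<open>0\<^sup>0\<close> (\<open>powr\<close> itself
  fixes \<open>0 powr 0 = 0\<close>). For \<open>m = 0\<close> the absorption term \<open>u\<^sup>m\<close> is the constant 1 if \<open>z = 1\<close> and
  the characteristic function of \<open>{u > 0}\<close> if \<open>z = 0\<close>; for \<open>m > 0\<close> the value of \<open>z\<close> is irrelevant.
\<close>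

definition rpow :: "real \<Rightarrow> real \<Rightarrow> real \<Rightarrow> real" where
  "rpow z t m = (if t = 0 \<and> m = 0 then z else t powr m)"

text \<open>
  Entire weak solutions of \<open>\<Delta>\<^sub>p u = |x|\<^sup>\<alpha> u\<^sup>m\<close>. Integrability is demanded explicitly because the
  library integral of a non-integrable function is 0. For the left-hand side it is automatic by
  Hoelder's inequality; for the right-hand side it can fail if \<open>\<alpha> \<le> - n\<close>.
  The field \<open>|\<nabla>u|\<^sup>p\<^sup>-\<^sup>2 \<nabla>u\<close> is 0 where \<open>\<nabla>u = 0\<close>, also for \<open>p < 2\<close>.
\<close>

definition entire_weak_solution ::
    "real \<Rightarrow> real \<Rightarrow> real \<Rightarrow> real \<Rightarrow> ('a::euclidean_space \<Rightarrow> real) \<Rightarrow> bool" where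
  "entire_weak_solution z p m \<alpha> u \<longleftrightarrow>
     (\<exists>G. W_1p_loc p u G \<and>
       (\<forall>\<Psi> H. W_1p p \<Psi> H \<and> compactly_supported \<Psi> \<longrightarrow>
          integrable lebesgue (\<lambda>x. (norm (G x) powr (p - 2) *\<^sub>R G x) \<bullet> H x) \<and>
          integrable lebesgue (\<lambda>x. norm x powr \<alpha> * rpow z (u x) m * \<Psi> x) \<and>
          (LINT x|lebesgue. (norm (G x) powr (p - 2) *\<^sub>R G x) \<bullet> H x)
            = - (LINT x|lebesgue. norm x powr \<alpha> * rpow z (u x) m * \<Psi> x)))"

definition tau :: "nat \<Rightarrow> real \<Rightarrow> real \<Rightarrow> real \<Rightarrow> real" where
  "tau n p m \<alpha> =
     ((p - 1 - m) / ((1 + \<alpha> + m) * (p - 1) + (real n - 1) * (p - 1 - m))) powr (1 / (p - 1 - m)) *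
     ((p - 1 - m) / (p + \<alpha>)) powr ((p - 1) / (p - 1 - m))"

end

theory Submission
  imports Defs
begin

text \<open>
  Put \<open>\<beta> = 1 + (1 + \<alpha> + m) / (p - 1 - m)\<close>. The constant \<open>\<tau>\<close> is the one for which \<open>\<tau> |x|\<^sup>\<beta>\<close> solves
  the equation, and for \<open>0 < c < \<tau>\<close> the function \<open>c |x|\<^sup>\<beta>\<close> is a strict supersolution. The supersolution
  can be damped near the origin, at no cost at infinity: for all small \<open>s > 0\<close> and every \<open>\<delta> > 0\<close>,

    \<open>v\<^sub>\<delta>(x) = c |x|\<^sup>\<beta> exp (- \<delta> |x|\<^sup>-\<^sup>s)\<close>

  is still a strict supersolution (lemma \<open>supersolution\<close>). The growth hypothesis gives a \<open>c < \<tau>\<close> with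
  \<open>u \<le> v\<^sub>\<delta>\<close> outside a large ball whose radius may depend on \<open>\<delta>\<close>. Comparison on that ball
  (lemma \<open>weak_comparison\<close>) yields \<open>u \<le> v\<^sub>\<delta>\<close> almost everywhere for every \<open>\<delta>\<close>, and \<open>v\<^sub>\<delta>(x) \<rightarrow> 0\<close> as
  \<open>\<delta> \<rightarrow> \<infinity>\<close> for each \<open>x \<noteq> 0\<close>. Hence \<open>u = 0\<close>.

  For the comparison the equation of \<open>u\<close> and the inequality of \<open>v = v\<^sub>\<delta>\<close> are tested with \<open>\<Psi> = f (u - v)\<close>,
  where \<open>f\<close> is a nondecreasing \<open>C\<^sup>1\<close> function with bounded derivative that is positive exactly on the
  positive half-line. This \<open>\<Psi>\<close> has compact support. Monotonicity of \<open>\<xi> \<mapsto> |\<xi>|\<^sup>p\<^sup>-\<^sup>2 \<xi>\<close> gives one sign, the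
  strict differential inequality gives the other, so \<open>\<Psi> = 0\<close> almost everywhere. A \<open>C\<^sup>1\<close> function \<open>f\<close>
  makes the chain rule for Sobolev functions a direct consequence of mollification; the positive part
  itself would need a further limit.

  Two facts about weak derivatives carry this argument: the chain rule (\<open>has_weak_gradient_compose_diff\<close>)
  and integration by parts against a \<open>C\<^sup>1\<close> field (\<open>has_weak_gradient_by_parts\<close>). Weak gradients are
  tested with smooth functions only, so both rest on a smooth mollifier: the mollified function is \<open>C\<^sup>1\<close>, its
  classical derivative is the mollified weak derivative, and both converge in \<open>L\<^sup>1\<close>. Everything is
  done one direction at a time, so that only one-dimensional calculus is involved. The exponential
  damping makes \<open>v\<close> and its flux \<open>|\<nabla>v|\<^sup>p\<^sup>-\<^sup>2 \<nabla>v\<close> of class \<open>C\<^sup>1\<close> on the whole space, for all exponents, so that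
  integration by parts covers the origin as well.
\<close>

section \<open>Smooth functions and a bump function\<close>

lemma C_k_imp_continuous: "C_k k f \<Longrightarrow> continuous_on UNIV f"
  by (cases k) (auto simp: continuous_on_eq_continuous_at intro: differentiable_imp_continuous_within)

lemma C_k_pred: "C_k (Suc k) f \<Longrightarrow> C_k k f"
proof (induction k arbitrary: f)
  case 0
  then show ?case using C_k_imp_continuous by (metis C_k.simps(1))
next
  case (Suc k)
  then show ?case by (metis C_k.simps(2))
qed

lemma C_k_const: "C_k k (\<lambda>x. c)"
proof (induction k arbitrary: c)
  case (Suc k)
  then show ?case by (simp add: frechet_derivative_const)
qed simp

lemma C_k_add:
  assumes "C_k k f" "C_k k g"
  shows "C_k k (\<lambda>x. f x + g x)"
  using assms
proof (induction k arbitrary: f g)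
  case 0
  then show ?case by (auto intro: continuous_intros)
next
  case (Suc k)
  have "frechet_derivative (\<lambda>x. f x + g x) (at x) b =
      frechet_derivative f (at x) b + frechet_derivative g (at x) b" for x b
    using Suc.prems
    by (subst frechet_derivative_at[OF has_derivative_add, symmetric])
       (auto simp: frechet_derivative_works[symmetric])
  then show ?case using Suc by (auto simp: differentiable_add)
qed

lemma C_k_mult:
  assumes "C_k k f" "C_k k g"
  shows "C_k k (\<lambda>x. f x * g x)"
  using assms
proof (induction k arbitrary: f g)
  case 0
  then show ?case by (auto intro: continuous_intros)
next
  case (Suc k)
  have "frechet_derivative (\<lambda>x. f x * g x) (at x) b =
      f x * frechet_derivative g (at x) b + frechet_derivative f (at x) b * g x" for x b
    using Suc.prems
    by (subst frechet_derivative_at[OF has_derivative_mult, symmetric])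
       (auto simp: frechet_derivative_works[symmetric])
  moreover have "C_k k f" "C_k k g" using Suc.prems C_k_pred by auto
  ultimately show ?case using Suc by (auto simp: differentiable_mult intro!: C_k_add)
qed

lemma C_k_affine: "C_k k (\<lambda>x. c + x \<bullet> a)"
proof (cases k)
  case (Suc j)
  have d: "((\<lambda>x. c + x \<bullet> a) has_derivative (\<lambda>h. h \<bullet> a)) (at x)" for x
    by (auto intro!: derivative_eq_intros)
  then have "frechet_derivative (\<lambda>x. c + x \<bullet> a) (at x) = (\<lambda>h. h \<bullet> a)" for x
    using frechet_derivative_at by metis
  with d show ?thesis unfolding Suc by (auto simp: differentiable_def C_k_const)
qed (auto intro!: continuous_intros)

text \<open>
  The functions \<open>F j\<close> form a chain of successive derivatives, which expresses smoothness of \<open>F 0\<close> in a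
  form that the induction on \<open>k\<close> can use: a partial derivative of \<open>F j \<circ> h\<close> is \<open>F (Suc j) \<circ> h\<close> times a
  partial derivative of \<open>h\<close>.
\<close>

lemma C_k_compose:
  fixes F :: "nat \<Rightarrow> real \<Rightarrow> real"
  assumes "\<And>j t. (F j has_real_derivative F (Suc j) t) (at t)" and "\<And>k. C_k k h"
  shows "C_k k (\<lambda>x. F j (h x))"
proof (induction k arbitrary: j)
  case 0
  have "continuous_on UNIV (F j)"
    using DERIV_isCont[OF assms(1)] by (simp add: continuous_on_eq_continuous_at)
  then show ?case
    using assms(2)[of 0] by (auto intro: continuous_on_compose2[of UNIV "F j" UNIV h])
next
  case (Suc k)
  have h: "C_k (Suc k) h" by (rule assms)
  have d: "((\<lambda>x. F j (h x)) has_derivative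
      (\<lambda>v. frechet_derivative h (at x) v * F (Suc j) (h x))) (at x)" for x
    using h by (intro DERIV_compose_FDERIV[OF assms(1)]) (simp add: frechet_derivative_works[symmetric])
  then have "frechet_derivative (\<lambda>x. F j (h x)) (at x) =
      (\<lambda>v. frechet_derivative h (at x) v * F (Suc j) (h x))" for x
    using frechet_derivative_at by metis
  moreover have "(\<lambda>x. F j (h x)) differentiable (at x)" for x
    using d by (auto simp: differentiable_def)
  ultimately show ?case using h Suc by (auto intro!: C_k_mult)
qed

lemma C_k_norm_sq: "C_k k (\<lambda>y. 1 - c * ((x - y) \<bullet> (x - y)))"
proof (cases k)
  case (Suc j)
  have d: "((\<lambda>y. 1 - c * ((x - y) \<bullet> (x - y))) has_derivative (\<lambda>h. 2 * c * ((x - y) \<bullet> h))) (at y)" for y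
    by (auto intro!: derivative_eq_intros simp: algebra_simps inner_commute)
  then have e: "frechet_derivative (\<lambda>y. 1 - c * ((x - y) \<bullet> (x - y))) (at y) = (\<lambda>h. 2 * c * ((x - y) \<bullet> h))" for y
    using frechet_derivative_at by metis
  have "C_k j (\<lambda>y. 2 * c * ((x - y) \<bullet> b))" for b
  proof -
    have "C_k j (\<lambda>y. 2 * c * (x \<bullet> b) + y \<bullet> ((- 2 * c) *\<^sub>R b))" by (rule C_k_affine)
    then show ?thesis by (simp add: algebra_simps)
  qed
  then show ?thesis unfolding Suc using d by (auto simp: e differentiable_def)
qed (auto intro!: continuous_intros)

text \<open>
  The family of functions \<open>P(1/t) exp (- 1/t)\<close>, extended by zero to \<open>t \<le> 0\<close>. It contains the classical
  smooth function \<open>exp (- 1/t)\<close> and, unlike that function alone, is closed under differentiation.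
\<close>

definition exp_flat :: "real poly \<Rightarrow> real \<Rightarrow> real" where
  "exp_flat P t = (if t > 0 then poly P (1 / t) * exp (- (1 / t)) else 0)"

lemma poly_times_exp_minus_tendsto_0: "((\<lambda>x::real. poly P x * exp (- x)) \<longlongrightarrow> 0) at_top"
proof -
  have "((\<lambda>x::real. \<Sum>i\<le>degree P. coeff P i * (x ^ i / exp x)) \<longlongrightarrow> (\<Sum>i\<le>degree P. coeff P i * 0)) at_top"
    by (intro tendsto_intros tendsto_power_div_exp_0)
  then show ?thesis
    by (simp add: poly_altdef exp_minus sum_distrib_right divide_inverse mult.assoc)
qed

lemma DERIV_exp_flat:
  "(exp_flat P has_real_derivative exp_flat ([:0, 0, 1:] * (P - pderiv P)) t) (at t)"
proof -
  consider "t > 0" | "t < 0" | "t = 0" by linarith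
  then show ?thesis
  proof cases
    case 1
    have "((\<lambda>t. poly P (1 / t) * exp (- (1 / t))) has_real_derivative
        poly ([:0, 0, 1:] * (P - pderiv P)) (1 / t) * exp (- (1 / t))) (at t)"
      using 1 by (auto intro!: derivative_eq_intros DERIV_chain2[OF poly_DERIV]
          simp: field_simps power2_eq_square)
    then have "(exp_flat P has_real_derivative
        poly ([:0, 0, 1:] * (P - pderiv P)) (1 / t) * exp (- (1 / t))) (at t)"
      by (rule has_field_derivative_transform_within_open[of _ _ _ "{0<..}"])
        (use 1 in \<open>auto simp: exp_flat_def\<close>)
    with 1 show ?thesis by (simp add: exp_flat_def)
  next
    case 2
    have "((\<lambda>t. 0) has_real_derivative 0) (at t)" by simp
    then have "(exp_flat P has_real_derivative 0) (at t)"
      by (rule has_field_derivative_transform_within_open[of _ _ _ "{..<0}"])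
        (use 2 in \<open>auto simp: exp_flat_def\<close>)
    with 2 show ?thesis by (simp add: exp_flat_def)
  next
    case 3
    have "((\<lambda>t. poly (pCons 0 P) (inverse t) * exp (- inverse t)) \<longlongrightarrow> 0) (at_right (0::real))"
      by (rule filterlim_compose[OF poly_times_exp_minus_tendsto_0 filterlim_inverse_at_top_right])
    then have "((\<lambda>h. exp_flat P h / h) \<longlongrightarrow> 0) (at_right 0)"
    proof (rule Lim_transform_eventually)
      show "\<forall>\<^sub>F t in at_right 0. poly (pCons 0 P) (inverse t) * exp (- inverse t) = exp_flat P t / t"
        unfolding eventually_at_right_field by (intro exI[of _ 1]) (auto simp: exp_flat_def field_simps)
    qed
    moreover have "((\<lambda>h. exp_flat P h / h) \<longlongrightarrow> 0) (at_left 0)"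
    proof (rule Lim_transform_eventually[OF tendsto_const])
      show "\<forall>\<^sub>F t in at_left 0. 0 = exp_flat P t / t"
        unfolding eventually_at_left_field by (intro exI[of _ "-1"]) (auto simp: exp_flat_def)
    qed
    ultimately have "((\<lambda>h. exp_flat P h / h) \<longlongrightarrow> 0) (at 0)"
      by (rule filterlim_split_at_real[rotated])
    then show ?thesis using 3 by (simp add: DERIV_def exp_flat_def)
  qed
qed

lemma C_k_exp_flat_compose:
  assumes "\<And>k. C_k k h"
  shows "C_k k (\<lambda>x. exp_flat P (h x))"
proof -
  define F where "F j = exp_flat (((\<lambda>P. [:0, 0, 1:] * (P - pderiv P)) ^^ j) P)" for j
  have "C_k k (\<lambda>x. F 0 (h x))"
    by (rule C_k_compose[OF _ assms]) (simp add: F_def DERIV_exp_flat del: mult_pCons_left)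
  then show ?thesis by (simp add: F_def)
qed

text \<open>
  Smooth because it composes \<open>exp_flat\<close> with a polynomial; positive exactly on the open ball of radius
  \<open>1 / (k + 1)\<close>.
\<close>

definition bump :: "nat \<Rightarrow> 'a::euclidean_space \<Rightarrow> real" where
  "bump k x = exp_flat 1 (1 - (real k + 1)\<^sup>2 * (x \<bullet> x))"

lemma bump_nonneg: "0 \<le> bump k x"
  by (simp add: bump_def exp_flat_def)

lemma bump_eq_0: "1 / (real k + 1) \<le> norm x \<Longrightarrow> bump k x = 0"
proof -
  assume "1 / (real k + 1) \<le> norm x"
  then have "1 \<le> norm x * (real k + 1)" by (simp add: field_simps)
  then have "1\<^sup>2 \<le> (norm x * (real k + 1))\<^sup>2" by (intro power_mono) auto
  then show ?thesis by (simp add: bump_def exp_flat_def power2_norm_eq_inner power_mult_distrib mult.commute)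
qed

lemma bump_0_pos: "0 < bump k 0"
  by (simp add: bump_def exp_flat_def)

lemma compactly_supportedI:
  fixes f :: "'a::euclidean_space \<Rightarrow> real"
  assumes "\<And>x. norm x > R \<Longrightarrow> f x = 0"
  shows "compactly_supported f"
proof -
  have "{x. f x \<noteq> 0} \<subseteq> cball 0 R" using assms by (auto simp: not_less[symmetric])
  then have "bounded (closure {x. f x \<noteq> 0})" by (meson bounded_cball bounded_closure bounded_subset)
  then show ?thesis by (simp add: compactly_supported_def compact_eq_bounded_closed)
qed

lemma compactly_supportedE:
  fixes f :: "'a::euclidean_space \<Rightarrow> real"
  assumes "compactly_supported f"
  obtains R where "R > 0" "\<And>x. norm x > R \<Longrightarrow> f x = 0"
proof -
  have "bounded {x. f x \<noteq> 0}" using assms closure_subset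
    by (metis bounded_subset compactly_supported_def compact_imp_bounded)
  then obtain R where "R > 0" "\<forall>x\<in>{x. f x \<noteq> 0}. norm x \<le> R" using bounded_pos by blast
  then show ?thesis using that[of R] by (metis (mono_tags) mem_Collect_eq not_less)
qed

lemma test_function_bump:
  fixes x :: "'a::euclidean_space"
  shows "test_function (\<lambda>y. bump k (x - y))"
proof -
  have "C_k j (\<lambda>y. bump k (x - y))" for j
    unfolding bump_def by (intro C_k_exp_flat_compose C_k_norm_sq)
  moreover have "compactly_supported (\<lambda>y. bump k (x - y))"
  proof (rule compactly_supportedI)
    fix y :: 'a assume "norm y > norm x + 1"
    then have "1 \<le> norm (x - y)" by (smt (verit) norm_minus_commute norm_triangle_ineq2)
    moreover have "1 / (real k + 1) \<le> 1" by simp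
    ultimately show "bump k (x - y) = 0" by (intro bump_eq_0) linarith
  qed
  ultimately show ?thesis by (simp add: test_function_def)
qed

section \<open>Differentiation under the integral and integration by parts\<close>

lemma continuous_bounded_if_zero_outside:
  fixes f :: "'a::euclidean_space \<Rightarrow> real"
  assumes "continuous_on UNIV f" and "\<And>x. norm x > R \<Longrightarrow> f x = 0"
  obtains B where "B > 0" "\<And>x. \<bar>f x\<bar> \<le> B"
proof -
  have "compact (f ` cball 0 R)"
    using assms(1) by (intro compact_continuous_image) (auto intro: continuous_on_subset)
  then obtain B where B: "B > 0" "\<And>y. y \<in> f ` cball 0 R \<Longrightarrow> \<bar>y\<bar> \<le> B"
    using compact_imp_bounded bounded_pos by (metis real_norm_def)
  have "\<bar>f x\<bar> \<le> B" for x
    using B assms(2)[of x] by (cases "norm x \<le> R") auto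
  with B(1) that show ?thesis by blast
qed

lemma integrable_if_zero_outside:
  fixes f :: "'a::euclidean_space \<Rightarrow> real"
  assumes "continuous_on UNIV f" and "\<And>x. norm x > R \<Longrightarrow> f x = 0"
  shows "integrable lborel f"
proof -
  have "integrable lborel (\<lambda>x. indicator (cball 0 R) x *\<^sub>R f x)"
    using assms(1) by (intro borel_integrable_compact) (auto intro: continuous_on_subset)
  moreover have "(\<lambda>x. indicator (cball 0 R) x *\<^sub>R f x) = f"
    using assms(2) by (auto simp: indicator_def fun_eq_iff)
  ultimately show ?thesis by simp
qed

lemma integral_lborel_shift:
  fixes f :: "'a::euclidean_space \<Rightarrow> real"
  assumes "f \<in> borel_measurable borel"
  shows "(\<integral>x. f (x + a) \<partial>lborel) = (\<integral>x. f x \<partial>lborel)"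
proof -
  have "(\<integral>x. f x \<partial>lborel) = (\<integral>x. f x \<partial>(distr lborel borel ((+) a)))"
    by (simp add: lborel_distr_plus)
  also have "\<dots> = (\<integral>x. f (a + x) \<partial>lborel)"
    using assms by (intro integral_distr) auto
  finally show ?thesis by (simp add: add.commute)
qed

text \<open>
  The mean value theorem bounds the difference quotients of \<open>K\<close> by \<open>B'\<close>, so that dominated convergence
  applies. The lemma serves twice: for convolutions with the mollifier, and for the vanishing of
  integrals of derivatives below.
\<close>

lemma has_real_derivative_integral:
  fixes K :: "real \<Rightarrow> 'a \<Rightarrow> real"
  assumes w: "integrable M w"
    and meas: "\<And>t. K t \<in> borel_measurable M" "\<And>t. K' t \<in> borel_measurable M"
    and bnd: "\<And>t y. \<bar>K t y\<bar> \<le> B" "\<And>t y. \<bar>K' t y\<bar> \<le> B'"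
    and der: "\<And>t y. ((\<lambda>t. K t y) has_real_derivative K' t y) (at t)"
  shows "((\<lambda>t. \<integral>y. w y * K t y \<partial>M) has_real_derivative (\<integral>y. w y * K' t y \<partial>M)) (at t)"
proof -
  have [measurable]: "w \<in> borel_measurable M" using w by auto
  note meas[measurable]
  have int: "integrable M (\<lambda>y. w y * K t y)" for t
  proof (rule Bochner_Integration.integrable_bound[of _ "\<lambda>y. w y * B"])
    show "AE y in M. norm (w y * K t y) \<le> norm (w y * B)"
      using order_trans[OF bnd(1) abs_ge_self] by (auto simp: abs_mult intro!: mult_left_mono)
  qed (use w in auto)
  show ?thesis unfolding DERIV_def tendsto_at_iff_sequentially
  proof (intro allI impI)
    fix X :: "nat \<Rightarrow> real" assume X0: "\<forall>i. X i \<in> UNIV - {0}" and X: "X \<longlonglongrightarrow> 0"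
    have "(\<lambda>i. \<integral>y. w y * ((K (t + X i) y - K t y) / X i) \<partial>M) \<longlonglongrightarrow> (\<integral>y. w y * K' t y \<partial>M)"
    proof (rule integral_dominated_convergence[where w = "\<lambda>y. B' * \<bar>w y\<bar>"])
      show "integrable M (\<lambda>y. B' * \<bar>w y\<bar>)" using w by auto
      show "AE y in M. (\<lambda>i. w y * ((K (t + X i) y - K t y) / X i)) \<longlonglongrightarrow> w y * K' t y"
      proof (intro AE_I2 tendsto_intros)
        fix y
        have "((\<lambda>h. (K (t + h) y - K t y) / h) \<longlongrightarrow> K' t y) (at 0)"
          using der[of y t] by (simp add: DERIV_def)
        then show "(\<lambda>i. (K (t + X i) y - K t y) / X i) \<longlonglongrightarrow> K' t y"
          using X0 X unfolding tendsto_at_iff_sequentially by (auto simp: comp_def)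
      qed
      show "AE y in M. norm (w y * ((K (t + X i) y - K t y) / X i)) \<le> B' * \<bar>w y\<bar>" for i
      proof (intro AE_I2)
        fix y
        have "norm (K (t + X i) y - K t y) \<le> B' * norm (t + X i - t)"
          by (rule field_differentiable_bound[of UNIV _ "\<lambda>t. K' t y"])
             (use der[of y] bnd(2)[of _ y] in auto)
        then have "\<bar>(K (t + X i) y - K t y) / X i\<bar> \<le> B'"
          using X0 by (simp add: field_simps)
        then show "norm (w y * ((K (t + X i) y - K t y) / X i)) \<le> B' * \<bar>w y\<bar>"
          by (metis abs_ge_zero abs_mult mult.commute mult_left_mono real_norm_def)
      qed
    qed measurable
    moreover have "(\<integral>y. w y * ((K (t + X i) y - K t y) / X i) \<partial>M) =
      ((\<integral>y. w y * K (t + X i) y \<partial>M) - (\<integral>y. w y * K t y \<partial>M)) / X i" for i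
      by (subst Bochner_Integration.integral_diff[OF int int, symmetric])
         (simp add: right_diff_distrib flip: integral_divide_zero)
    ultimately show "((\<lambda>h. ((\<integral>y. w y * K (t + h) y \<partial>M) - (\<integral>y. w y * K t y \<partial>M)) / h) \<circ> X)
        \<longlonglongrightarrow> (\<integral>y. w y * K' t y \<partial>M)"
      by (simp only: comp_def)
  qed
qed

text \<open>
  A single direction suffices, since weak gradients are tested component by component.
\<close>

definition C1_along :: "'a::euclidean_space \<Rightarrow> ('a \<Rightarrow> real) \<Rightarrow> ('a \<Rightarrow> real) \<Rightarrow> bool" where
  "C1_along b f f' \<longleftrightarrow> continuous_on UNIV f \<and> continuous_on UNIV f' \<and>
     (\<forall>x. ((\<lambda>t. f (x + t *\<^sub>R b)) has_real_derivative f' x) (at 0))"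

lemma C1_along_DERIV:
  assumes "C1_along b f f'"
  shows "((\<lambda>t. f (x + t *\<^sub>R b)) has_real_derivative f' (x + t *\<^sub>R b)) (at t)"
proof -
  have "((\<lambda>s. f ((x + t *\<^sub>R b) + s *\<^sub>R b)) has_real_derivative f' (x + t *\<^sub>R b)) (at 0)"
    using assms by (auto simp: C1_along_def)
  then show ?thesis
    unfolding DERIV_def by (simp add: algebra_simps)
qed

lemma C1_along_mult:
  assumes "C1_along b f f'" "C1_along b g g'"
  shows "C1_along b (\<lambda>x. f x * g x) (\<lambda>x. f' x * g x + f x * g' x)"
proof -
  have "((\<lambda>t. f (x + t *\<^sub>R b) * g (x + t *\<^sub>R b)) has_real_derivative f' x * g x + f x * g' x) (at 0)" for x
    using DERIV_mult[of "\<lambda>t. f (x + t *\<^sub>R b)" "f' x" 0 UNIV "\<lambda>t. g (x + t *\<^sub>R b)" "g' x"] assms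
    by (simp add: C1_along_def mult.commute)
  then show ?thesis using assms by (auto simp: C1_along_def intro: continuous_intros)
qed

lemma C1_along_compose:
  assumes "C1_along b f f'" and "\<And>s. (h has_real_derivative h' s) (at s)" and "continuous_on UNIV h'"
  shows "C1_along b (\<lambda>x. h (f x)) (\<lambda>x. h' (f x) * f' x)"
proof -
  have "continuous_on UNIV h"
    using DERIV_isCont[OF assms(2)] by (simp add: continuous_on_eq_continuous_at)
  moreover have "((\<lambda>t. h (f (x + t *\<^sub>R b))) has_real_derivative h' (f x) * f' x) (at 0)" for x
    using DERIV_chain2[of h _ "\<lambda>t. f (x + t *\<^sub>R b)" 0 "f' x" UNIV] assms by (auto simp: C1_along_def)
  ultimately show ?thesis using assms
    by (auto simp: C1_along_def intro!: continuous_intros intro: continuous_on_compose2[of UNIV h]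
        continuous_on_compose2[of UNIV h'])
qed

lemma C1_along_zero_outside:
  assumes "C1_along b f f'" "\<And>x. norm x > R \<Longrightarrow> f x = 0" "norm x > R"
  shows "f' x = 0"
proof -
  have "((\<lambda>t. f (x + t *\<^sub>R b)) has_real_derivative 0) (at 0)"
  proof (rule has_field_derivative_transform_within_open)
    show "((\<lambda>t. 0) has_real_derivative 0) (at 0)" by simp
    show "open ((\<lambda>t. norm (x + t *\<^sub>R b)) -` {R<..})"
      by (intro open_vimage continuous_intros open_greaterThan)
    show "0 \<in> (\<lambda>t. norm (x + t *\<^sub>R b)) -` {R<..}" using assms(3) by simp
    show "0 = f (x + t *\<^sub>R b)" if "t \<in> (\<lambda>t. norm (x + t *\<^sub>R b)) -` {R<..}" for t
      using that assms(2) by simp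
  qed
  then show ?thesis using assms(1) DERIV_unique unfolding C1_along_def by blast
qed

text \<open>
  By translation invariance \<open>t \<mapsto> \<integral> g (y + t b) dy\<close> is constant, and its derivative at 0 is the integral
  in question. The indicator of a larger ball supplies the integrable weight needed to differentiate
  under the integral; it does not change the integrand for \<open>|t| < 1\<close>.
\<close>

lemma integral_C1_along_eq_0:
  fixes g :: "'a::euclidean_space \<Rightarrow> real"
  assumes g: "C1_along b g g'" and supp: "\<And>x. norm x > R \<Longrightarrow> g x = 0"
  shows "(\<integral>x. g' x \<partial>lborel) = 0"
proof -
  have supp': "\<And>x. norm x > R \<Longrightarrow> g' x = 0"
    using C1_along_zero_outside[OF g supp] by blast
  have cont: "continuous_on UNIV g" "continuous_on UNIV g'" using g by (auto simp: C1_along_def)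
  then have [measurable]: "g \<in> borel_measurable borel" "g' \<in> borel_measurable borel"
    by (auto intro: borel_measurable_continuous_onI)
  obtain B where B: "\<And>x. \<bar>g x\<bar> \<le> B"
    using continuous_bounded_if_zero_outside[OF cont(1) supp] by metis
  obtain B' where B': "\<And>x. \<bar>g' x\<bar> \<le> B'"
    using continuous_bounded_if_zero_outside[OF cont(2) supp'] by metis
  let ?w = "indicat_real (cball 0 (R + norm b)) :: 'a \<Rightarrow> real"
  have "((\<lambda>t. \<integral>y. ?w y * g (y + t *\<^sub>R b) \<partial>lborel) has_real_derivative
      (\<integral>y. ?w y * g' (y + 0 *\<^sub>R b) \<partial>lborel)) (at 0)"
  proof (rule has_real_derivative_integral)
    show "integrable lborel ?w"
      using emeasure_bounded_finite[OF bounded_cball]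
      by (simp add: integrable_indicator_iff)
  qed (use B B' C1_along_DERIV[OF g] in auto)
  moreover have "((\<lambda>t. \<integral>y. ?w y * g (y + t *\<^sub>R b) \<partial>lborel) has_real_derivative 0) (at 0)"
  proof (rule has_field_derivative_transform_within_open)
    show "((\<lambda>t. \<integral>y. g y \<partial>lborel) has_real_derivative 0) (at 0)" by simp
    show "(\<integral>y. g y \<partial>lborel) = (\<integral>y. ?w y * g (y + t *\<^sub>R b) \<partial>lborel)" if "t \<in> {-1<..<1}" for t
    proof -
      have "?w y * g (y + t *\<^sub>R b) = g (y + t *\<^sub>R b)" for y
      proof (cases "norm (y + t *\<^sub>R b) \<le> R")
        case True
        have "\<bar>t\<bar> * norm b \<le> 1 * norm b" using that by (intro mult_right_mono) auto
        moreover have "norm y \<le> norm (y + t *\<^sub>R b) + norm (t *\<^sub>R b)"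
          by (metis add_diff_cancel_right' norm_triangle_ineq4)
        ultimately show ?thesis using True by (auto simp: indicator_def)
      qed (use supp in auto)
      then have "(\<integral>y. ?w y * g (y + t *\<^sub>R b) \<partial>lborel) = (\<integral>y. g (y + t *\<^sub>R b) \<partial>lborel)"
        by (intro Bochner_Integration.integral_cong) (rule refl)
      then show ?thesis by (simp add: integral_lborel_shift)
    qed
  qed auto
  ultimately have z: "(\<integral>y. ?w y * g' (y + 0 *\<^sub>R b) \<partial>lborel) = 0"
    by (rule DERIV_unique)
  have w: "?w y * g' (y + 0 *\<^sub>R b) = g' y" for y
  proof -
    have "norm y > R + norm b \<Longrightarrow> norm y > R" using norm_ge_zero[of b] by linarith
    then show ?thesis using supp'[of y] by (auto simp: indicator_def)
  qed
  have "(\<integral>y. ?w y * g' (y + 0 *\<^sub>R b) \<partial>lborel) = (\<integral>y. g' y \<partial>lborel)"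
    by (intro Bochner_Integration.integral_cong refl w)
  with z show ?thesis by simp
qed

lemma integral_by_parts_along:
  fixes A B :: "'a::euclidean_space \<Rightarrow> real"
  assumes A: "C1_along b A A'" and B: "C1_along b B B'" and supp: "\<And>x. norm x > R \<Longrightarrow> B x = 0"
  shows "(\<integral>x. A' x * B x \<partial>lborel) = - (\<integral>x. A x * B' x \<partial>lborel)"
proof -
  have supp': "\<And>x. norm x > R \<Longrightarrow> B' x = 0"
    using C1_along_zero_outside[OF B supp] by blast
  have i: "integrable lborel (\<lambda>x. A' x * B x)" "integrable lborel (\<lambda>x. A x * B' x)"
    using A B supp supp' by (auto simp: C1_along_def intro!: continuous_intros integrable_if_zero_outside[where R = R])
  have "(\<integral>x. A' x * B x + A x * B' x \<partial>lborel) = 0"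
    by (rule integral_C1_along_eq_0[OF C1_along_mult[OF A B]]) (use supp in auto)
  then show ?thesis using i by simp
qed

section \<open>Mollification\<close>

lemma test_function_continuous: "test_function \<phi> \<Longrightarrow> continuous_on UNIV \<phi>"
  unfolding test_function_def by (metis C_k.simps(1))

lemma test_function_has_derivative:
  assumes "test_function \<phi>"
  shows "(\<phi> has_derivative frechet_derivative \<phi> (at x)) (at x)"
proof -
  have "C_k (Suc 0) \<phi>" using assms by (auto simp: test_function_def)
  then show ?thesis by (simp add: frechet_derivative_works[symmetric])
qed

lemma C1_along_test_function:
  assumes "test_function \<phi>" "b \<in> Basis"
  shows "C1_along b \<phi> (\<lambda>x. frechet_derivative \<phi> (at x) b)"
  unfolding C1_along_def
proof (intro conjI allI)
  show "continuous_on UNIV \<phi>" using assms(1) by (rule test_function_continuous)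
  have "C_k (Suc 0) \<phi>" using assms by (auto simp: test_function_def)
  then show "continuous_on UNIV (\<lambda>x. frechet_derivative \<phi> (at x) b)" using assms(2) by simp
  fix x
  have "((\<lambda>t. x + t *\<^sub>R b) has_vector_derivative b) (at 0)"
    by (auto intro!: derivative_eq_intros)
  then have "(\<phi> \<circ> (\<lambda>t. x + t *\<^sub>R b) has_vector_derivative frechet_derivative \<phi> (at x) b) (at 0)"
    using test_function_has_derivative[OF assms(1), of x]
    by (intro vector_derivative_diff_chain_within) (auto intro: has_derivative_at_withinI)
  then show "((\<lambda>t. \<phi> (x + t *\<^sub>R b)) has_real_derivative frechet_derivative \<phi> (at x) b) (at 0)"
    by (simp add: has_real_derivative_iff_has_vector_derivative comp_def)
qed

lemma continuous_bump: "continuous_on UNIV (bump k :: 'a::euclidean_space \<Rightarrow> real)"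
  using test_function_continuous[OF test_function_bump[of k "0::'a"]]
  by (simp add: bump_def)

lemma integrable_bump: "integrable lborel (bump k :: 'a::euclidean_space \<Rightarrow> real)"
proof (rule integrable_if_zero_outside[OF continuous_bump, of 1])
  fix x :: 'a assume "norm x > 1"
  moreover have "1 / (real k + 1) \<le> 1" by simp
  ultimately show "bump k x = 0" by (intro bump_eq_0) linarith
qed

lemma integral_bump_pos: "0 < (\<integral>x. bump k (x :: 'a::euclidean_space) \<partial>lborel)"
proof -
  have "(\<integral>x. bump k (x :: 'a) \<partial>lborel) \<noteq> 0"
  proof
    assume "(\<integral>x. bump k (x :: 'a) \<partial>lborel) = 0"
    then have ae: "AE x in lborel. bump k (x :: 'a) = 0"
      by (subst (asm) integral_nonneg_eq_0_iff_AE[OF integrable_bump]) (auto simp: bump_nonneg)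
    have op: "open {x :: 'a. bump k x \<noteq> 0}"
      by (intro open_Collect_neq continuous_bump continuous_on_const)
    then have "{x :: 'a. bump k x \<noteq> 0} \<in> sets lborel" by simp
    with ae have "{x :: 'a. bump k x \<noteq> 0} \<in> null_sets lborel"
      by (subst AE_iff_null_sets) auto
    then have "negligible {x :: 'a. bump k x \<noteq> 0}"
      by (simp add: negligible_iff_null_sets null_sets_completionI)
    moreover have "{x :: 'a. bump k x \<noteq> 0} \<noteq> {}"
      using bump_0_pos[of k, where 'a = 'a] by force
    ultimately show False using open_not_negligible[OF op] by blast
  qed
  moreover have "0 \<le> (\<integral>x. bump k (x :: 'a) \<partial>lborel)" by (simp add: bump_nonneg)
  ultimately show ?thesis by simp
qed

definition mollifier :: "nat \<Rightarrow> 'a::euclidean_space \<Rightarrow> real" where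
  "mollifier k x = bump k x / (\<integral>y. bump k (y :: 'a) \<partial>lborel)"

definition mollifier_deriv :: "nat \<Rightarrow> 'a::euclidean_space \<Rightarrow> 'a \<Rightarrow> real" where
  "mollifier_deriv k b x = frechet_derivative (mollifier k) (at x) b"

lemma mollifier_nonneg: "0 \<le> mollifier k x"
  unfolding mollifier_def by (intro divide_nonneg_pos bump_nonneg integral_bump_pos)

lemma mollifier_eq_0: "1 / (real k + 1) \<le> norm x \<Longrightarrow> mollifier k x = 0"
  by (simp add: mollifier_def bump_eq_0)

lemma mollifier_eq_0': "1 \<le> norm x \<Longrightarrow> mollifier k x = 0"
proof -
  assume "1 \<le> norm x"
  moreover have "1 / (real k + 1) \<le> 1" by simp
  ultimately show ?thesis by (intro mollifier_eq_0) linarith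
qed

lemma mollifier_minus: "mollifier k (- x) = mollifier k x"
  by (simp add: mollifier_def bump_def)

lemma test_function_mollifier_shift:
  fixes x :: "'a::euclidean_space"
  shows "test_function (\<lambda>y. mollifier k (x - y))"
proof -
  define c where "c = 1 / (\<integral>y. bump k (y :: 'a) \<partial>lborel)"
  have m: "mollifier k (x - y) = c * bump k (x - y)" for y by (simp add: mollifier_def c_def)
  have "compactly_supported (\<lambda>y. mollifier k (x - y))"
  proof (rule compactly_supportedI)
    fix y :: 'a assume "norm y > norm x + 1"
    then have "1 \<le> norm (x - y)" by (smt (verit) norm_minus_commute norm_triangle_ineq2)
    then show "mollifier k (x - y) = 0" by (rule mollifier_eq_0')
  qed
  moreover have "C_k j (\<lambda>y. mollifier k (x - y))" for j
    unfolding m using test_function_bump[of k x] by (intro C_k_mult C_k_const) (auto simp: test_function_def)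
  ultimately show ?thesis by (simp add: test_function_def)
qed

lemma test_function_mollifier: "test_function (mollifier k)"
  using test_function_mollifier_shift[of k 0] by (simp add: mollifier_minus)

lemmas continuous_mollifier = test_function_continuous[OF test_function_mollifier]

lemma C1_along_mollifier: "b \<in> Basis \<Longrightarrow> C1_along b (mollifier k) (mollifier_deriv k b)"
  unfolding mollifier_deriv_def[abs_def] by (rule C1_along_test_function[OF test_function_mollifier])

lemma frechet_derivative_mollifier_shift:
  "frechet_derivative (\<lambda>y. mollifier k (x - y)) (at y) b = - mollifier_deriv k b (x - y)"
proof -
  have "((\<lambda>y. mollifier k (x - y)) has_derivative
      (\<lambda>h. frechet_derivative (mollifier k) (at (x - y)) (- h))) (at y)"
    by (rule has_derivative_compose[of "\<lambda>y. x - y" "\<lambda>h. - h" _ _ "mollifier k", OF _ test_function_has_derivative[OF test_function_mollifier]])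
       (auto intro!: derivative_eq_intros)
  moreover have "linear (frechet_derivative (mollifier k) (at (x - y)))"
    using test_function_has_derivative[OF test_function_mollifier] has_derivative_linear by blast
  ultimately show ?thesis
    by (simp add: frechet_derivative_at[symmetric] mollifier_deriv_def linear_neg)
qed

lemma integrable_mollifier: "integrable lborel (mollifier k :: 'a::euclidean_space \<Rightarrow> real)"
  unfolding mollifier_def by (intro integrable_divide integrable_bump)

lemma integral_mollifier: "(\<integral>x. mollifier k (x :: 'a::euclidean_space) \<partial>lborel) = 1"
  unfolding mollifier_def using integral_bump_pos[of k, where 'a = 'a] by simp

lemma borel_measurable_mollifier [measurable]: "mollifier k \<in> borel_measurable borel"
  by (rule borel_measurable_continuous_onI[OF continuous_mollifier])

lemma nn_integral_mollifier:
  "(\<integral>\<^sup>+x. ennreal (mollifier k (x - y :: 'a::euclidean_space)) \<partial>lborel) = 1"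
proof -
  have "(\<integral>\<^sup>+x. ennreal (mollifier k (x - y)) \<partial>lborel) = (\<integral>\<^sup>+x. ennreal (mollifier k x) \<partial>(distr lborel borel ((+) (- y))))"
    by (subst nn_integral_distr) auto
  also have "\<dots> = (\<integral>\<^sup>+x. ennreal (mollifier k x) \<partial>(lborel :: 'a measure))"
    by (simp add: lborel_distr_plus)
  also have "\<dots> = ennreal (\<integral>x. mollifier k (x :: 'a) \<partial>lborel)"
    by (intro nn_integral_eq_integral integrable_mollifier) (simp add: mollifier_nonneg)
  finally show ?thesis by (simp add: integral_mollifier)
qed

lemma integral_mollifier_shift:
  "(\<integral>y. mollifier k (x - y :: 'a::euclidean_space) \<partial>lborel) = 1"
proof -
  have "(\<integral>y. mollifier k (y + - x :: 'a) \<partial>lborel) = 1"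
    by (subst integral_lborel_shift) (auto simp: integral_mollifier)
  moreover have "mollifier k (y + - x) = mollifier k (x - y)" for y
    using mollifier_minus[of k "x - y"] by (simp add: algebra_simps)
  ultimately show ?thesis by simp
qed

lemma mollifier_bounded: obtains B where "B > 0" "\<And>x. \<bar>mollifier k x\<bar> \<le> B"
  using continuous_bounded_if_zero_outside[OF continuous_mollifier, of 1 k] mollifier_eq_0'
  by (metis less_imp_le)

lemma mollifier_deriv_eq_0: "b \<in> Basis \<Longrightarrow> norm x > 1 \<Longrightarrow> mollifier_deriv k b x = 0"
  using C1_along_zero_outside[OF C1_along_mollifier] mollifier_eq_0' by (metis less_imp_le)

lemma mollifier_deriv_bounded:
  assumes "b \<in> Basis"
  obtains B where "B > 0" "\<And>x. \<bar>mollifier_deriv k b x\<bar> \<le> B"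
proof -
  have "continuous_on UNIV (mollifier_deriv k b)"
    using C1_along_mollifier[OF assms] by (auto simp: C1_along_def)
  from continuous_bounded_if_zero_outside[OF this, of 1] mollifier_deriv_eq_0[OF assms] that
  show ?thesis by metis
qed

definition mollify :: "nat \<Rightarrow> ('a::euclidean_space \<Rightarrow> real) \<Rightarrow> 'a \<Rightarrow> real" where
  "mollify k w x = (\<integral>y. w y * mollifier k (x - y) \<partial>lborel)"

definition mollify_deriv :: "nat \<Rightarrow> 'a::euclidean_space \<Rightarrow> ('a \<Rightarrow> real) \<Rightarrow> 'a \<Rightarrow> real" where
  "mollify_deriv k b w x = (\<integral>y. w y * mollifier_deriv k b (x - y) \<partial>lborel)"

lemma continuous_convolution:
  fixes K :: "'a::euclidean_space \<Rightarrow> real"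
  assumes w: "integrable lborel w" and K: "continuous_on UNIV K" "\<And>x. \<bar>K x\<bar> \<le> B"
  shows "continuous_on UNIV (\<lambda>x. \<integral>y. w y * K (x - y) \<partial>lborel)"
  unfolding continuous_on_sequentially
proof (intro allI ballI impI, elim conjE)
  fix X and a :: 'a assume X: "X \<longlonglongrightarrow> a"
  have [measurable]: "K \<in> borel_measurable borel" "w \<in> borel_measurable borel"
    using w by (auto intro: borel_measurable_continuous_onI[OF K(1)])
  have "(\<lambda>n. \<integral>y. w y * K (X n - y) \<partial>lborel) \<longlonglongrightarrow> (\<integral>y. w y * K (a - y) \<partial>lborel)"
  proof (rule integral_dominated_convergence[where w = "\<lambda>y. \<bar>w y\<bar> * B"])
    show "AE y in lborel. (\<lambda>n. w y * K (X n - y)) \<longlonglongrightarrow> w y * K (a - y)"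
      using X by (intro AE_I2 tendsto_intros continuous_on_tendsto_compose[OF K(1)]) auto
    show "AE y in lborel. norm (w y * K (X n - y)) \<le> \<bar>w y\<bar> * B" for n
      using K(2) by (auto simp: abs_mult intro!: mult_left_mono)
  qed (use w in auto)
  then show "((\<lambda>x. \<integral>y. w y * K (x - y) \<partial>lborel) \<circ> X) \<longlonglongrightarrow> (\<integral>y. w y * K (a - y) \<partial>lborel)"
    by (simp add: comp_def)
qed

lemma C1_along_mollify:
  fixes b :: "'a::euclidean_space"
  assumes b: "b \<in> Basis" and w: "integrable lborel w"
  shows "C1_along b (mollify k w) (mollify_deriv k b w)"
proof -
  obtain B where B: "\<And>x::'a. \<bar>mollifier k x\<bar> \<le> B" using mollifier_bounded by metis
  obtain B' where B': "\<And>x. \<bar>mollifier_deriv k b x\<bar> \<le> B'" using mollifier_deriv_bounded[OF b] by metis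
  have cd: "continuous_on UNIV (mollifier_deriv k b)"
    using C1_along_mollifier[OF b] by (auto simp: C1_along_def)
  then have [measurable]: "mollifier_deriv k b \<in> borel_measurable borel"
    by (rule borel_measurable_continuous_onI)
  have "((\<lambda>t. \<integral>y. w y * mollifier k (x + t *\<^sub>R b - y) \<partial>lborel) has_real_derivative
      (\<integral>y. w y * mollifier_deriv k b (x + 0 *\<^sub>R b - y) \<partial>lborel)) (at 0)" for x
  proof (rule has_real_derivative_integral[OF w])
    show "((\<lambda>t. mollifier k (x + t *\<^sub>R b - y)) has_real_derivative mollifier_deriv k b (x + t *\<^sub>R b - y)) (at t)" for t y
      using C1_along_DERIV[OF C1_along_mollifier[OF b], of k "x - y" t] by (simp add: algebra_simps)
  qed (use B B' in auto)
  then show ?thesis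
    unfolding C1_along_def mollify_def[abs_def] mollify_deriv_def[abs_def]
    using continuous_convolution[OF w continuous_mollifier B] continuous_convolution[OF w cd B'] by simp
qed

lemma continuous_mollify: "integrable lborel w \<Longrightarrow> continuous_on UNIV (mollify k w)"
  using C1_along_mollify nonempty_Basis unfolding C1_along_def by blast

lemma integrable_times_mollifier:
  fixes w :: "'a::euclidean_space \<Rightarrow> real"
  assumes "integrable lborel w"
  shows "integrable lborel (\<lambda>y. w y * mollifier k (x - y))"
proof -
  obtain B where B: "\<And>x::'a. \<bar>mollifier k x\<bar> \<le> B" using mollifier_bounded by metis
  show ?thesis
  proof (rule Bochner_Integration.integrable_bound[of _ "\<lambda>y. w y * B"])
    show "AE y in lborel. norm (w y * mollifier k (x - y)) \<le> norm (w y * B)"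
      using order_trans[OF B abs_ge_self] by (auto simp: abs_mult intro!: mult_left_mono)
  qed (use assms in auto)
qed

lemma mollify_diff:
  assumes "integrable lborel v" "integrable lborel w"
  shows "mollify k (\<lambda>x. v x - w x) x = mollify k v x - mollify k w x"
  unfolding mollify_def
  using integrable_times_mollifier[OF assms(1)] integrable_times_mollifier[OF assms(2)]
  by (simp add: left_diff_distrib)

lemma mollify_eq_0:
  fixes x :: "'a::euclidean_space"
  assumes "\<And>y. norm y > r \<Longrightarrow> w y = 0" "norm x > r + 1"
  shows "mollify k w x = 0"
proof -
  have *: "w y * mollifier k (x - y) = 0" for y
  proof (cases "norm y > r")
    case False
    then have "1 \<le> norm (x - y)" using assms(2) norm_triangle_ineq2[of x y] by linarith
    then show ?thesis by (simp add: mollifier_eq_0')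
  qed (use assms in auto)
  have "mollify k w x = (\<integral>y. 0 \<partial>(lborel :: 'a measure))"
    unfolding mollify_def by (intro Bochner_Integration.integral_cong refl *)
  then show ?thesis by simp
qed

text \<open>
  Tonelli's theorem, together with the fact that every translate of the mollifier has mass 1.
\<close>

lemma mollify_L1_contraction:
  fixes w :: "'a::euclidean_space \<Rightarrow> real"
  assumes w: "integrable lborel w"
  shows "integrable lborel (mollify k w)" and "(\<integral>x. \<bar>mollify k w x\<bar> \<partial>lborel) \<le> (\<integral>x. \<bar>w x\<bar> \<partial>lborel)"
proof -
  have [measurable]: "mollify k w \<in> borel_measurable borel" "w \<in> borel_measurable borel"
    using w by (auto intro: borel_measurable_continuous_onI[OF continuous_mollify])
  have "(\<integral>\<^sup>+x. ennreal \<bar>mollify k w x\<bar> \<partial>lborel) \<le>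
      (\<integral>\<^sup>+x. (\<integral>\<^sup>+y. ennreal \<bar>w y\<bar> * ennreal (mollifier k (x - y)) \<partial>lborel) \<partial>lborel)"
  proof (rule nn_integral_mono)
    fix x :: 'a
    have "ennreal \<bar>mollify k w x\<bar> \<le> (\<integral>\<^sup>+y. ennreal (norm (w y * mollifier k (x - y))) \<partial>lborel)"
      using integral_norm_bound_ennreal[OF integrable_times_mollifier[OF w], of k x] by (simp add: mollify_def)
    then show "ennreal \<bar>mollify k w x\<bar> \<le> (\<integral>\<^sup>+y. ennreal \<bar>w y\<bar> * ennreal (mollifier k (x - y)) \<partial>lborel)"
      by (simp add: abs_mult mollifier_nonneg ennreal_mult)
  qed
  also have "\<dots> = (\<integral>\<^sup>+y. (\<integral>\<^sup>+x. ennreal \<bar>w y\<bar> * ennreal (mollifier k (x - y)) \<partial>lborel) \<partial>lborel)"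
    by (rule lborel_pair.Fubini') measurable
  also have "\<dots> = (\<integral>\<^sup>+y. ennreal \<bar>w y\<bar> \<partial>lborel)"
    by (simp add: nn_integral_cmult nn_integral_mollifier)
  finally have le: "(\<integral>\<^sup>+x. ennreal \<bar>mollify k w x\<bar> \<partial>lborel) \<le> (\<integral>\<^sup>+y. ennreal \<bar>w y\<bar> \<partial>lborel)" .
  have fin: "(\<integral>\<^sup>+y. ennreal \<bar>w y\<bar> \<partial>lborel) = ennreal (\<integral>y. \<bar>w y\<bar> \<partial>lborel)"
    using w by (intro nn_integral_eq_integral) auto
  show int: "integrable lborel (mollify k w)"
    using le fin by (intro integrableI_bounded) (auto simp: le_less_trans)
  have "(\<integral>\<^sup>+x. ennreal \<bar>mollify k w x\<bar> \<partial>lborel) = ennreal (\<integral>x. \<bar>mollify k w x\<bar> \<partial>lborel)"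
    using int by (intro nn_integral_eq_integral) auto
  with le fin show "(\<integral>x. \<bar>mollify k w x\<bar> \<partial>lborel) \<le> (\<integral>x. \<bar>w x\<bar> \<partial>lborel)"
    by (simp add: ennreal_le_iff)
qed

section \<open>Convergence of mollifications in the mean\<close>

text \<open>
  Truncating both the values and the support of \<open>w\<close> costs little in \<open>L\<^sup>1\<close>. A measurable function is an
  almost everywhere limit of continuous functions; truncating these in the same way keeps them
  continuous and makes the convergence dominated. The truncation \<open>T n\<close> uses a continuous cut-off for
  that reason.
\<close>

lemma L1_dense_continuous:
  fixes w :: "'a::euclidean_space \<Rightarrow> real"
  assumes w: "integrable lborel w" and e: "0 < e"
  obtains h R where "continuous_on UNIV h" "\<And>x. norm x > R \<Longrightarrow> h x = 0"
    "(\<integral>x. \<bar>w x - h x\<bar> \<partial>lborel) < e"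
proof -
  have [measurable]: "w \<in> borel_measurable borel" using w by auto
  define T where "T n t x = max (- real n) (min (real n) t) * max 0 (min 1 (real n + 1 - norm x))"
    for n :: nat and t and x :: 'a
  have T_abs: "\<bar>T n t x\<bar> \<le> \<bar>t\<bar>" "\<bar>T n t x\<bar> \<le> real n" for n t x
  proof -
    have "\<bar>T n t x\<bar> \<le> \<bar>max (- real n) (min (real n) t)\<bar> * 1"
      unfolding T_def abs_mult by (intro mult_left_mono) auto
    then show "\<bar>T n t x\<bar> \<le> \<bar>t\<bar>" "\<bar>T n t x\<bar> \<le> real n" by auto
  qed
  have T_0: "T n t x = 0" if "norm x > real n + 1" for n t x
    using that by (simp add: T_def)
  have [measurable]: "(\<lambda>x. T n (f x) x) \<in> borel_measurable borel" if [measurable]: "f \<in> borel_measurable borel" for n f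
    unfolding T_def by measurable
  have "(\<lambda>n. \<integral>x. \<bar>w x - T n (w x) x\<bar> \<partial>lborel) \<longlonglongrightarrow> (\<integral>x. 0 \<partial>(lborel :: 'a measure))"
  proof (rule integral_dominated_convergence[where w = "\<lambda>x. 2 * \<bar>w x\<bar>"])
    show "AE x in lborel. norm \<bar>w x - T n (w x) x\<bar> \<le> 2 * \<bar>w x\<bar>" for n
    proof (rule AE_I2)
      show "norm \<bar>w x - T n (w x) x\<bar> \<le> 2 * \<bar>w x\<bar>" for x
        using T_abs(1)[of n "w x" x] by (simp add: abs_if split: if_splits)
    qed
    show "AE x in lborel. (\<lambda>n. \<bar>w x - T n (w x) x\<bar>) \<longlonglongrightarrow> 0"
    proof (intro AE_I2 tendsto_eventually)
      fix x
      obtain N :: nat where N: "\<bar>w x\<bar> + norm x \<le> real N" using real_arch_simple by blast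
      show "\<forall>\<^sub>F n in sequentially. \<bar>w x - T n (w x) x\<bar> = 0"
        unfolding eventually_sequentially
      proof (intro exI[of _ N] allI impI)
        fix n assume "N \<le> n"
        then have "\<bar>w x\<bar> \<le> real n" "norm x \<le> real n" using N norm_ge_zero[of x] by linarith+
        then show "\<bar>w x - T n (w x) x\<bar> = 0" by (auto simp: T_def abs_le_iff)
      qed
    qed
  qed (use w in auto)
  then have "\<forall>\<^sub>F n in sequentially. (\<integral>x. \<bar>w x - T n (w x) x\<bar> \<partial>lborel) < e / 2"
    using e by (intro order_tendstoD(2)[of _ 0]) auto
  then obtain n where n: "(\<integral>x. \<bar>w x - T n (w x) x\<bar> \<partial>lborel) < e / 2"
    by (auto simp: eventually_sequentially)
  have "w \<in> borel_measurable lebesgue" by (intro measurable_completion) simp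
  then have "w measurable_on UNIV"
    by (intro lebesgue_measurable_imp_measurable_on_real) auto
  then obtain N g where N: "negligible N" and g: "\<And>j. continuous_on UNIV (g j)"
    and lim: "\<And>x. x \<notin> N \<Longrightarrow> (\<lambda>j. g j x) \<longlonglongrightarrow> w x"
    unfolding measurable_on_def by auto
  have gm [measurable]: "g j \<in> borel_measurable borel" for j
    by (rule borel_measurable_continuous_onI[OF g])
  have N': "AE x in lborel. x \<notin> N"
  proof -
    have "AE x in lebesgue. x \<notin> N" using N by (simp add: negligible_iff_null_sets AE_not_in)
    then show ?thesis by (simp add: AE_completion_iff)
  qed
  have "(\<lambda>j. \<integral>x. \<bar>T n (w x) x - T n (g j x) x\<bar> \<partial>lborel) \<longlonglongrightarrow> (\<integral>x. 0 \<partial>(lborel :: 'a measure))"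
  proof (rule integral_dominated_convergence[where w = "\<lambda>x. 2 * real n * indicator (cball 0 (real n + 1)) x"])
    show "AE x in lborel. norm \<bar>T n (w x) x - T n (g j x) x\<bar> \<le> 2 * real n * indicator (cball 0 (real n + 1)) x" for j
    proof (rule AE_I2)
      show "norm \<bar>T n (w x) x - T n (g j x) x\<bar> \<le> 2 * real n * indicator (cball 0 (real n + 1)) x" for x
        using T_abs(2)[of n "w x" x] T_abs(2)[of n "g j x" x] T_0[of n x "w x"] T_0[of n x "g j x"]
        by (cases "norm x > real n + 1") (auto simp: indicator_def)
    qed
    show "AE x in lborel. (\<lambda>j. \<bar>T n (w x) x - T n (g j x) x\<bar>) \<longlonglongrightarrow> 0"
      using N'
    proof eventually_elim
      case (elim x)
      then have "(\<lambda>j. \<bar>T n (w x) x - T n (g j x) x\<bar>) \<longlonglongrightarrow> \<bar>T n (w x) x - T n (w x) x\<bar>"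
        unfolding T_def by (intro tendsto_intros lim)
      then show ?case by simp
    qed
    show "integrable lborel (\<lambda>x::'a. 2 * real n * indicator (cball 0 (real n + 1)) x)"
      using emeasure_bounded_finite[OF bounded_cball]
      by (intro integrable_mult_right) (simp add: integrable_indicator_iff)
  qed auto
  then have "\<forall>\<^sub>F j in sequentially. (\<integral>x. \<bar>T n (w x) x - T n (g j x) x\<bar> \<partial>lborel) < e / 2"
    using e by (intro order_tendstoD(2)[of _ 0]) auto
  then obtain j where j: "(\<integral>x. \<bar>T n (w x) x - T n (g j x) x\<bar> \<partial>lborel) < e / 2"
    by (auto simp: eventually_sequentially)
  define h where "h x = T n (g j x) x" for x
  have hc: "continuous_on UNIV h"
    unfolding h_def T_def by (intro continuous_intros g)
  have h0: "\<And>x. norm x > real n + 1 \<Longrightarrow> h x = 0" by (simp add: h_def T_0)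
  have ih: "integrable lborel h" by (rule integrable_if_zero_outside[OF hc h0])
  have iT: "integrable lborel (\<lambda>x. T n (w x) x)"
    by (rule Bochner_Integration.integrable_bound[OF w]) (use T_abs in auto)
  have "(\<integral>x. \<bar>w x - h x\<bar> \<partial>lborel) \<le> (\<integral>x. \<bar>w x - T n (w x) x\<bar> + \<bar>T n (w x) x - h x\<bar> \<partial>lborel)"
    using w ih iT by (intro integral_mono) auto
  also have "\<dots> = (\<integral>x. \<bar>w x - T n (w x) x\<bar> \<partial>lborel) + (\<integral>x. \<bar>T n (w x) x - h x\<bar> \<partial>lborel)"
    using w ih iT by (intro Bochner_Integration.integral_add) auto
  also have "\<dots> < e" using n j by (simp add: h_def)
  finally show ?thesis using that hc h0 by blast
qed

lemma integrable_mollifier_shift: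
  fixes x :: "'a::euclidean_space"
  shows "integrable lborel (\<lambda>y. mollifier k (x - y))"
proof (rule integrable_if_zero_outside[OF test_function_continuous[OF test_function_mollifier_shift]])
  fix y :: 'a assume "norm y > norm x + 1"
  then have "1 \<le> norm (x - y)" by (smt (verit) norm_minus_commute norm_triangle_ineq2)
  then show "mollifier k (x - y) = 0" by (rule mollifier_eq_0')
qed

text \<open>
  Pointwise convergence follows from continuity because the mollifier concentrates at the origin, and
  the mollified functions are uniformly bounded with supports in a fixed ball, so that dominated
  convergence applies.
\<close>

lemma mollify_continuous_L1_tendsto:
  fixes h :: "'a::euclidean_space \<Rightarrow> real"
  assumes h: "continuous_on UNIV h" "\<And>x. norm x > R \<Longrightarrow> h x = 0"
  shows "(\<lambda>k. \<integral>x. \<bar>mollify k h x - h x\<bar> \<partial>lborel) \<longlonglongrightarrow> 0"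
proof -
  have ih: "integrable lborel h" by (rule integrable_if_zero_outside[OF h])
  obtain B where B: "\<And>x. \<bar>h x\<bar> \<le> B" using continuous_bounded_if_zero_outside[OF h] by metis
  have [measurable]: "h \<in> borel_measurable borel" "mollify k h \<in> borel_measurable borel" for k
    using h(1) by (auto intro: borel_measurable_continuous_onI continuous_mollify[OF ih])
  have eq: "mollify k h x - h x = (\<integral>y. (h y - h x) * mollifier k (x - y) \<partial>lborel)" for k x
  proof -
    have im: "integrable lborel (\<lambda>y. mollifier k (x - y))"
        by (rule integrable_mollifier_shift)
    have "h x = (\<integral>y. h x * mollifier k (x - y) \<partial>lborel)"
      by (simp add: integral_mollifier_shift)
    then show ?thesis
      using integrable_times_mollifier[OF ih, of k x] im
      by (simp add: mollify_def left_diff_distrib)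
  qed
  have lim: "(\<lambda>k. \<bar>mollify k h x - h x\<bar>) \<longlonglongrightarrow> 0" for x
  proof (rule LIMSEQ_I)
    fix e :: real assume e: "0 < e"
    have "isCont h x" using h(1) by (simp add: continuous_on_eq_continuous_at)
    then obtain d where d: "d > 0" "\<And>y. norm (y - x) < d \<Longrightarrow> \<bar>h y - h x\<bar> < e / 2"
      using e unfolding isCont_def LIM_def dist_norm by (metis diff_self half_gt_zero norm_zero real_norm_def)
    obtain N :: nat where N: "1 / (real N + 1) < d"
      using d(1) by (metis add.commute nat_approx_posE of_nat_Suc)
    show "\<exists>no. \<forall>k\<ge>no. norm (\<bar>mollify k h x - h x\<bar> - 0) < e"
    proof (intro exI[of _ N] allI impI)
      fix k assume k: "N \<le> k"
      have kd: "1 / (real k + 1) < d"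
        using N k by (smt (verit) frac_le of_nat_0_le_iff of_nat_mono)
      have "\<bar>(\<integral>y. (h y - h x) * mollifier k (x - y) \<partial>lborel)\<bar> \<le> (\<integral>y. (e / 2) * mollifier k (x - y) \<partial>lborel)"
      proof (rule integral_abs_bound_integral)
        have "integrable lborel (\<lambda>y. mollifier k (x - y))"
        by (rule integrable_mollifier_shift)
        then show "integrable lborel (\<lambda>y. (e / 2) * mollifier k (x - y))"
          "integrable lborel (\<lambda>y. (h y - h x) * mollifier k (x - y))"
          using integrable_times_mollifier[OF ih, of k x] by (auto simp: left_diff_distrib)
        fix y
        show "\<bar>(h y - h x) * mollifier k (x - y)\<bar> \<le> (e / 2) * mollifier k (x - y)"
        proof (cases "norm (x - y) < d")
          case True
          then have "\<bar>h y - h x\<bar> \<le> e / 2" using d(2)[of y] by (simp add: norm_minus_commute)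
          then show ?thesis
            using mult_right_mono[OF _ mollifier_nonneg[where k = k and x = "x - y"], of "\<bar>h y - h x\<bar>" "e / 2"]
            by (simp add: abs_mult mollifier_nonneg)
        next
          case False
          then have "mollifier k (x - y) = 0" using kd by (intro mollifier_eq_0) auto
          then show ?thesis by simp
        qed
      qed
      also have "\<dots> = e / 2" by (simp add: integral_mollifier_shift)
      finally show "norm (\<bar>mollify k h x - h x\<bar> - 0) < e" using e by (simp add: eq)
    qed
  qed
  have bnd: "\<bar>mollify k h x\<bar> \<le> B" for k x
  proof -
    have "\<bar>\<integral>y. h y * mollifier k (x - y) \<partial>lborel\<bar> \<le> (\<integral>y. B * mollifier k (x - y) \<partial>lborel)"
    proof (rule integral_abs_bound_integral[OF integrable_times_mollifier[OF ih]])
      have "integrable lborel (\<lambda>y. mollifier k (x - y))"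
        by (rule integrable_mollifier_shift)
      then show "integrable lborel (\<lambda>y. B * mollifier k (x - y))" by simp
      show "\<bar>h y * mollifier k (x - y)\<bar> \<le> B * mollifier k (x - y)" for y
        using B by (simp add: abs_mult mollifier_nonneg mult_right_mono)
    qed
    then show ?thesis by (simp add: mollify_def integral_mollifier_shift)
  qed
  have "(\<lambda>k. \<integral>x. \<bar>mollify k h x - h x\<bar> \<partial>lborel) \<longlonglongrightarrow> (\<integral>x. 0 \<partial>(lborel :: 'a measure))"
  proof (rule integral_dominated_convergence[where w = "\<lambda>x. 2 * B * indicator (cball 0 (R + 1)) x"])
    show "AE x in lborel. norm \<bar>mollify k h x - h x\<bar> \<le> 2 * B * indicator (cball 0 (R + 1)) x" for k
    proof (rule AE_I2)
      show "norm \<bar>mollify k h x - h x\<bar> \<le> 2 * B * indicator (cball 0 (R + 1)) x" for x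
        using B[of x] bnd[of k x] mollify_eq_0[where w = h and r = R and x = x and k = k, OF h(2)] h(2)[of x]
        by (cases "norm x > R + 1") (auto simp: indicator_def)
    qed
    show "integrable lborel (\<lambda>x::'a. 2 * B * indicator (cball 0 (R + 1)) x)"
      using emeasure_bounded_finite[OF bounded_cball]
      by (intro integrable_mult_right) (simp add: integrable_indicator_iff)
  qed (use lim in auto)
  then show ?thesis by simp
qed

text \<open>
  Approximate \<open>w\<close> by a continuous function of bounded support; mollification does not increase the
  \<open>L\<^sup>1\<close> norm of the error.
\<close>

lemma mollify_L1_tendsto:
  fixes w :: "'a::euclidean_space \<Rightarrow> real"
  assumes w: "integrable lborel w"
  shows "(\<lambda>k. \<integral>x. \<bar>mollify k w x - w x\<bar> \<partial>lborel) \<longlonglongrightarrow> 0"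
proof (rule LIMSEQ_I)
  fix e :: real assume e: "0 < e"
  obtain h R where h: "continuous_on UNIV h" "\<And>x. norm x > R \<Longrightarrow> h x = 0"
    and wh: "(\<integral>x. \<bar>w x - h x\<bar> \<partial>lborel) < e / 3"
    using L1_dense_continuous[OF w, of "e / 3"] e by auto
  have ih: "integrable lborel h" by (rule integrable_if_zero_outside[OF h])
  have iwh: "integrable lborel (\<lambda>x. w x - h x)" using w ih by auto
  have "\<forall>\<^sub>F k in sequentially. (\<integral>x. \<bar>mollify k h x - h x\<bar> \<partial>lborel) < e / 3"
    by (rule order_tendstoD(2)[OF mollify_continuous_L1_tendsto[OF h]]) (use e in auto)
  then obtain N where N: "\<And>k. k \<ge> N \<Longrightarrow> (\<integral>x. \<bar>mollify k h x - h x\<bar> \<partial>lborel) < e / 3"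
    unfolding eventually_sequentially by blast
  show "\<exists>no. \<forall>k\<ge>no. norm ((\<integral>x. \<bar>mollify k w x - w x\<bar> \<partial>lborel) - 0) < e"
  proof (intro exI[of _ N] allI impI)
    fix k assume k: "N \<le> k"
    note i = mollify_L1_contraction(1)[OF ih, of k] mollify_L1_contraction(1)[OF iwh, of k] mollify_L1_contraction(1)[OF w, of k]
    have "(\<integral>x. \<bar>mollify k w x - w x\<bar> \<partial>lborel) \<le>
        (\<integral>x. \<bar>mollify k (\<lambda>x. w x - h x) x\<bar> + \<bar>mollify k h x - h x\<bar> + \<bar>w x - h x\<bar> \<partial>lborel)"
    proof (rule integral_mono)
      show "\<bar>mollify k w x - w x\<bar> \<le> \<bar>mollify k (\<lambda>x. w x - h x) x\<bar> + \<bar>mollify k h x - h x\<bar> + \<bar>w x - h x\<bar>" for x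
        using mollify_diff[OF w ih, of k x] by linarith
    qed (use i w ih in auto)
    also have "\<dots> = (\<integral>x. \<bar>mollify k (\<lambda>x. w x - h x) x\<bar> \<partial>lborel) +
        (\<integral>x. \<bar>mollify k h x - h x\<bar> \<partial>lborel) + (\<integral>x. \<bar>w x - h x\<bar> \<partial>lborel)"
      using i w ih by simp
    also have "\<dots> < e"
      using wh N[OF k] mollify_L1_contraction(2)[OF iwh, of k] by linarith
    finally show "norm ((\<integral>x. \<bar>mollify k w x - w x\<bar> \<partial>lborel) - 0) < e" by simp
  qed
qed

section \<open>Weak partial derivatives\<close>

definition truncate :: "real \<Rightarrow> ('a::euclidean_space \<Rightarrow> real) \<Rightarrow> 'a \<Rightarrow> real" where
  "truncate r w x = indicator (cball 0 r) x * w x"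

lemma truncate_eq [simp]: "norm x \<le> r \<Longrightarrow> truncate r w x = w x"
  and truncate_eq_0 [simp]: "r < norm x \<Longrightarrow> truncate r w x = 0"
  by (auto simp: truncate_def)

lemma borel_measurable_truncate:
  "q \<in> borel_measurable borel \<Longrightarrow> truncate r q \<in> borel_measurable borel"
  unfolding truncate_def[abs_def] by (intro borel_measurable_times borel_measurable_indicator) simp_all

text \<open>
  Weak differentiability in one coordinate direction for Borel representatives. Working with Borel
  functions and \<open>lborel\<close> makes Fubini's theorem available; the passage from and to Lebesgue measurable
  functions is made once, in the section on weak gradients.
\<close>

definition weak_partial :: "'a::euclidean_space \<Rightarrow> ('a \<Rightarrow> real) \<Rightarrow> ('a \<Rightarrow> real) \<Rightarrow> bool" where
  "weak_partial b w g \<longleftrightarrow> w \<in> borel_measurable borel \<and> g \<in> borel_measurable borel \<and>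
     (\<forall>r. integrable lborel (truncate r w)) \<and> (\<forall>r. integrable lborel (truncate r g)) \<and>
     (\<forall>\<phi>. test_function \<phi> \<longrightarrow> (\<integral>x. w x * frechet_derivative \<phi> (at x) b \<partial>lborel) = - (\<integral>x. g x * \<phi> x \<partial>lborel))"

text \<open>
  The translated mollifier is itself a test function, so the definition of the weak derivative moves
  the derivative from the mollifier to \<open>w\<close>. The kernel has radius at most 1; hence truncating at
  \<open>r + 1\<close>, which makes \<open>w\<close> globally integrable, is invisible in the ball of radius \<open>r\<close>.
\<close>

lemma mollify_deriv_eq_mollify:
  fixes b :: "'a::euclidean_space"
  assumes b: "b \<in> Basis" and wg: "weak_partial b w g" and x: "norm x \<le> r"
  shows "mollify_deriv k b (truncate (r + 1) w) x = mollify k (truncate (r + 1) g) x"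
proof -
  have far: "1 < norm (x - y)" if "r + 1 < norm y" for y
    using that x norm_triangle_ineq2[of y x] by (simp add: norm_minus_commute)
  have D: "truncate (r + 1) w y * mollifier_deriv k b (x - y) = w y * mollifier_deriv k b (x - y)" for y
    using far[of y] mollifier_deriv_eq_0[OF b, of "x - y" k] by (cases "norm y \<le> r + 1") auto
  have M: "truncate (r + 1) g y * mollifier k (x - y) = g y * mollifier k (x - y)" for y
    using far[of y] mollifier_eq_0'[of "x - y" k] by (cases "norm y \<le> r + 1") auto
  have "(\<integral>y. w y * frechet_derivative (\<lambda>y. mollifier k (x - y)) (at y) b \<partial>lborel) =
      - (\<integral>y. g y * mollifier k (x - y) \<partial>lborel)"
    using wg test_function_mollifier_shift unfolding weak_partial_def by blast
  then show ?thesis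
    unfolding mollify_def mollify_deriv_def D M by (simp add: frechet_derivative_mollifier_shift)
qed

lemma integral_tendsto_L1:
  fixes U :: "nat \<Rightarrow> 'a::euclidean_space \<Rightarrow> real"
  assumes int: "\<And>k. integrable M (U k)" "integrable M u" "\<And>k. integrable M (d k)"
    and le: "\<And>k x. \<bar>U k x - u x\<bar> \<le> C * d k x" and lim: "(\<lambda>k. \<integral>x. d k x \<partial>M) \<longlonglongrightarrow> 0"
  shows "(\<lambda>k. \<integral>x. U k x \<partial>M) \<longlonglongrightarrow> (\<integral>x. u x \<partial>M)"
proof -
  have "(\<lambda>k. (\<integral>x. U k x \<partial>M) - (\<integral>x. u x \<partial>M)) \<longlonglongrightarrow> 0"
  proof (rule Lim_null_comparison)
    show "\<forall>\<^sub>F k in sequentially. norm ((\<integral>x. U k x \<partial>M) - (\<integral>x. u x \<partial>M)) \<le> C * (\<integral>x. d k x \<partial>M)"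
    proof (intro always_eventually allI)
      fix k
      have "\<bar>\<integral>x. U k x - u x \<partial>M\<bar> \<le> (\<integral>x. C * d k x \<partial>M)"
        using int le by (intro integral_abs_bound_integral) auto
      then show "norm ((\<integral>x. U k x \<partial>M) - (\<integral>x. u x \<partial>M)) \<le> C * (\<integral>x. d k x \<partial>M)"
        using int by simp
    qed
    show "(\<lambda>k. C * (\<integral>x. d k x \<partial>M)) \<longlonglongrightarrow> 0"
      using tendsto_mult_right_zero[OF lim] by simp
  qed
  then show ?thesis by (simp add: LIM_zero_iff)
qed

text \<open>
  The identity holds classically for the mollified functions. As \<open>f\<close> is Lipschitz, \<open>f\<close> of the
  mollified functions converges in \<open>L\<^sup>1\<close>. In the product \<open>f' (w\<^sub>k) g\<^sub>k\<close> the second factor converges in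
  \<open>L\<^sup>1\<close> and the first one boundedly and almost everywhere along a subsequence, which suffices for the
  limit.
\<close>

lemma weak_partial_chain:
  fixes f f' :: "real \<Rightarrow> real"
  assumes b: "b \<in> Basis" and wg: "weak_partial b w g"
    and f: "\<And>s. (f has_real_derivative f' s) (at s)" and f': "continuous_on UNIV f'"
    and L: "\<And>s. \<bar>f' s\<bar> \<le> L"
  shows "weak_partial b (\<lambda>x. f (w x)) (\<lambda>x. f' (w x) * g x)"
proof -
  have [measurable]: "w \<in> borel_measurable borel" "g \<in> borel_measurable borel"
    and iw: "integrable lborel (truncate r w)" and ig: "integrable lborel (truncate r g)" for r
    using wg by (auto simp: weak_partial_def)
  have fc: "continuous_on UNIV f"
    using DERIV_isCont[OF f] by (simp add: continuous_on_eq_continuous_at)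
  have [measurable]: "f \<in> borel_measurable borel" "f' \<in> borel_measurable borel"
    using fc f' by (auto intro: borel_measurable_continuous_onI)
  have fw [measurable]: "(\<lambda>x. f (w x)) \<in> borel_measurable borel" "(\<lambda>x. f' (w x)) \<in> borel_measurable borel"
    by (rule measurable_compose[of w borel borel]; measurable)+
  have L0: "0 \<le> L" using L[of 0] by simp
  have lip: "\<bar>f s - f t\<bar> \<le> L * \<bar>s - t\<bar>" for s t
    using field_differentiable_bound[of UNIV f f' L s t] f L by simp
  have flin: "\<bar>f s\<bar> \<le> \<bar>f 0\<bar> + L * \<bar>s\<bar>" for s
    using lip[of s 0] by simp
  have iball: "integrable lborel (\<lambda>x::'a. c * indicator (cball 0 r) x)" for c r :: real
    using emeasure_bounded_finite[OF bounded_cball]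
    by (intro integrable_mult_right) (simp add: integrable_indicator_iff)
  have i1: "integrable lborel (truncate r (\<lambda>x. f (w x)))" for r
  proof (rule Bochner_Integration.integrable_bound)
    show "integrable lborel (\<lambda>x. \<bar>f 0\<bar> * indicator (cball 0 r) x + L * \<bar>truncate r w x\<bar>)"
      using iball[of "\<bar>f 0\<bar>" r] iw[of r] by auto
    show "AE x in lborel. norm (truncate r (\<lambda>x. f (w x)) x) \<le> norm (\<bar>f 0\<bar> * indicator (cball 0 r) x + L * \<bar>truncate r w x\<bar>)"
    proof (rule AE_I2)
      fix x
      have "\<bar>truncate r (\<lambda>x. f (w x)) x\<bar> \<le> \<bar>f 0\<bar> * indicator (cball 0 r) x + L * \<bar>truncate r w x\<bar>"
        using flin[of "w x"] L0 by (cases "norm x \<le> r") auto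
      then show "norm (truncate r (\<lambda>x. f (w x)) x) \<le> norm (\<bar>f 0\<bar> * indicator (cball 0 r) x + L * \<bar>truncate r w x\<bar>)"
        by (simp only: real_norm_def)
    qed
  qed (auto intro!: borel_measurable_truncate)
  have i2: "integrable lborel (truncate r (\<lambda>x. f' (w x) * g x))" for r
  proof (rule Bochner_Integration.integrable_bound)
    show "integrable lborel (\<lambda>x. L * truncate r g x)"
      using ig[of r] by auto
    show "AE x in lborel. norm (truncate r (\<lambda>x. f' (w x) * g x) x) \<le> norm (L * truncate r g x)"
      using L L0 by (auto simp: truncate_def indicator_def abs_mult intro!: mult_right_mono)
  qed (auto intro!: borel_measurable_truncate)
  have "(\<integral>x. f (w x) * frechet_derivative \<phi> (at x) b \<partial>lborel) = - (\<integral>x. f' (w x) * g x * \<phi> x \<partial>lborel)"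
    if \<phi>: "test_function \<phi>" for \<phi>
  proof -
    obtain R where R: "\<And>x. norm x > R \<Longrightarrow> \<phi> x = 0"
      using \<phi> compactly_supportedE unfolding test_function_def by metis
    define \<phi>' where "\<phi>' x = frechet_derivative \<phi> (at x) b" for x
    have C\<phi>: "C1_along b \<phi> \<phi>'"
      unfolding \<phi>'_def[abs_def] by (rule C1_along_test_function[OF \<phi> b])
    then have c: "continuous_on UNIV \<phi>" "continuous_on UNIV \<phi>'" by (auto simp: C1_along_def)
    have R': "\<And>x. norm x > R \<Longrightarrow> \<phi>' x = 0" using C1_along_zero_outside[OF C\<phi> R] by blast
    have [measurable]: "\<phi> \<in> borel_measurable borel" "\<phi>' \<in> borel_measurable borel"
      using c by (auto intro: borel_measurable_continuous_onI)
    obtain B where B: "B > 0" "\<And>x. \<bar>\<phi> x\<bar> \<le> B"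
      using continuous_bounded_if_zero_outside[OF c(1) R] by metis
    obtain B' where B': "B' > 0" "\<And>x. \<bar>\<phi>' x\<bar> \<le> B'"
      using continuous_bounded_if_zero_outside[OF c(2) R'] by metis
    define v where "v = truncate (R + 1) w"
    define h where "h = truncate (R + 1) g"
    have iv: "integrable lborel v" and ih: "integrable lborel h" by (auto simp: v_def h_def iw ig)
    have [measurable]: "v \<in> borel_measurable borel" "h \<in> borel_measurable borel"
      using iv ih by auto
    have [measurable]: "mollify k v \<in> borel_measurable borel" "mollify k h \<in> borel_measurable borel" for k
      by (auto intro: borel_measurable_continuous_onI continuous_mollify iv ih)
    have lv: "(\<lambda>k. \<integral>x. \<bar>mollify k v x - v x\<bar> \<partial>lborel) \<longlonglongrightarrow> 0"
      and lh: "(\<lambda>k. \<integral>x. \<bar>mollify k h x - h x\<bar> \<partial>lborel) \<longlonglongrightarrow> 0"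
      by (auto intro: mollify_L1_tendsto iv ih)
    have dv: "integrable lborel (\<lambda>x. \<bar>mollify k v x - v x\<bar>)" and dh: "integrable lborel (\<lambda>x. \<bar>mollify k h x - h x\<bar>)" for k
      by (intro integrable_abs Bochner_Integration.integrable_diff mollify_L1_contraction(1) iv ih)+
    obtain s where s: "strict_mono s" and ae: "AE x in lborel. (\<lambda>n. mollify (s n) v x - v x) \<longlonglongrightarrow> 0"
      using tendsto_L1_AE_subseq[of lborel "\<lambda>k x. mollify k v x - v x"] lv
        mollify_L1_contraction(1)[OF iv] iv by auto
    have iv1: "integrable lborel (\<lambda>x. f (v x) * \<phi>' x)"
    proof (rule Bochner_Integration.integrable_bound)
      show "integrable lborel (\<lambda>x. B' * (\<bar>f 0\<bar> * indicator (cball 0 R) x + L * \<bar>v x\<bar>))"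
        using iball[of "\<bar>f 0\<bar>" R] iv by auto
      show "AE x in lborel. norm (f (v x) * \<phi>' x) \<le> norm (B' * (\<bar>f 0\<bar> * indicator (cball 0 R) x + L * \<bar>v x\<bar>))"
      proof (rule AE_I2)
        fix x
        have "\<bar>f (v x) * \<phi>' x\<bar> \<le> B' * (\<bar>f 0\<bar> * indicator (cball 0 R) x + L * \<bar>v x\<bar>)"
        proof (cases "norm x > R")
          case True
          then show ?thesis using R' B'(1) L0 by simp
        next
          case False
          have "\<bar>f (v x)\<bar> * \<bar>\<phi>' x\<bar> \<le> (\<bar>f 0\<bar> + L * \<bar>v x\<bar>) * B'"
            using flin B' L0 by (intro mult_mono) auto
          with False show ?thesis by (simp add: abs_mult mult.commute)
        qed
        then show "norm (f (v x) * \<phi>' x) \<le> norm (B' * (\<bar>f 0\<bar> * indicator (cball 0 R) x + L * \<bar>v x\<bar>))"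
          by (simp only: real_norm_def)
      qed
    qed measurable
    have "(\<lambda>k. \<integral>x. f (mollify k v x) * \<phi>' x \<partial>lborel) \<longlonglongrightarrow> (\<integral>x. f (v x) * \<phi>' x \<partial>lborel)"
    proof (rule integral_tendsto_L1[OF _ iv1 dv _ lv])
      show "integrable lborel (\<lambda>x. f (mollify k v x) * \<phi>' x)" for k
        using R' c(2) continuous_mollify[OF iv, of k]
        by (intro integrable_if_zero_outside[where R = R] continuous_intros continuous_on_compose2[OF fc]) auto
      show "\<bar>f (mollify k v x) * \<phi>' x - f (v x) * \<phi>' x\<bar> \<le> (L * B') * \<bar>mollify k v x - v x\<bar>" for k x
      proof -
        have "\<bar>f (mollify k v x) - f (v x)\<bar> * \<bar>\<phi>' x\<bar> \<le> (L * \<bar>mollify k v x - v x\<bar>) * B'"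
          using lip B' L0 by (intro mult_mono) auto
        then have "\<bar>(f (mollify k v x) - f (v x)) * \<phi>' x\<bar> \<le> (L * B') * \<bar>mollify k v x - v x\<bar>"
          unfolding abs_mult by (simp only: mult_ac)
        then show ?thesis by (simp only: left_diff_distrib)
      qed
    qed
    then have lim1: "(\<lambda>k. \<integral>x. f (mollify (s k) v x) * \<phi>' x \<partial>lborel) \<longlonglongrightarrow> (\<integral>x. f (v x) * \<phi>' x \<partial>lborel)"
      using LIMSEQ_subseq_LIMSEQ[OF _ s] by (fastforce simp: comp_def)
    have ihm: "integrable lborel (\<lambda>x. f' (mollify k v x) * h x * \<phi> x)"
      "integrable lborel (\<lambda>x. f' (mollify k v x) * (mollify k h x - h x) * \<phi> x)"
      "integrable lborel (\<lambda>x. f' (mollify k v x) * mollify k h x * \<phi> x)" for k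
    proof -
      have *: "integrable lborel (\<lambda>x. f' (mollify k v x) * q x * \<phi> x)" if q: "integrable lborel q" for q
      proof (rule Bochner_Integration.integrable_bound[OF integrable_mult_right[OF integrable_mult_right[OF q]]])
        show "AE x in lborel. norm (f' (mollify k v x) * q x * \<phi> x) \<le> norm (L * (B * q x))"
        proof (rule AE_I2)
          fix x
          have "(\<bar>f' (mollify k v x)\<bar> * \<bar>q x\<bar>) * \<bar>\<phi> x\<bar> \<le> (L * \<bar>q x\<bar>) * B"
            using L B L0 by (intro mult_mono) auto
          then show "norm (f' (mollify k v x) * q x * \<phi> x) \<le> norm (L * (B * q x))"
            using L0 B(1) by (simp add: abs_mult mult_ac)
        qed
      qed (use q in measurable)
      show "integrable lborel (\<lambda>x. f' (mollify k v x) * h x * \<phi> x)"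
        "integrable lborel (\<lambda>x. f' (mollify k v x) * (mollify k h x - h x) * \<phi> x)"
        "integrable lborel (\<lambda>x. f' (mollify k v x) * mollify k h x * \<phi> x)"
        using ih mollify_L1_contraction(1)[OF ih] by (auto intro!: *)
    qed
    have "(\<lambda>k. \<integral>x. f' (mollify k v x) * (mollify k h x - h x) * \<phi> x \<partial>lborel) \<longlonglongrightarrow> (\<integral>x. 0 \<partial>(lborel :: 'a measure))"
    proof (rule integral_tendsto_L1[OF ihm(2) _ dh _ lh])
      show "\<bar>f' (mollify k v x) * (mollify k h x - h x) * \<phi> x - 0\<bar> \<le> (L * B) * \<bar>mollify k h x - h x\<bar>" for k x
      proof -
        have "(\<bar>f' (mollify k v x)\<bar> * \<bar>mollify k h x - h x\<bar>) * \<bar>\<phi> x\<bar> \<le> (L * \<bar>mollify k h x - h x\<bar>) * B"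
          using L B L0 by (intro mult_mono) auto
        then show ?thesis by (simp add: abs_mult mult_ac)
      qed
    qed auto
    then have lim2: "(\<lambda>k. \<integral>x. f' (mollify (s k) v x) * (mollify (s k) h x - h x) * \<phi> x \<partial>lborel) \<longlonglongrightarrow> 0"
      using LIMSEQ_subseq_LIMSEQ[OF _ s] by (fastforce simp: comp_def)
    have lim3: "(\<lambda>k. \<integral>x. f' (mollify (s k) v x) * h x * \<phi> x \<partial>lborel) \<longlonglongrightarrow> (\<integral>x. f' (v x) * h x * \<phi> x \<partial>lborel)"
    proof (rule integral_dominated_convergence[where w = "\<lambda>x. L * B * \<bar>h x\<bar>"])
      show "AE x in lborel. (\<lambda>k. f' (mollify (s k) v x) * h x * \<phi> x) \<longlonglongrightarrow> f' (v x) * h x * \<phi> x"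
        using ae
      proof eventually_elim
        case (elim x)
        then have "(\<lambda>k. mollify (s k) v x) \<longlonglongrightarrow> v x" by (simp add: LIM_zero_iff)
        then show ?case
          by (intro tendsto_intros continuous_on_tendsto_compose[OF f']) auto
      qed
      show "AE x in lborel. norm (f' (mollify (s k) v x) * h x * \<phi> x) \<le> L * B * \<bar>h x\<bar>" for k
      proof (rule AE_I2)
        fix x
        have "(\<bar>f' (mollify (s k) v x)\<bar> * \<bar>h x\<bar>) * \<bar>\<phi> x\<bar> \<le> (L * \<bar>h x\<bar>) * B"
          using L B L0 by (intro mult_mono) auto
        then show "norm (f' (mollify (s k) v x) * h x * \<phi> x) \<le> L * B * \<bar>h x\<bar>"
          by (simp add: abs_mult mult_ac)
      qed
    qed (use ih in auto)
    have parts: "(\<integral>x. f (mollify k v x) * \<phi>' x \<partial>lborel) = - (\<integral>x. f' (mollify k v x) * mollify k h x * \<phi> x \<partial>lborel)" for k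
    proof -
      have "(\<integral>x. f' (mollify k v x) * mollify_deriv k b v x * \<phi> x \<partial>lborel) = - (\<integral>x. f (mollify k v x) * \<phi>' x \<partial>lborel)"
        by (rule integral_by_parts_along[OF C1_along_compose[OF C1_along_mollify[OF b iv] f f'] C\<phi> R])
      moreover have "f' (mollify k v x) * mollify_deriv k b v x * \<phi> x = f' (mollify k v x) * mollify k h x * \<phi> x" for x
        using mollify_deriv_eq_mollify[OF b wg, of x R k] R[of x] by (cases "norm x \<le> R") (auto simp: v_def h_def)
      ultimately show ?thesis by simp
    qed
    have "(\<integral>x. f (mollify (s k) v x) * \<phi>' x \<partial>lborel) = - ((\<integral>x. f' (mollify (s k) v x) * h x * \<phi> x \<partial>lborel) +
       (\<integral>x. f' (mollify (s k) v x) * (mollify (s k) h x - h x) * \<phi> x \<partial>lborel))" for k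
      unfolding parts Bochner_Integration.integral_add[OF ihm(1) ihm(2), symmetric] by (simp add: algebra_simps)
    then have "(\<lambda>k. \<integral>x. f (mollify (s k) v x) * \<phi>' x \<partial>lborel) \<longlonglongrightarrow> - ((\<integral>x. f' (v x) * h x * \<phi> x \<partial>lborel) + 0)"
      using tendsto_minus[OF tendsto_add[OF lim3 lim2]] by simp
    then have "(\<integral>x. f (v x) * \<phi>' x \<partial>lborel) = - (\<integral>x. f' (v x) * h x * \<phi> x \<partial>lborel)"
      using LIMSEQ_unique[OF lim1] by simp
    moreover have e1: "f (v x) * \<phi>' x = f (w x) * \<phi>' x" for x
      using R'[of x] by (cases "norm x \<le> R") (auto simp: v_def)
    moreover have e2: "f' (v x) * h x * \<phi> x = f' (w x) * g x * \<phi> x" for x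
      using R[of x] by (cases "norm x \<le> R") (auto simp: v_def h_def)
    ultimately show ?thesis unfolding \<phi>'_def e1 e2 by simp
  qed
  with i1 i2 show ?thesis unfolding weak_partial_def by auto
qed

text \<open>
  This extends the defining identity from smooth test functions to \<open>C\<^sup>1\<close> functions \<open>A\<close> of arbitrary
  support. Mollifying \<open>\<psi>\<close>, which has bounded support, avoids having to smooth or cut off \<open>A\<close>.
\<close>

lemma weak_partial_by_parts:
  fixes \<psi> :: "'a::euclidean_space \<Rightarrow> real"
  assumes b: "b \<in> Basis" and wp: "weak_partial b \<psi> h"
    and zero: "\<And>x. norm x > r \<Longrightarrow> \<psi> x = 0" "\<And>x. norm x > r \<Longrightarrow> h x = 0"
    and A: "C1_along b A A'"
  shows "(\<integral>x. A' x * \<psi> x \<partial>lborel) = - (\<integral>x. A x * h x \<partial>lborel)"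
proof -
  have tr: "truncate q \<psi> = \<psi>" "truncate q h = h" if "q \<ge> r" for q
    using zero that by (auto simp: fun_eq_iff truncate_def indicator_def)
  have i: "integrable lborel \<psi>" "integrable lborel h"
    using wp tr[of r] unfolding weak_partial_def by (metis order_refl)+
  have [measurable]: "\<psi> \<in> borel_measurable borel" "h \<in> borel_measurable borel" using i by auto
  have Ac: "continuous_on UNIV A" "continuous_on UNIV A'" using A by (auto simp: C1_along_def)
  have D: "mollify_deriv k b \<psi> x = mollify k h x" for k x
    using mollify_deriv_eq_mollify[OF b wp, of x "max r (norm x)" k] tr[of "max r (norm x) + 1"] by simp
  have z: "mollify k \<psi> x = 0" "mollify k h x = 0" if "norm x > r + 1" for k x
    using that mollify_eq_0[where r = r and x = x and k = k] zero by auto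
  have parts: "(\<integral>x. A' x * mollify k \<psi> x \<partial>lborel) = - (\<integral>x. A x * mollify k h x \<partial>lborel)" for k
    using integral_by_parts_along[OF A C1_along_mollify[OF b i(1)] z(1)] by (simp add: D)
  have lim: "(\<lambda>k. \<integral>x. Q x * mollify k q x \<partial>lborel) \<longlonglongrightarrow> (\<integral>x. Q x * q x \<partial>lborel)"
    if Q: "continuous_on UNIV Q" and q: "integrable lborel q" "\<And>x. norm x > r \<Longrightarrow> q x = 0" for Q q :: "'a \<Rightarrow> real"
  proof -
    have [measurable]: "Q \<in> borel_measurable borel" "q \<in> borel_measurable borel"
      using Q q(1) by (auto intro: borel_measurable_continuous_onI)
    have "compact (Q ` cball 0 (r + 1))"
      using Q by (intro compact_continuous_image) (auto intro: continuous_on_subset)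
    then obtain B where B: "B > 0" "\<And>y. y \<in> Q ` cball 0 (r + 1) \<Longrightarrow> \<bar>y\<bar> \<le> B"
      using compact_imp_bounded bounded_pos by (metis real_norm_def)
    have qz: "q x = 0" "mollify k q x = 0" if "norm x > r + 1" for k x
      using that mollify_eq_0[where w = q and r = r and x = x and k = k] q(2) by auto
    have QB: "\<bar>Q x\<bar> \<le> B" if "norm x \<le> r + 1" for x using B(2) that by auto
    show ?thesis
    proof (rule integral_tendsto_L1[where d = "\<lambda>k x. \<bar>mollify k q x - q x\<bar>" and C = B])
      show "integrable lborel (\<lambda>x. Q x * mollify k q x)" for k
        using qz(2) by (intro integrable_if_zero_outside[where R = "r + 1"] continuous_intros Q continuous_mollify q(1)) auto
      show "integrable lborel (\<lambda>x. Q x * q x)"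
      proof (rule Bochner_Integration.integrable_bound[OF integrable_mult_right[OF q(1)]])
        show "AE x in lborel. norm (Q x * q x) \<le> norm (B * q x)"
        proof (rule AE_I2)
          show "norm (Q x * q x) \<le> norm (B * q x)" for x
            using QB[of x] qz(1)[of x] B(1) by (cases "norm x > r + 1") (auto simp: abs_mult intro: mult_right_mono)
        qed
      qed measurable
      show "integrable lborel (\<lambda>x. \<bar>mollify k q x - q x\<bar>)" for k
        using mollify_L1_contraction(1)[OF q(1)] q(1) by auto
      show "(\<lambda>k. \<integral>x. \<bar>mollify k q x - q x\<bar> \<partial>lborel) \<longlonglongrightarrow> 0" by (rule mollify_L1_tendsto[OF q(1)])
      show "\<bar>Q x * mollify k q x - Q x * q x\<bar> \<le> B * \<bar>mollify k q x - q x\<bar>" for k x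
        using QB[of x] qz[of x] B(1)
        by (cases "norm x > r + 1") (auto simp: abs_mult right_diff_distrib[symmetric] intro: mult_right_mono)
    qed
  qed
  have "(\<lambda>k. \<integral>x. A' x * mollify k \<psi> x \<partial>lborel) \<longlonglongrightarrow> (\<integral>x. A' x * \<psi> x \<partial>lborel)"
    by (rule lim[OF Ac(2) i(1) zero(1)])
  moreover have "(\<lambda>k. \<integral>x. A' x * mollify k \<psi> x \<partial>lborel) \<longlonglongrightarrow> - (\<integral>x. A x * h x \<partial>lborel)"
    unfolding parts by (rule tendsto_minus[OF lim[OF Ac(1) i(2) zero(2)]])
  ultimately show ?thesis by (rule LIMSEQ_unique)
qed

section \<open>Weak gradients\<close>

lemma integrable_times_continuous:
  fixes w c :: "'a::euclidean_space \<Rightarrow> real"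
  assumes w: "integrable lborel (truncate R w)" and c: "continuous_on UNIV c" "\<And>x. norm x > R \<Longrightarrow> c x = 0"
  shows "integrable lborel (\<lambda>x. w x * c x)"
proof -
  obtain B where B: "B > 0" "\<And>x. \<bar>c x\<bar> \<le> B"
    using continuous_bounded_if_zero_outside[OF c] by metis
  have [measurable]: "c \<in> borel_measurable borel" using c(1) by (rule borel_measurable_continuous_onI)
  have eq: "w x * c x = truncate R w x * c x" for x
    using c(2)[of x] by (cases "norm x \<le> R") auto
  show ?thesis unfolding eq
  proof (rule Bochner_Integration.integrable_bound[OF integrable_mult_left[OF w, of B]])
    show "AE x in lborel. norm (truncate R w x * c x) \<le> norm (truncate R w x * B)"
      using order_trans[OF B(2) abs_ge_self] by (auto simp: abs_mult intro!: mult_left_mono)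
  qed (use w in measurable)
qed

lemma weak_partialD:
  assumes "weak_partial b w g"
  shows "w \<in> borel_measurable borel" "g \<in> borel_measurable borel"
    "integrable lborel (truncate r w)" "integrable lborel (truncate r g)"
    "test_function \<phi> \<Longrightarrow> (\<integral>x. w x * frechet_derivative \<phi> (at x) b \<partial>lborel) = - (\<integral>x. g x * \<phi> x \<partial>lborel)"
  using assms unfolding weak_partial_def by blast+

lemma weak_partial_C1:
  assumes v: "C1_along b v v'" and b: "b \<in> Basis"
  shows "weak_partial b v v'"
  unfolding weak_partial_def
proof (intro conjI allI impI)
  have c: "continuous_on UNIV v" "continuous_on UNIV v'" using v by (auto simp: C1_along_def)
  then show "v \<in> borel_measurable borel" "v' \<in> borel_measurable borel"
    by (auto intro: borel_measurable_continuous_onI)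
  have "integrable lborel (\<lambda>x. indicator (cball 0 r) x *\<^sub>R q x)"
    if "continuous_on UNIV q" for r and q :: "'a \<Rightarrow> real"
    by (rule borel_integrable_compact[OF compact_cball continuous_on_subset[OF that subset_UNIV]])
  from this[OF c(1)] this[OF c(2)]
  show "integrable lborel (truncate r v)" "integrable lborel (truncate r v')" for r
    by (simp_all add: truncate_def[abs_def])
  fix \<phi> :: "'a \<Rightarrow> real" assume \<phi>: "test_function \<phi>"
  then obtain R where R: "\<And>x. norm x > R \<Longrightarrow> \<phi> x = 0"
    using compactly_supportedE unfolding test_function_def by metis
  show "(\<integral>x. v x * frechet_derivative \<phi> (at x) b \<partial>lborel) = - (\<integral>x. v' x * \<phi> x \<partial>lborel)"
    using integral_by_parts_along[OF v C1_along_test_function[OF \<phi> b] R] by simp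
qed

lemma weak_partial_diff:
  assumes b: "b \<in> Basis" and w: "weak_partial b w g" and v: "weak_partial b v h"
  shows "weak_partial b (\<lambda>x. w x - v x) (\<lambda>x. g x - h x)"
  unfolding weak_partial_def
proof (intro conjI allI impI)
  note W = weak_partialD[OF w] and V = weak_partialD[OF v]
  show "(\<lambda>x. w x - v x) \<in> borel_measurable borel" "(\<lambda>x. g x - h x) \<in> borel_measurable borel"
    using W(1,2) V(1,2) by auto
  show "integrable lborel (truncate r (\<lambda>x. w x - v x))" "integrable lborel (truncate r (\<lambda>x. g x - h x))" for r
    using W(3,4)[of r] V(3,4)[of r] by (simp_all add: truncate_def[abs_def] right_diff_distrib)
  fix \<phi> :: "'a \<Rightarrow> real" assume \<phi>: "test_function \<phi>"
  then obtain R where R: "\<And>x. norm x > R \<Longrightarrow> \<phi> x = 0"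
    using compactly_supportedE unfolding test_function_def by metis
  note C = C1_along_test_function[OF \<phi> b]
  have R': "\<And>x. norm x > R \<Longrightarrow> frechet_derivative \<phi> (at x) b = 0"
    using C1_along_zero_outside[OF C R] by blast
  have c: "continuous_on UNIV \<phi>" "continuous_on UNIV (\<lambda>x. frechet_derivative \<phi> (at x) b)"
    using C by (auto simp: C1_along_def)
  have "integrable lborel (\<lambda>x. w x * frechet_derivative \<phi> (at x) b)" "integrable lborel (\<lambda>x. v x * frechet_derivative \<phi> (at x) b)"
    "integrable lborel (\<lambda>x. g x * \<phi> x)" "integrable lborel (\<lambda>x. h x * \<phi> x)"
    using c R R' by (auto intro!: integrable_times_continuous[where R = R] W(3,4) V(3,4))
  then show "(\<integral>x. (w x - v x) * frechet_derivative \<phi> (at x) b \<partial>lborel) = - (\<integral>x. (g x - h x) * \<phi> x \<partial>lborel)"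
    using W(5)[OF \<phi>] V(5)[OF \<phi>] by (simp add: left_diff_distrib)
qed

lemma integral_lebesgue_eq_lborel:
  fixes f g :: "'a::euclidean_space \<Rightarrow> real"
  assumes "AE x in lebesgue. f x = g x" "f \<in> borel_measurable lebesgue" "g \<in> borel_measurable borel"
  shows "(LINT x|lebesgue. f x) = (LINT x|lborel. g x)"
proof -
  have g: "g \<in> borel_measurable lebesgue" using assms(3) by (intro measurable_completion) simp
  have "(LINT x|lebesgue. f x) = (LINT x|lebesgue. g x)"
    using assms g by (intro integral_cong_AE) auto
  also have "\<dots> = (LINT x|lborel. g x)"
    using assms(3) by (intro integral_completion) simp
  finally show ?thesis .
qed

lemma integrable_lebesgue_iff_lborel:
  fixes f g :: "'a::euclidean_space \<Rightarrow> real"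
  assumes "AE x in lebesgue. f x = g x" "f \<in> borel_measurable lebesgue" "g \<in> borel_measurable borel"
  shows "integrable lebesgue f \<longleftrightarrow> integrable lborel g"
proof -
  have g: "g \<in> borel_measurable lebesgue" using assms(3) by (intro measurable_completion) simp
  have "integrable lebesgue f \<longleftrightarrow> integrable lebesgue g"
    using assms g by (intro integrable_cong_AE) auto
  also have "\<dots> \<longleftrightarrow> integrable lborel g"
    using assms(3) by (intro integrable_completion) simp
  finally show ?thesis .
qed

lemma has_weak_gradientD:
  assumes "has_weak_gradient u G" "test_function \<phi>" "b \<in> Basis"
  shows "(LINT x|lebesgue. u x * frechet_derivative \<phi> (at x) b) = - (LINT x|lebesgue. (G x \<bullet> b) * \<phi> x)"
  using assms(1)[unfolded has_weak_gradient_def, THEN conjunct2, THEN conjunct2, rule_format, OF assms(2,3)] .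

lemma borel_measurable_lebesgueI:
  "g \<in> borel_measurable borel \<Longrightarrow> g \<in> borel_measurable lebesgue"
  by (intro measurable_completion) simp

lemma integral_lebesgue_eq_lborel_mult:
  fixes a a' c :: "'a::euclidean_space \<Rightarrow> real"
  assumes ae: "AE x in lebesgue. a x = a' x" and m: "a \<in> borel_measurable lebesgue" "a' \<in> borel_measurable borel"
    and c: "c \<in> borel_measurable borel"
  shows "(LINT x|lebesgue. a x * c x) = (LINT x|lborel. a' x * c x)"
proof (rule integral_lebesgue_eq_lborel)
  show "AE x in lebesgue. a x * c x = a' x * c x" using ae by eventually_elim simp
  show "(\<lambda>x. a x * c x) \<in> borel_measurable lebesgue"
    using m(1) borel_measurable_lebesgueI[OF c] by (rule borel_measurable_times)
  show "(\<lambda>x. a' x * c x) \<in> borel_measurable borel"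
    using m(2) c by (rule borel_measurable_times)
qed

lemma has_weak_gradient_representatives:
  fixes u :: "'a::euclidean_space \<Rightarrow> real"
  assumes uG: "has_weak_gradient u G" and u: "u \<in> borel_measurable lebesgue" and G: "G \<in> borel_measurable lebesgue"
  obtains u' g where "AE x in lebesgue. u x = u' x"
    "\<And>b. b \<in> Basis \<Longrightarrow> AE x in lebesgue. G x \<bullet> b = g b x"
    "\<And>b. b \<in> Basis \<Longrightarrow> weak_partial b u' (g b)"
proof -
  obtain u' where u': "u' \<in> borel_measurable borel" "AE x in lebesgue. u x = u' x"
    using completion_ex_borel_measurable_real[OF u] by (auto simp: AE_completion)
  have "\<exists>h. h \<in> borel_measurable borel \<and> (AE x in lebesgue. G x \<bullet> b = h x)" for b
  proof -
    have "(\<lambda>x. G x \<bullet> b) \<in> borel_measurable lebesgue" using G by simp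
    from completion_ex_borel_measurable_real[OF this] show ?thesis by (auto simp: AE_completion)
  qed
  then obtain g where g: "\<And>b. g b \<in> borel_measurable borel" "\<And>b. AE x in lebesgue. G x \<bullet> b = g b x"
    by metis
  have "weak_partial b u' (g b)" if b: "b \<in> Basis" for b
    unfolding weak_partial_def
  proof (intro conjI allI impI u'(1) g(1))
    fix r :: real
    have "integrable lebesgue (\<lambda>x. indicator (cball 0 r) x *\<^sub>R u x)" "integrable lebesgue (\<lambda>x. indicator (cball 0 r) x *\<^sub>R G x)"
      using uG unfolding has_weak_gradient_def locally_integrable_def set_integrable_def by auto
    then have i: "integrable lebesgue (truncate r u)" "integrable lebesgue (truncate r (\<lambda>x. G x \<bullet> b))"
      using integrable_inner_left[of b lebesgue "\<lambda>x. indicator (cball 0 r) x *\<^sub>R G x"]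
      by (simp_all add: truncate_def[abs_def])
    have ae1: "AE x in lebesgue. truncate r u x = truncate r u' x"
      using u'(2) by eventually_elim (simp add: truncate_def)
    show "integrable lborel (truncate r u')"
      by (rule iffD1[OF integrable_lebesgue_iff_lborel[OF ae1 borel_measurable_integrable[OF i(1)] borel_measurable_truncate[OF u'(1)]] i(1)])
    have ae2: "AE x in lebesgue. truncate r (\<lambda>x. G x \<bullet> b) x = truncate r (g b) x"
      using g(2)[of b] by eventually_elim (simp add: truncate_def)
    show "integrable lborel (truncate r (g b))"
      by (rule iffD1[OF integrable_lebesgue_iff_lborel[OF ae2 borel_measurable_integrable[OF i(2)] borel_measurable_truncate[OF g(1)]] i(2)])
  next
    fix \<phi> :: "'a \<Rightarrow> real" assume \<phi>: "test_function \<phi>"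
    have "C1_along b \<phi> (\<lambda>x. frechet_derivative \<phi> (at x) b)" by (rule C1_along_test_function[OF \<phi> b])
    then have m: "\<phi> \<in> borel_measurable borel" "(\<lambda>x. frechet_derivative \<phi> (at x) b) \<in> borel_measurable borel"
      unfolding C1_along_def by (auto intro: borel_measurable_continuous_onI)
    have "(LINT x|lebesgue. u x * frechet_derivative \<phi> (at x) b) = (LINT x|lborel. u' x * frechet_derivative \<phi> (at x) b)"
      by (rule integral_lebesgue_eq_lborel_mult[OF u'(2) u u'(1) m(2)])
    moreover have "(LINT x|lebesgue. (G x \<bullet> b) * \<phi> x) = (LINT x|lborel. g b x * \<phi> x)"
      using G by (intro integral_lebesgue_eq_lborel_mult[OF g(2) _ g(1) m(1)]) auto
    ultimately show "(\<integral>x. u' x * frechet_derivative \<phi> (at x) b \<partial>lborel) = - (\<integral>x. g b x * \<phi> x \<partial>lborel)"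
      using has_weak_gradientD[OF uG \<phi> b] by simp
  qed
  with u'(2) g(2) show ?thesis by (rule that)
qed

lemma has_weak_gradientI:
  fixes u :: "'a::euclidean_space \<Rightarrow> real"
  assumes u: "u \<in> borel_measurable lebesgue" and G: "G \<in> borel_measurable lebesgue"
    and u': "AE x in lebesgue. u x = u' x"
    and g: "\<And>b. b \<in> Basis \<Longrightarrow> AE x in lebesgue. G x \<bullet> b = g b x"
    and wp: "\<And>b. b \<in> Basis \<Longrightarrow> weak_partial b u' (g b)"
  shows "has_weak_gradient u G"
proof -
  have trunc: "integrable lebesgue (\<lambda>x. indicator K x *\<^sub>R q x)"
    if K: "compact K" and q: "q \<in> borel_measurable lebesgue" "AE x in lebesgue. q x = q' x"
      and q': "\<And>r. integrable lborel (truncate r q')" "q' \<in> borel_measurable borel"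
    for K and q q' :: "'a \<Rightarrow> real"
  proof -
    obtain r where "\<forall>x\<in>K. norm x \<le> r" using compact_imp_bounded[OF K] by (auto simp: bounded_iff)
    then have r: "K \<subseteq> cball 0 r" by auto
    have m: "truncate r q' \<in> borel_measurable borel" using q'(1)[of r] by auto
    have ae: "AE x in lebesgue. truncate r q x = truncate r q' x"
      using q(2) by eventually_elim (simp add: truncate_def)
    have qm: "truncate r q \<in> borel_measurable lebesgue"
      unfolding truncate_def[abs_def] by (intro borel_measurable_times borel_measurable_indicator q(1)) simp
    have "integrable lebesgue (truncate r q)"
      by (rule iffD2[OF integrable_lebesgue_iff_lborel[OF ae qm m] q'(1)])
    then have "set_integrable lebesgue (cball 0 r) q"
      by (simp add: set_integrable_def truncate_def[abs_def])
    moreover have "K \<in> sets lebesgue" using fmeasurableD[OF lmeasurable_compact[OF K]] .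
    ultimately show ?thesis
      using set_integrable_subset[of lebesgue "cball 0 r" q K, OF _ _ r] by (simp only: set_integrable_def)
  qed
  obtain b0 :: 'a where b0: "b0 \<in> Basis" using nonempty_Basis by blast
  have "locally_integrable u"
    unfolding locally_integrable_def set_integrable_def
    by (intro allI impI trunc[OF _ u u' weak_partialD(3)[OF wp[OF b0]] weak_partialD(1)[OF wp[OF b0]]])
  moreover have "locally_integrable G"
    unfolding locally_integrable_def set_integrable_def
  proof (intro allI impI)
    fix K :: "'a set" assume K: "compact K"
    have "integrable lebesgue (\<lambda>x. indicator K x *\<^sub>R (G x \<bullet> b))" if b: "b \<in> Basis" for b
      using G by (intro trunc[OF K _ g[OF b] weak_partialD(4)[OF wp[OF b]] weak_partialD(2)[OF wp[OF b]]]) auto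
    then have "integrable lebesgue (\<lambda>x. \<Sum>b\<in>Basis. (indicator K x *\<^sub>R (G x \<bullet> b)) *\<^sub>R b)"
      by (intro Bochner_Integration.integrable_sum integrable_scaleR_left)
    moreover have "(\<Sum>b\<in>Basis. (indicator K x *\<^sub>R (G x \<bullet> b)) *\<^sub>R b) = indicator K x *\<^sub>R G x" for x
    proof -
      have "(\<Sum>b\<in>Basis. (indicator K x *\<^sub>R (G x \<bullet> b)) *\<^sub>R b) = indicator K x *\<^sub>R (\<Sum>b\<in>Basis. (G x \<bullet> b) *\<^sub>R b)"
        by (simp add: scaleR_sum_right)
      then show ?thesis by (simp only: euclidean_representation)
    qed
    ultimately show "integrable lebesgue (\<lambda>x. indicat_real K x *\<^sub>R G x)" by (simp only:)
  qed
  moreover have "(LINT x|lebesgue. u x * frechet_derivative \<phi> (at x) b) = - (LINT x|lebesgue. (G x \<bullet> b) * \<phi> x)"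
    if \<phi>: "test_function \<phi>" and b: "b \<in> Basis" for \<phi> b
  proof -
    have "C1_along b \<phi> (\<lambda>x. frechet_derivative \<phi> (at x) b)" by (rule C1_along_test_function[OF \<phi> b])
    then have m: "\<phi> \<in> borel_measurable borel" "(\<lambda>x. frechet_derivative \<phi> (at x) b) \<in> borel_measurable borel"
      unfolding C1_along_def by (auto intro: borel_measurable_continuous_onI)
    note W = weak_partialD[OF wp[OF b]]
    have "(LINT x|lebesgue. u x * frechet_derivative \<phi> (at x) b) = (LINT x|lborel. u' x * frechet_derivative \<phi> (at x) b)"
      by (rule integral_lebesgue_eq_lborel_mult[OF u' u W(1) m(2)])
    moreover have "(LINT x|lebesgue. (G x \<bullet> b) * \<phi> x) = (LINT x|lborel. g b x * \<phi> x)"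
      using G by (intro integral_lebesgue_eq_lborel_mult[OF g[OF b] _ W(2) m(1)]) auto
    ultimately show ?thesis using W(5)[OF \<phi>] by simp
  qed
  ultimately show ?thesis unfolding has_weak_gradient_def by (intro conjI allI impI ballI)
qed

lemma has_weak_gradient_compose_diff:
  fixes f f' :: "real \<Rightarrow> real"
  assumes uG: "has_weak_gradient u G" and u: "u \<in> borel_measurable lebesgue" and G: "G \<in> borel_measurable lebesgue"
    and v: "\<And>b. b \<in> Basis \<Longrightarrow> C1_along b v (\<lambda>x. V x \<bullet> b)"
    and V: "continuous_on UNIV V"
    and f: "\<And>s. (f has_real_derivative f' s) (at s)" and f': "continuous_on UNIV f'"
    and L: "\<And>s. \<bar>f' s\<bar> \<le> L"
  shows "has_weak_gradient (\<lambda>x. f (u x - v x)) (\<lambda>x. f' (u x - v x) *\<^sub>R (G x - V x))"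
proof -
  obtain u' g where u': "AE x in lebesgue. u x = u' x"
    and g: "\<And>b. b \<in> Basis \<Longrightarrow> AE x in lebesgue. G x \<bullet> b = g b x"
    and wp: "\<And>b. b \<in> Basis \<Longrightarrow> weak_partial b u' (g b)"
    using has_weak_gradient_representatives[OF uG u G] by blast
  have fm: "f \<in> borel_measurable borel" "f' \<in> borel_measurable borel"
    using f' DERIV_isCont[OF f]
    by (auto intro: borel_measurable_continuous_onI simp: continuous_on_eq_continuous_at)
  obtain b0 :: 'a where b0: "b0 \<in> Basis" using nonempty_Basis by blast
  have "continuous_on UNIV v" using v[OF b0] by (simp add: C1_along_def)
  then have "v \<in> borel_measurable borel" "V \<in> borel_measurable borel"
    using V by (auto intro: borel_measurable_continuous_onI)
  then have vm: "v \<in> borel_measurable lebesgue" "V \<in> borel_measurable lebesgue"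
    by (auto intro: borel_measurable_lebesgueI)
  have uv: "(\<lambda>x. u x - v x) \<in> borel_measurable lebesgue" using u vm by auto
  show ?thesis
  proof (rule has_weak_gradientI)
    show "(\<lambda>x. f (u x - v x)) \<in> borel_measurable lebesgue"
      by (rule measurable_compose[OF uv fm(1)])
    show "(\<lambda>x. f' (u x - v x) *\<^sub>R (G x - V x)) \<in> borel_measurable lebesgue"
      using measurable_compose[OF uv fm(2)] G vm(2) by (intro borel_measurable_scaleR) auto
    show "AE x in lebesgue. f (u x - v x) = f (u' x - v x)"
      using u' by eventually_elim simp
    fix b :: 'a assume b: "b \<in> Basis"
    show "AE x in lebesgue. (f' (u x - v x) *\<^sub>R (G x - V x)) \<bullet> b = f' (u' x - v x) * (g b x - V x \<bullet> b)"
      using u' g[OF b] by eventually_elim (simp add: inner_diff_left)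
    show "weak_partial b (\<lambda>x. f (u' x - v x)) (\<lambda>x. f' (u' x - v x) * (g b x - V x \<bullet> b))"
      by (rule weak_partial_chain[OF b weak_partial_diff[OF b wp[OF b] weak_partial_C1[OF v[OF b] b]] f f' L])
  qed
qed

lemma has_weak_gradient_by_parts:
  fixes \<psi> :: "'a::euclidean_space \<Rightarrow> real"
  assumes wg: "has_weak_gradient \<psi> H" and m: "\<psi> \<in> borel_measurable lebesgue" "H \<in> borel_measurable lebesgue"
    and zero: "\<And>x. norm x > r \<Longrightarrow> \<psi> x = 0" "\<And>x. norm x > r \<Longrightarrow> H x = 0"
    and b: "b \<in> Basis" and A: "C1_along b A A'"
  shows "(LINT x|lebesgue. A' x * \<psi> x) = - (LINT x|lebesgue. A x * (H x \<bullet> b))"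
proof -
  obtain u' g where u': "AE x in lebesgue. \<psi> x = u' x"
    and g: "AE x in lebesgue. H x \<bullet> b = g b x"
    and wp: "weak_partial b u' (g b)"
    using has_weak_gradient_representatives[OF wg m] b by metis
  note W = weak_partialD[OF wp]
  have Am: "A \<in> borel_measurable borel" "A' \<in> borel_measurable borel"
    using A by (auto simp: C1_along_def intro: borel_measurable_continuous_onI)
  have ae1: "AE x in lebesgue. \<psi> x = truncate r u' x"
    using u' by eventually_elim (use zero in \<open>auto simp: truncate_def indicator_def\<close>)
  have ae2: "AE x in lebesgue. H x \<bullet> b = truncate r (g b) x"
    using g by eventually_elim (use zero in \<open>auto simp: truncate_def indicator_def\<close>)
  have tm: "truncate r u' \<in> borel_measurable borel" "truncate r (g b) \<in> borel_measurable borel"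
    using borel_measurable_integrable[OF W(3)] borel_measurable_integrable[OF W(4)] by simp_all
  have "weak_partial b (truncate r u') (truncate r (g b))"
    unfolding weak_partial_def
  proof (intro conjI allI impI tm)
    have "truncate q (truncate r h) = truncate (min q r) h" for q and h :: "'a \<Rightarrow> real"
      by (auto simp: truncate_def fun_eq_iff indicator_def)
    then show "integrable lborel (truncate q (truncate r u'))" "integrable lborel (truncate q (truncate r (g b)))" for q
      using W(3,4) by auto
    fix \<phi> :: "'a \<Rightarrow> real" assume \<phi>: "test_function \<phi>"
    have "C1_along b \<phi> (\<lambda>x. frechet_derivative \<phi> (at x) b)" by (rule C1_along_test_function[OF \<phi> b])
    then have m\<phi>: "\<phi> \<in> borel_measurable borel" "(\<lambda>x. frechet_derivative \<phi> (at x) b) \<in> borel_measurable borel"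
      unfolding C1_along_def by (auto intro: borel_measurable_continuous_onI)
    have "(LINT x|lebesgue. \<psi> x * frechet_derivative \<phi> (at x) b) = (LINT x|lborel. truncate r u' x * frechet_derivative \<phi> (at x) b)"
      by (rule integral_lebesgue_eq_lborel_mult[OF ae1 m(1) tm(1) m\<phi>(2)])
    moreover have "(LINT x|lebesgue. (H x \<bullet> b) * \<phi> x) = (LINT x|lborel. truncate r (g b) x * \<phi> x)"
      using m(2) by (intro integral_lebesgue_eq_lborel_mult[OF ae2 _ tm(2) m\<phi>(1)]) auto
    ultimately show "(\<integral>x. truncate r u' x * frechet_derivative \<phi> (at x) b \<partial>lborel) = - (\<integral>x. truncate r (g b) x * \<phi> x \<partial>lborel)"
      using has_weak_gradientD[OF wg \<phi> b] by simp
  qed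
  then have "(\<integral>x. A' x * truncate r u' x \<partial>lborel) = - (\<integral>x. A x * truncate r (g b) x \<partial>lborel)"
    by (rule weak_partial_by_parts[OF b, where r = r]) (use A in auto)
  moreover have "(LINT x|lebesgue. A' x * \<psi> x) = (LINT x|lborel. A' x * truncate r u' x)"
    using integral_lebesgue_eq_lborel_mult[OF ae1 m(1) tm(1) Am(2)] by (simp only: mult.commute)
  moreover have "(LINT x|lebesgue. A x * (H x \<bullet> b)) = (LINT x|lborel. A x * truncate r (g b) x)"
    using integral_lebesgue_eq_lborel_mult[OF ae2 _ tm(2) Am(1)] m(2) by (simp add: mult.commute)
  ultimately show ?thesis by simp
qed

section \<open>Radial functions that are flat at the origin\<close>

text \<open>
  In terms of \<open>X = d r\<^sup>-\<^sup>s \<rightarrow> \<infinity>\<close> the function is, for \<open>r < 1\<close>, at most a constant times \<open>X\<^sup>N exp (- X)\<close>, where \<open>N\<close> is a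
  natural number with \<open>- a \<le> s N\<close>.
\<close>

lemma powr_times_exp_neg_powr_tendsto_0:
  fixes a d s :: real
  assumes d: "0 < d" and s: "0 < s"
  shows "((\<lambda>r. r powr a * exp (- (d * r powr (- s)))) \<longlongrightarrow> 0) (at_right 0)"
proof -
  obtain N :: nat where N: "- a / s \<le> real N" using real_arch_simple by blast
  have "((\<lambda>r::real. r powr s) \<longlongrightarrow> 0) (at_right 0)"
    using s by (intro tendsto_zero_powrI[where b = s] tendsto_intros) (auto simp: eventually_at_right_less intro: eventually_mono[OF eventually_at_right_less])
  moreover have "\<forall>\<^sub>F r in at_right 0. (0::real) < r powr s"
    by (rule eventually_mono[OF eventually_at_right_less[of 0]]) simp
  ultimately have "LIM r at_right 0. inverse (r powr s) :> at_top"
    by (rule filterlim_inverse_at_top)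
  then have inf: "LIM r at_right 0. d * r powr (- s) :> at_top"
    using d by (intro filterlim_tendsto_pos_mult_at_top[OF tendsto_const]) (auto simp: powr_minus)
  have "((\<lambda>r. (d * r powr (- s)) ^ N / exp (d * r powr (- s)) * inverse (d ^ N)) \<longlongrightarrow> 0 * inverse (d ^ N)) (at_right 0)"
    by (intro tendsto_mult tendsto_const filterlim_compose[OF tendsto_power_div_exp_0 inf])
  then have lim: "((\<lambda>r. (d * r powr (- s)) ^ N / exp (d * r powr (- s)) * inverse (d ^ N)) \<longlongrightarrow> 0) (at_right 0)"
    by simp
  show ?thesis
  proof (rule tendsto_sandwich[OF _ _ tendsto_const lim])
    show "\<forall>\<^sub>F r in at_right 0. 0 \<le> r powr a * exp (- (d * r powr (- s)))" by simp
    have "\<forall>\<^sub>F r in at_right 0. r \<in> {0<..<1::real}" by (intro eventually_at_right_real) simp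
    then show "\<forall>\<^sub>F r in at_right 0. r powr a * exp (- (d * r powr (- s)))
        \<le> (d * r powr (- s)) ^ N / exp (d * r powr (- s)) * inverse (d ^ N)"
    proof eventually_elim
      case (elim r)
      have "- s * real N \<le> a" using N s by (simp add: field_simps)
      then have "r powr a \<le> r powr (- s * real N)" using elim by (intro powr_mono') auto
      also have "\<dots> = (r powr (- s)) powr real N" by (simp only: powr_powr)
      also have "\<dots> = (r powr (- s)) ^ N" using elim by (intro powr_realpow) simp
      finally show ?case using d by (simp add: power_mult_distrib exp_minus field_simps)
    qed
  qed
qed

text \<open>
  The bound by \<open>|x| \<omega>(|x|)\<close> makes the derivative of \<open>A\<close> at the origin equal to 0, and the bound by \<open>\<omega>(|x|)\<close>
  makes \<open>A'\<close> continuous there.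
\<close>

lemma C1_along_at_0I:
  fixes A A' :: "'a::euclidean_space \<Rightarrow> real"
  assumes b: "norm b = 1"
    and der: "\<And>x. x \<noteq> 0 \<Longrightarrow> ((\<lambda>t. A (x + t *\<^sub>R b)) has_real_derivative A' x) (at 0)"
    and cont: "\<And>x. x \<noteq> 0 \<Longrightarrow> isCont A x" "\<And>x. x \<noteq> 0 \<Longrightarrow> isCont A' x"
    and zero: "A 0 = 0" "A' 0 = 0"
    and bound: "\<And>x. x \<noteq> 0 \<Longrightarrow> \<bar>A x\<bar> \<le> norm x * \<omega> (norm x)" "\<And>x. x \<noteq> 0 \<Longrightarrow> \<bar>A' x\<bar> \<le> \<omega> (norm x)"
    and lim: "(\<omega> \<longlongrightarrow> 0) (at_right 0)"
  shows "C1_along b A A'"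
proof -
  have nlim: "filterlim norm (at_right 0) (at (0::'a))"
    unfolding filterlim_at using tendsto_norm_zero[OF tendsto_ident_at]
    by (auto simp: eventually_at_filter)
  have wlim: "((\<lambda>x::'a. \<omega> (norm x)) \<longlongrightarrow> 0) (at 0)"
    by (rule filterlim_compose[OF lim nlim])
  have "((\<lambda>x::'a. norm x * \<omega> (norm x)) \<longlongrightarrow> 0 * 0) (at 0)"
    by (intro tendsto_mult wlim tendsto_norm_zero tendsto_ident_at)
  then have "(A \<longlongrightarrow> 0) (at 0)"
    by (intro Lim_null_comparison[of A "\<lambda>x. norm x * \<omega> (norm x)"]) (auto simp: eventually_at_filter bound)
  then have A0: "isCont A 0" by (simp add: isCont_def zero)
  have "(A' \<longlongrightarrow> 0) (at 0)"
    using wlim by (intro Lim_null_comparison[of A' "\<lambda>x. \<omega> (norm x)"]) (auto simp: eventually_at_filter bound)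
  then have A'0: "isCont A' 0" by (simp add: isCont_def zero)
  have "((\<lambda>t. A (t *\<^sub>R b) / t) \<longlongrightarrow> 0) (at 0)"
  proof (rule Lim_null_comparison)
    have blim: "filterlim (\<lambda>t. t *\<^sub>R b) (at 0) (at (0::real))"
    proof -
      have "((\<lambda>t. t *\<^sub>R b) \<longlongrightarrow> 0) (at (0::real))"
        using tendsto_scaleR[OF tendsto_ident_at[of "0::real" UNIV] tendsto_const[of b]] by simp
      moreover have "b \<noteq> 0" using b by auto
      ultimately show ?thesis unfolding filterlim_at by (auto simp: eventually_at_filter)
    qed
    show "((\<lambda>t. \<omega> (norm (t *\<^sub>R b))) \<longlongrightarrow> 0) (at 0)"
      by (rule filterlim_compose[OF wlim blim])
    show "\<forall>\<^sub>F t in at 0. norm (A (t *\<^sub>R b) / t) \<le> \<omega> (norm (t *\<^sub>R b))"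
      unfolding eventually_at_filter
    proof (intro always_eventually allI impI)
      fix t :: real assume t: "t \<noteq> 0"
      then have "t *\<^sub>R b \<noteq> 0" using b by auto
      from bound(1)[OF this] show "norm (A (t *\<^sub>R b) / t) \<le> \<omega> (norm (t *\<^sub>R b))"
        using t b by (simp add: field_simps)
    qed
  qed
  then have d0: "((\<lambda>t. A (0 + t *\<^sub>R b)) has_real_derivative A' 0) (at 0)"
    by (simp add: DERIV_def zero)
  show ?thesis
    unfolding C1_along_def continuous_on_eq_continuous_at[OF open_UNIV]
  proof (intro conjI ballI allI)
    show "isCont A x" "isCont A' x" for x using cont[of x] A0 A'0 by (cases "x = 0"; simp)+
    show "((\<lambda>t. A (x + t *\<^sub>R b)) has_real_derivative A' x) (at 0)" for x
      using der[of x] d0 by (cases "x = 0") auto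
  qed
qed

lemma has_real_derivative_norm_line:
  fixes x b :: "'a::euclidean_space"
  assumes "x \<noteq> 0"
  shows "((\<lambda>t. norm (x + t *\<^sub>R b)) has_real_derivative (x \<bullet> b) / norm x) (at 0)"
proof -
  have d: "((\<lambda>t. x + t *\<^sub>R b) has_derivative (\<lambda>t. t *\<^sub>R b)) (at 0)"
    by (auto intro!: derivative_eq_intros)
  have "(norm has_derivative (\<lambda>h. h \<bullet> sgn x)) (at x)"
    by (rule has_derivative_norm[OF assms])
  then have "(norm has_derivative (\<lambda>h. h \<bullet> sgn x)) (at (x + 0 *\<^sub>R b))" by simp
  from has_derivative_compose[OF d this]
  have "((\<lambda>t. norm (x + t *\<^sub>R b)) has_derivative (\<lambda>t. (t *\<^sub>R b) \<bullet> sgn x)) (at 0)" .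
  moreover have "(\<lambda>t. (t *\<^sub>R b) \<bullet> sgn x) = (*) ((x \<bullet> b) / norm x)"
    by (simp add: fun_eq_iff sgn_div_norm inner_commute divide_inverse)
  ultimately show ?thesis by (simp only: has_field_derivative_def)
qed

text \<open>
  The two limits express that the radial function has value and gradient 0 at the origin and is \<open>C\<^sup>1\<close> there.
\<close>

lemma C1_along_radial:
  fixes b :: "'a::euclidean_space"
  assumes b: "b \<in> Basis"
    and der: "\<And>r. r > 0 \<Longrightarrow> (\<phi> has_real_derivative \<phi>' r) (at r)"
    and cont: "\<And>r. r > 0 \<Longrightarrow> isCont \<phi>' r"
    and zero: "\<phi> 0 = 0"
    and lim: "((\<lambda>r. \<phi> r / r) \<longlongrightarrow> 0) (at_right 0)" "(\<phi>' \<longlongrightarrow> 0) (at_right 0)"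
  shows "C1_along b (\<lambda>x. \<phi> (norm x)) (\<lambda>x. \<phi>' (norm x) / norm x * (x \<bullet> b))"
proof (rule C1_along_at_0I[where \<omega> = "\<lambda>r. \<bar>\<phi> r / r\<bar> + \<bar>\<phi>' r\<bar>"])
  show "norm b = 1" using b by simp
  fix x :: 'a assume x: "x \<noteq> 0"
  then have nx: "norm x > 0" by simp
  show "((\<lambda>t. \<phi> (norm (x + t *\<^sub>R b))) has_real_derivative \<phi>' (norm x) / norm x * (x \<bullet> b)) (at 0)"
  proof -
    have "(\<phi> has_real_derivative \<phi>' (norm x)) (at (norm (x + 0 *\<^sub>R b)))" using der[OF nx] by simp
    from DERIV_chain2[OF this has_real_derivative_norm_line[OF x]] show ?thesis by simp
  qed
  show "isCont (\<lambda>x. \<phi> (norm x)) x"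
    by (rule isCont_o2[OF isCont_norm[OF continuous_ident] DERIV_isCont[OF der[OF nx]]])
  have "isCont (\<lambda>x. \<phi>' (norm x)) x"
    by (rule isCont_o2[OF isCont_norm[OF continuous_ident] cont[OF nx]])
  then show "isCont (\<lambda>x. \<phi>' (norm x) / norm x * (x \<bullet> b)) x"
    using x by (intro isCont_mult isCont_divide isCont_norm continuous_inner continuous_ident continuous_const) simp_all
  show "\<bar>\<phi> (norm x)\<bar> \<le> norm x * (\<bar>\<phi> (norm x) / norm x\<bar> + \<bar>\<phi>' (norm x)\<bar>)"
  proof -
    have "norm x * \<bar>\<phi> (norm x) / norm x\<bar> \<le> norm x * (\<bar>\<phi> (norm x) / norm x\<bar> + \<bar>\<phi>' (norm x)\<bar>)"
      by (rule mult_left_mono) auto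
    then show ?thesis using nx by (simp add: abs_divide)
  qed
  have "\<bar>x \<bullet> b\<bar> \<le> norm x" by (rule Basis_le_norm[OF b])
  then have "\<bar>\<phi>' (norm x)\<bar> * \<bar>x \<bullet> b\<bar> \<le> \<bar>\<phi>' (norm x)\<bar> * norm x" by (rule mult_left_mono) simp
  then have "\<bar>\<phi>' (norm x) / norm x * (x \<bullet> b)\<bar> \<le> \<bar>\<phi>' (norm x)\<bar>"
    using nx by (simp add: abs_mult field_simps)
  then show "\<bar>\<phi>' (norm x) / norm x * (x \<bullet> b)\<bar> \<le> \<bar>\<phi> (norm x) / norm x\<bar> + \<bar>\<phi>' (norm x)\<bar>" by linarith
next
  show "((\<lambda>r. \<bar>\<phi> r / r\<bar> + \<bar>\<phi>' r\<bar>) \<longlongrightarrow> 0) (at_right 0)"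
    using tendsto_add[OF tendsto_rabs_zero[OF lim(1)] tendsto_rabs_zero[OF lim(2)]] by simp
qed (use zero in simp_all)

lemma C1_along_radial_field:
  fixes b :: "'a::euclidean_space"
  assumes b: "b \<in> Basis"
    and der: "\<And>r. r > 0 \<Longrightarrow> (k has_real_derivative k' r) (at r)"
    and cont: "\<And>r. r > 0 \<Longrightarrow> isCont k' r"
    and zero: "k 0 = 0"
    and lim: "(k \<longlongrightarrow> 0) (at_right 0)" "((\<lambda>r. r * k' r) \<longlongrightarrow> 0) (at_right 0)"
  shows "C1_along b (\<lambda>x. k (norm x) * (x \<bullet> b)) (\<lambda>x. k (norm x) + k' (norm x) / norm x * (x \<bullet> b)\<^sup>2)"
proof (rule C1_along_at_0I[where \<omega> = "\<lambda>r. \<bar>k r\<bar> + \<bar>r * k' r\<bar>"])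
  show "norm b = 1" using b by simp
  fix x :: 'a assume x: "x \<noteq> 0"
  then have nx: "norm x > 0" by simp
  have "((\<lambda>t. k (norm (x + t *\<^sub>R b))) has_real_derivative k' (norm x) * ((x \<bullet> b) / norm x)) (at 0)"
  proof -
    have "(k has_real_derivative k' (norm x)) (at (norm (x + 0 *\<^sub>R b)))" using der[OF nx] by simp
    from DERIV_chain2[OF this has_real_derivative_norm_line[OF x]] show ?thesis .
  qed
  moreover have "((\<lambda>t. (x + t *\<^sub>R b) \<bullet> b) has_real_derivative 1) (at 0)"
    using b by (auto intro!: derivative_eq_intros simp: inner_add_left inner_same_Basis)
  ultimately have "((\<lambda>t. k (norm (x + t *\<^sub>R b)) * ((x + t *\<^sub>R b) \<bullet> b)) has_real_derivative
      k' (norm x) * ((x \<bullet> b) / norm x) * ((x + 0 *\<^sub>R b) \<bullet> b) + 1 * k (norm (x + 0 *\<^sub>R b))) (at 0)"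
    by (rule DERIV_mult)
  then show "((\<lambda>t. k (norm (x + t *\<^sub>R b)) * ((x + t *\<^sub>R b) \<bullet> b)) has_real_derivative
      k (norm x) + k' (norm x) / norm x * (x \<bullet> b)\<^sup>2) (at 0)"
    by (simp add: power2_eq_square add.commute mult.assoc)
  have ck: "isCont (\<lambda>x. k (norm x)) x"
    by (rule isCont_o2[OF isCont_norm[OF continuous_ident] DERIV_isCont[OF der[OF nx]]])
  then show "isCont (\<lambda>x. k (norm x) * (x \<bullet> b)) x"
    by (intro isCont_mult continuous_inner continuous_ident continuous_const)
  have "isCont (\<lambda>x. k' (norm x)) x"
    by (rule isCont_o2[OF isCont_norm[OF continuous_ident] cont[OF nx]])
  with ck show "isCont (\<lambda>x. k (norm x) + k' (norm x) / norm x * (x \<bullet> b)\<^sup>2) x"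
    using x by (intro isCont_add isCont_mult isCont_divide isCont_norm isCont_power continuous_inner continuous_ident continuous_const) simp_all
  have le: "\<bar>x \<bullet> b\<bar> \<le> norm x" by (rule Basis_le_norm[OF b])
  have "\<bar>k (norm x)\<bar> * \<bar>x \<bullet> b\<bar> \<le> (\<bar>k (norm x)\<bar> + \<bar>norm x * k' (norm x)\<bar>) * norm x"
    using le by (intro mult_mono) auto
  then show "\<bar>k (norm x) * (x \<bullet> b)\<bar> \<le> norm x * (\<bar>k (norm x)\<bar> + \<bar>norm x * k' (norm x)\<bar>)"
    by (simp add: abs_mult mult.commute)
  have "(x \<bullet> b)\<^sup>2 \<le> (norm x)\<^sup>2" using power_mono[OF le abs_ge_zero, of 2] by simp
  then have "\<bar>k' (norm x) / norm x\<bar> * (x \<bullet> b)\<^sup>2 \<le> \<bar>k' (norm x) / norm x\<bar> * (norm x)\<^sup>2" by (rule mult_left_mono) simp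
  also have "\<dots> = \<bar>norm x * k' (norm x)\<bar>" using nx by (simp add: abs_mult power2_eq_square)
  finally have "\<bar>k' (norm x) / norm x * (x \<bullet> b)\<^sup>2\<bar> \<le> \<bar>norm x * k' (norm x)\<bar>" by (simp add: abs_mult)
  then show "\<bar>k (norm x) + k' (norm x) / norm x * (x \<bullet> b)\<^sup>2\<bar> \<le> \<bar>k (norm x)\<bar> + \<bar>norm x * k' (norm x)\<bar>" by linarith
next
  show "((\<lambda>r. \<bar>k r\<bar> + \<bar>r * k' r\<bar>) \<longlongrightarrow> 0) (at_right 0)"
    using tendsto_add[OF tendsto_rabs_zero[OF lim(1)] tendsto_rabs_zero[OF lim(2)]] by simp
qed (use zero in simp_all)

section \<open>The barrier\<close>

text \<open>
  The radial barrier and its flux. The exponent \<open>q\<close> stands for \<open>p - 1\<close>. The condition \<open>small\<close> lets the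
  exponential factor dominate all powers of \<open>1 + Y\<close> that occur in the flux and its derivative.
\<close>

locale barrier =
  fixes c \<beta> q s \<delta> :: real
  assumes pos: "0 < c" "1 < \<beta>" "0 < q" "0 < s" "0 < \<delta>"
    and small: "s * (q + 1) < q * \<beta>"
begin

text \<open>
  The profile of the barrier is \<open>\<phi>\<close>, with derivative \<open>d\<phi>\<close>. The flux \<open>|\<nabla>v|\<^sup>q\<^sup>-\<^sup>1 \<nabla>v\<close> is \<open>k(|x|) x\<close>, and \<open>dk\<close> is
  the derivative of \<open>k\<close>. The quantity \<open>Y\<close> is the relative change of the logarithmic derivative of
  \<open>r\<^sup>\<beta>\<close> caused by the damping factor: \<open>r \<phi>'(r) / \<phi>(r) = \<beta> (1 + Y(r))\<close>.
\<close>

definition Y :: "real \<Rightarrow> real" where "Y r = \<delta> * s / \<beta> * r powr (- s)"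
definition \<phi> :: "real \<Rightarrow> real" where "\<phi> r = c * r powr \<beta> * exp (- (\<delta> * r powr (- s)))"
definition d\<phi> :: "real \<Rightarrow> real" where "d\<phi> r = \<beta> / r * (1 + Y r) * \<phi> r"
definition k :: "real \<Rightarrow> real" where "k r = d\<phi> r powr q / r"
definition dk :: "real \<Rightarrow> real" where
  "dk r = k r / r * ((\<beta> - 1) * q - 1 + q * \<beta> * Y r - q * s * Y r / (1 + Y r))"

lemma Y_nonneg: "0 \<le> Y r"
  using pos by (simp add: Y_def)

lemma \<phi>_pos: "0 < r \<Longrightarrow> 0 < \<phi> r"
  using pos by (simp add: \<phi>_def)

lemma d\<phi>_pos: "0 < r \<Longrightarrow> 0 < d\<phi> r"
  using pos \<phi>_pos[of r] Y_nonneg[of r] by (simp add: d\<phi>_def)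

lemma \<phi>_0: "\<phi> 0 = 0" and d\<phi>_0: "d\<phi> 0 = 0" and k_0: "k 0 = 0"
  by (simp_all add: \<phi>_def d\<phi>_def k_def)

lemma DERIV_Y: "0 < r \<Longrightarrow> (Y has_real_derivative - (s * Y r / r)) (at r)"
  unfolding Y_def[abs_def] using pos
  by (auto intro!: derivative_eq_intros simp: powr_diff field_simps)

lemma DERIV_\<phi>: "0 < r \<Longrightarrow> (\<phi> has_real_derivative d\<phi> r) (at r)"
  unfolding \<phi>_def[abs_def] d\<phi>_def Y_def using pos
  by (auto intro!: derivative_eq_intros simp: powr_diff field_simps)

lemma DERIV_d\<phi>:
  assumes r: "0 < r"
  shows "(d\<phi> has_real_derivative d\<phi> r / r * (\<beta> - 1 + \<beta> * Y r - s * Y r / (1 + Y r))) (at r)"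
proof -
  have Y1: "1 + Y r > 0" using Y_nonneg[of r] by linarith
  have "((\<lambda>r. \<beta> / r * (1 + Y r) * \<phi> r) has_real_derivative
      (- \<beta> / r\<^sup>2 * (1 + Y r) + \<beta> / r * (- (s * Y r / r))) * \<phi> r + \<beta> / r * (1 + Y r) * d\<phi> r) (at r)"
    using r by (auto intro!: derivative_eq_intros DERIV_Y DERIV_\<phi> simp: power2_eq_square field_simps)
  moreover have "(- \<beta> / r\<^sup>2 * (1 + Y r) + \<beta> / r * (- (s * Y r / r))) * \<phi> r + \<beta> / r * (1 + Y r) * d\<phi> r =
      d\<phi> r / r * (\<beta> - 1 + \<beta> * Y r - s * Y r / (1 + Y r))"
  proof -
    define T where "T = s * Y r / (1 + Y r)"
    have sY: "s * Y r = (1 + Y r) * T" using Y1 by (simp add: T_def)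
    show ?thesis
      unfolding d\<phi>_def T_def[symmetric] unfolding sY using r by (simp add: field_simps power2_eq_square)
  qed
  ultimately show ?thesis unfolding d\<phi>_def[abs_def] by simp
qed

lemma DERIV_k:
  assumes r: "0 < r"
  shows "(k has_real_derivative dk r) (at r)"
proof -
  let ?D = "d\<phi> r / r * (\<beta> - 1 + \<beta> * Y r - s * Y r / (1 + Y r))"
  have "((\<lambda>r. d\<phi> r powr q) has_real_derivative q * d\<phi> r powr (q - 1) * ?D) (at r)"
    using DERIV_chain2[OF has_real_derivative_powr[OF d\<phi>_pos[OF r]] DERIV_d\<phi>[OF r], of q] by simp
  moreover have "q * d\<phi> r powr (q - 1) * ?D = d\<phi> r powr q / r * (q * (\<beta> - 1 + \<beta> * Y r - s * Y r / (1 + Y r)))"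
  proof -
    have "d\<phi> r powr (q - 1) * d\<phi> r = d\<phi> r powr q"
      using d\<phi>_pos[OF r] by (simp add: powr_diff)
    moreover have "q * P' * (D / r * Z) = (P' * D) / r * (q * Z)" for P' D Z :: real by simp
    ultimately show ?thesis by (simp only:)
  qed
  ultimately have "((\<lambda>r. d\<phi> r powr q) has_real_derivative
      d\<phi> r powr q / r * (q * (\<beta> - 1 + \<beta> * Y r - s * Y r / (1 + Y r)))) (at r)" by (simp only:)
  from DERIV_divide[OF this DERIV_ident] r
  have "(k has_real_derivative (d\<phi> r powr q / r * (q * (\<beta> - 1 + \<beta> * Y r - s * Y r / (1 + Y r))) * r - d\<phi> r powr q * 1) / (r * r)) (at r)"
    unfolding k_def[abs_def] by (simp only: order_less_imp_not_eq2 simp_thms)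
  moreover have "(d\<phi> r powr q / r * (q * (\<beta> - 1 + \<beta> * Y r - s * Y r / (1 + Y r))) * r - d\<phi> r powr q * 1) / (r * r) = dk r"
  proof -
    have "(P / r * (q * Z) * r - P * 1) / (r * r) = P / r / r * (q * Z - 1)" for P Z
      using r by (simp add: field_simps)
    moreover have "q * (\<beta> - 1 + \<beta> * Y r - s * Y r / (1 + Y r)) - 1 = (\<beta> - 1) * q - 1 + q * \<beta> * Y r - q * s * Y r / (1 + Y r)"
      by (simp add: algebra_simps)
    ultimately show ?thesis by (simp only: dk_def k_def)
  qed
  ultimately show ?thesis by simp
qed

lemma isCont_d\<phi>: "0 < r \<Longrightarrow> isCont d\<phi> r"
  using DERIV_d\<phi> DERIV_isCont by blast

lemma isCont_dk:
  assumes r: "0 < r"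
  shows "isCont dk r"
proof -
  have "isCont k r" "isCont Y r" using DERIV_k[OF r] DERIV_Y[OF r] DERIV_isCont by blast+
  moreover have "1 + Y r \<noteq> 0" using Y_nonneg[of r] by linarith
  ultimately show ?thesis
    unfolding dk_def[abs_def] using r
    by (intro isCont_add isCont_diff isCont_mult isCont_divide continuous_ident continuous_const) simp_all
qed

lemma exp_Y: "exp (- (\<delta> * r powr (- s))) = exp (- (\<beta> / s * Y r))"
  using pos by (simp add: Y_def)

text \<open>
  All factors are expressed through \<open>r\<close> and \<open>Y r\<close>. The remaining estimates then follow from
  \<open>1 + Y \<le> exp Y\<close>.
\<close>

lemma k_eq:
  assumes r: "0 < r"
  shows "k r = (c * \<beta>) powr q * r powr ((\<beta> - 1) * q - 1) * (1 + Y r) powr q * exp (- (q * \<beta> / s * Y r))"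
proof -
  have Y1: "0 < 1 + Y r" using Y_nonneg[of r] by linarith
  have "d\<phi> r = (c * \<beta>) * r powr (\<beta> - 1) * (1 + Y r) * exp (- (\<beta> / s * Y r))"
    using r by (simp add: d\<phi>_def \<phi>_def exp_Y powr_diff)
  then have "d\<phi> r powr q = (c * \<beta>) powr q * (r powr (\<beta> - 1)) powr q * (1 + Y r) powr q * exp (- (\<beta> / s * Y r)) powr q"
    using pos Y1 by (simp add: powr_mult)
  moreover have "exp (- (\<beta> / s * Y r)) powr q = exp (- (q * \<beta> / s * Y r))"
    by (simp add: exp_powr_real mult_ac)
  moreover have "r powr ((\<beta> - 1) * q - 1) = (r powr (\<beta> - 1)) powr q / r"
    using r unfolding powr_powr by (simp add: powr_diff[of r _ 1])
  ultimately show ?thesis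
    by (simp add: k_def)
qed

lemma one_plus_Y_powr_le: "(1 + Y r) powr a \<le> exp (a * Y r)" if "0 \<le> a"
proof -
  have "(1 + Y r) powr a \<le> exp (Y r) powr a"
    using that Y_nonneg[of r] by (intro powr_mono2) auto
  then show ?thesis by (simp add: exp_powr_real mult.commute)
qed

text \<open>
  Every function of this form is flat at the origin, because \<open>Y r\<close> is a positive multiple of \<open>r\<^sup>-\<^sup>s\<close>.
\<close>

lemma flat: "((\<lambda>r. C * r powr a * exp (- (\<gamma> * Y r))) \<longlongrightarrow> 0) (at_right 0)" if "0 < \<gamma>"
proof -
  have "((\<lambda>r. C * (r powr a * exp (- ((\<gamma> * (\<delta> * s / \<beta>)) * r powr (- s))))) \<longlongrightarrow> C * 0) (at_right 0)"
    using that pos by (intro tendsto_mult tendsto_const powr_times_exp_neg_powr_tendsto_0) auto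
  then show ?thesis by (simp add: Y_def mult.assoc)
qed

lemma lim_\<phi>: "((\<lambda>r. \<phi> r / r) \<longlongrightarrow> 0) (at_right 0)"
proof (rule Lim_transform_eventually)
  show "((\<lambda>r. c * r powr (\<beta> - 1) * exp (- (\<beta> / s * Y r))) \<longlongrightarrow> 0) (at_right 0)"
    using pos by (intro flat) auto
  show "\<forall>\<^sub>F r in at_right 0. c * r powr (\<beta> - 1) * exp (- (\<beta> / s * Y r)) = \<phi> r / r"
    by (rule eventually_mono[OF eventually_at_right_less[of 0]]) (simp add: \<phi>_def exp_Y powr_diff)
qed

lemma k_le:
  assumes r: "0 < r"
  shows "k r * (1 + Y r) \<le> (c * \<beta>) powr q * r powr ((\<beta> - 1) * q - 1) * exp (- (q * \<beta> / s * Y r) + (q + 1) * Y r)"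
proof -
  have "1 + Y r \<le> exp (Y r)" by simp
  then have "(1 + Y r) powr q * (1 + Y r) \<le> exp (q * Y r) * exp (Y r)"
    using Y_nonneg[of r] pos by (intro mult_mono one_plus_Y_powr_le) auto
  also have "\<dots> = exp ((q + 1) * Y r)" by (simp add: exp_add[symmetric] algebra_simps)
  finally have "(1 + Y r) powr q * (1 + Y r) \<le> exp ((q + 1) * Y r)" .
  then have "((c * \<beta>) powr q * r powr ((\<beta> - 1) * q - 1) * exp (- (q * \<beta> / s * Y r))) * ((1 + Y r) powr q * (1 + Y r))
      \<le> ((c * \<beta>) powr q * r powr ((\<beta> - 1) * q - 1) * exp (- (q * \<beta> / s * Y r))) * exp ((q + 1) * Y r)"
    by (rule mult_left_mono) simp
  then show ?thesis unfolding k_eq[OF r] exp_add by (simp only: mult_ac)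
qed

lemma lim_d\<phi>: "(d\<phi> \<longlongrightarrow> 0) (at_right 0)"
proof (rule tendsto_sandwich[OF _ _ tendsto_const])
  have "s * (q + 1) < \<beta> * (q + 1)" using small pos by (simp add: algebra_simps)
  then have "s < \<beta>" using pos by simp
  then show "((\<lambda>r. (c * \<beta>) * r powr (\<beta> - 1) * exp (- ((\<beta> / s - 1) * Y r))) \<longlongrightarrow> 0) (at_right 0)"
    using pos by (intro flat) (simp add: field_simps)
  show "\<forall>\<^sub>F r in at_right 0. 0 \<le> d\<phi> r"
    by (rule eventually_mono[OF eventually_at_right_less[of 0]]) (simp add: less_imp_le d\<phi>_pos)
  show "\<forall>\<^sub>F r in at_right 0. d\<phi> r \<le> (c * \<beta>) * r powr (\<beta> - 1) * exp (- ((\<beta> / s - 1) * Y r))"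
  proof (rule eventually_mono[OF eventually_at_right_less[of 0]])
    fix r :: real assume r: "0 < r"
    have "d\<phi> r = ((c * \<beta>) * r powr (\<beta> - 1) * exp (- (\<beta> / s * Y r))) * (1 + Y r)"
      using r by (simp add: d\<phi>_def \<phi>_def exp_Y powr_diff)
    also have "\<dots> \<le> ((c * \<beta>) * r powr (\<beta> - 1) * exp (- (\<beta> / s * Y r))) * exp (Y r)"
      using pos by (intro mult_left_mono) auto
    also have "\<dots> = (c * \<beta>) * r powr (\<beta> - 1) * exp (- (\<beta> / s * Y r) + Y r)"
      unfolding exp_add by (simp only: mult_ac)
    also have "- (\<beta> / s * Y r) + Y r = - ((\<beta> / s - 1) * Y r)" by (simp add: left_diff_distrib)
    finally show "d\<phi> r \<le> (c * \<beta>) * r powr (\<beta> - 1) * exp (- ((\<beta> / s - 1) * Y r))" .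
  qed
qed

lemma k_nonneg: "0 < r \<Longrightarrow> 0 \<le> k r"
  by (simp add: k_def)

lemma lim_k_weighted: "((\<lambda>r. k r * (1 + Y r)) \<longlongrightarrow> 0) (at_right 0)"
proof (rule tendsto_sandwich[OF _ _ tendsto_const])
  show "((\<lambda>r. (c * \<beta>) powr q * r powr ((\<beta> - 1) * q - 1) * exp (- ((q * \<beta> / s - (q + 1)) * Y r))) \<longlongrightarrow> 0) (at_right 0)"
    using pos small by (intro flat) (simp add: field_simps)
  show "\<forall>\<^sub>F r in at_right 0. 0 \<le> k r * (1 + Y r)"
    by (rule eventually_mono[OF eventually_at_right_less[of 0]]) (simp add: k_nonneg Y_nonneg)
  show "\<forall>\<^sub>F r in at_right 0. k r * (1 + Y r) \<le>
      (c * \<beta>) powr q * r powr ((\<beta> - 1) * q - 1) * exp (- ((q * \<beta> / s - (q + 1)) * Y r))"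
  proof (rule eventually_mono[OF eventually_at_right_less[of 0]])
    fix r :: real assume r: "0 < r"
    have "- (q * \<beta> / s * Y r) + (q + 1) * Y r = - ((q * \<beta> / s - (q + 1)) * Y r)" by (simp add: left_diff_distrib)
    then show "k r * (1 + Y r) \<le> (c * \<beta>) powr q * r powr ((\<beta> - 1) * q - 1) * exp (- ((q * \<beta> / s - (q + 1)) * Y r))"
      using k_le[OF r] by (simp only:)
  qed
qed

lemma lim_k: "(k \<longlongrightarrow> 0) (at_right 0)"
proof (rule tendsto_sandwich[OF _ _ tendsto_const lim_k_weighted])
  show "\<forall>\<^sub>F r in at_right 0. 0 \<le> k r"
    by (rule eventually_mono[OF eventually_at_right_less[of 0]]) (simp add: k_nonneg)
  show "\<forall>\<^sub>F r in at_right 0. k r \<le> k r * (1 + Y r)"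
    by (rule eventually_mono[OF eventually_at_right_less[of 0]]) (simp add: distrib_left k_nonneg Y_nonneg)
qed

lemma lim_dk: "((\<lambda>r. r * dk r) \<longlongrightarrow> 0) (at_right 0)"
proof (rule Lim_null_comparison)
  let ?C = "\<bar>(\<beta> - 1) * q - 1\<bar> + q * \<beta> + q * s"
  have "((\<lambda>r. ?C * (k r * (1 + Y r))) \<longlongrightarrow> ?C * 0) (at_right 0)"
    by (intro tendsto_mult tendsto_const lim_k_weighted)
  then show "((\<lambda>r. ?C * (k r * (1 + Y r))) \<longlongrightarrow> 0) (at_right 0)" by simp
  show "\<forall>\<^sub>F r in at_right 0. norm (r * dk r) \<le> ?C * (k r * (1 + Y r))"
  proof (rule eventually_mono[OF eventually_at_right_less[of 0]])
    fix r :: real assume r: "0 < r"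
    let ?b = "(\<beta> - 1) * q - 1" and ?T = "q * s * Y r / (1 + Y r)"
    have Y: "0 \<le> Y r" by (rule Y_nonneg)
    have T: "0 \<le> ?T" "?T \<le> q * s" using Y pos by (auto simp: divide_le_eq)
    have "\<bar>?b + q * \<beta> * Y r - ?T\<bar> \<le> \<bar>?b\<bar> + q * \<beta> * Y r + q * s"
    proof -
      have "0 \<le> q * \<beta> * Y r" using Y pos by simp
      then show ?thesis using T by linarith
    qed
    also have "\<dots> \<le> ?C * (1 + Y r)"
    proof -
      have "0 \<le> \<bar>?b\<bar> * Y r + q * s * Y r + q * \<beta>" using Y pos by simp
      then show ?thesis by (simp add: algebra_simps)
    qed
    finally have *: "\<bar>?b + q * \<beta> * Y r - ?T\<bar> \<le> ?C * (1 + Y r)" .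
    have "r * dk r = k r * (?b + q * \<beta> * Y r - ?T)" using r by (simp add: dk_def)
    then have "norm (r * dk r) = k r * \<bar>?b + q * \<beta> * Y r - ?T\<bar>"
      using k_nonneg[OF r] by (simp only: real_norm_def abs_mult abs_of_nonneg)
    also have "\<dots> \<le> k r * (?C * (1 + Y r))" by (rule mult_left_mono[OF * k_nonneg[OF r]])
    finally show "norm (r * dk r) \<le> ?C * (k r * (1 + Y r))" by (simp only: mult_ac)
  qed
qed

text \<open>
  For \<open>Y = 0\<close> this is the computation for \<open>c r\<^sup>\<beta>\<close>, where \<open>scaling\<close> matches the powers of \<open>r\<close> on both sides.
  For \<open>Y > 0\<close> the left-hand side gains at most the factor \<open>exp (q Y + (q \<beta> / K) Y)\<close>, from
  \<open>(1 + Y)\<^sup>q (1 + (q \<beta> / K) Y)\<close> with \<open>K = n + (\<beta> - 1) q - 1\<close>. It also gains the damping factor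
  \<open>exp (- \<beta> Y / s)\<close> to the power \<open>q\<close>, whereas the right-hand side has it only to the smaller power \<open>m\<close>.
  For small \<open>s\<close> the difference of these powers absorbs the first factor.
\<close>

lemma supersolution:
  assumes r: "0 < r" and K: "0 < n + (\<beta> - 1) * q - 1"
    and scaling: "\<beta> * (q - m) = q + 1 + \<alpha>"
    and s: "s * (q + q * \<beta> / (n + (\<beta> - 1) * q - 1)) \<le> \<beta> * (q - m)"
  shows "n * k r + r * dk r \<le> (c powr (q - m) * \<beta> powr q * (n + (\<beta> - 1) * q - 1)) * r powr \<alpha> * \<phi> r powr m"
proof -
  define K where "K = n + (\<beta> - 1) * q - 1"
  have K0: "0 < K" using K by (simp add: K_def)
  have Y: "0 \<le> Y r" by (rule Y_nonneg)
  let ?T = "q * s * Y r / (1 + Y r)"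
  have T: "0 \<le> ?T" using Y pos by auto
  have "r * dk r = k r * ((\<beta> - 1) * q - 1 + q * \<beta> * Y r - ?T)" using r by (simp add: dk_def)
  moreover have "n * k r + k r * ((\<beta> - 1) * q - 1 + q * \<beta> * Y r - ?T) = k r * (K + q * \<beta> * Y r - ?T)"
    unfolding K_def by (simp add: algebra_simps)
  ultimately have "n * k r + r * dk r = k r * (K + q * \<beta> * Y r - ?T)" by (simp only:)
  also have "\<dots> \<le> k r * (K * exp (q * \<beta> / K * Y r))"
  proof (intro mult_left_mono k_nonneg r)
    have "K * (1 + q * \<beta> / K * Y r) = K + q * \<beta> * Y r" using K0 by (simp add: distrib_left)
    then have "K + q * \<beta> * Y r - ?T \<le> K * (1 + q * \<beta> / K * Y r)" using T by linarith
    also have "\<dots> \<le> K * exp (q * \<beta> / K * Y r)" using K0 by (intro mult_left_mono exp_ge_add_one_self) auto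
    finally show "K + q * \<beta> * Y r - ?T \<le> K * exp (q * \<beta> / K * Y r)" .
  qed
  also have "\<dots> = ((c * \<beta>) powr q * r powr ((\<beta> - 1) * q - 1) * exp (- (q * \<beta> / s * Y r)) * (K * exp (q * \<beta> / K * Y r))) * (1 + Y r) powr q"
    unfolding k_eq[OF r] by (simp only: mult_ac)
  also have "\<dots> \<le> ((c * \<beta>) powr q * r powr ((\<beta> - 1) * q - 1) * exp (- (q * \<beta> / s * Y r)) * (K * exp (q * \<beta> / K * Y r))) * exp (q * Y r)"
    using K0 pos by (intro mult_left_mono one_plus_Y_powr_le) auto
  also have "\<dots> = ((c * \<beta>) powr q * K * r powr ((\<beta> - 1) * q - 1)) * exp (- (q * \<beta> / s * Y r) + q * \<beta> / K * Y r + q * Y r)"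
    unfolding exp_add by (simp only: mult_ac)
  also have "\<dots> \<le> ((c * \<beta>) powr q * K * r powr ((\<beta> - 1) * q - 1)) * exp (- (m * \<beta> / s * Y r))"
  proof (intro mult_left_mono)
    have "q + q * \<beta> / K \<le> \<beta> * (q - m) / s"
      using s pos unfolding K_def by (simp add: field_simps)
    then have "(q + q * \<beta> / K) * Y r \<le> (\<beta> * (q - m) / s) * Y r" using Y by (rule mult_right_mono)
    then show "exp (- (q * \<beta> / s * Y r) + q * \<beta> / K * Y r + q * Y r) \<le> exp (- (m * \<beta> / s * Y r))"
      by (simp add: algebra_simps diff_divide_distrib)
  qed (use K0 in simp)
  also have "\<dots> = (c powr (q - m) * \<beta> powr q * K) * r powr \<alpha> * \<phi> r powr m"
  proof -
    have "\<phi> r powr m = c powr m * r powr (\<beta> * m) * exp (- (m * \<beta> / s * Y r))"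
      using pos r by (simp add: \<phi>_def exp_Y powr_mult powr_powr exp_powr_real mult_ac)
    moreover have "(c * \<beta>) powr q = c powr (q - m) * c powr m * \<beta> powr q"
      using pos by (simp add: powr_mult powr_add[symmetric])
    moreover have "r powr ((\<beta> - 1) * q - 1) = r powr \<alpha> * r powr (\<beta> * m)"
    proof -
      have "(\<beta> - 1) * q - 1 = \<alpha> + \<beta> * m" using scaling by (simp add: algebra_simps)
      then show ?thesis by (simp only: powr_add)
    qed
    ultimately show ?thesis by (simp only: mult_ac)
  qed
  finally show ?thesis by (simp only: K_def)
qed

definition v :: "'a::euclidean_space \<Rightarrow> real" where "v x = \<phi> (norm x)"
definition V :: "'a::euclidean_space \<Rightarrow> 'a" where "V x = (d\<phi> (norm x) / norm x) *\<^sub>R x"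

lemma C1_along_v: "b \<in> Basis \<Longrightarrow> C1_along b v (\<lambda>x. V x \<bullet> b)"
  unfolding v_def[abs_def] V_def inner_scaleR_left
  by (rule C1_along_radial[OF _ DERIV_\<phi> isCont_d\<phi> \<phi>_0 lim_\<phi> lim_d\<phi>])

text \<open>
  The components of the flux \<open>|\<nabla>v|\<^sup>p\<^sup>-\<^sup>2 \<nabla>v = k(|x|) x\<close> are \<open>C\<^sup>1\<close> on the whole space, the origin included.
\<close>

lemma C1_along_flux:
  "b \<in> Basis \<Longrightarrow> C1_along b (\<lambda>x. k (norm x) * (x \<bullet> b)) (\<lambda>x. k (norm x) + dk (norm x) / norm x * (x \<bullet> b)\<^sup>2)"
  by (rule C1_along_radial_field[OF _ DERIV_k isCont_dk k_0 lim_k lim_dk])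

lemma flux_eq: "norm (V x) powr (q - 1) *\<^sub>R V x = k (norm x) *\<^sub>R x"
proof (cases "x = 0")
  case False
  then have n: "0 < norm x" by simp
  have "norm (V x) = d\<phi> (norm x)" using d\<phi>_pos[OF n] n by (simp add: V_def)
  moreover have "d\<phi> (norm x) powr (q - 1) * d\<phi> (norm x) = d\<phi> (norm x) powr q"
    using d\<phi>_pos[OF n] by (simp add: powr_diff)
  ultimately show ?thesis by (simp add: V_def k_def)
qed (simp add: V_def)

lemma divergence_flux:
  fixes x :: "'a::euclidean_space"
  assumes "x \<noteq> 0"
  shows "(\<Sum>b\<in>Basis. k (norm x) + dk (norm x) / norm x * (x \<bullet> b)\<^sup>2) = real DIM('a) * k (norm x) + norm x * dk (norm x)"
proof -
  have "(\<Sum>b\<in>Basis. (x \<bullet> b)\<^sup>2) = (norm x)\<^sup>2"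
    unfolding power2_norm_eq_inner euclidean_inner[of x x] by (simp add: power2_eq_square)
  then have "(\<Sum>b\<in>Basis. dk (norm x) / norm x * (x \<bullet> b)\<^sup>2) = dk (norm x) / norm x * (norm x)\<^sup>2"
    by (simp only: sum_distrib_left[symmetric])
  also have "\<dots> = norm x * dk (norm x)" using assms by (simp add: power2_eq_square)
  finally show ?thesis by (simp add: sum.distrib)
qed

end

section \<open>Ingredients of the comparison argument\<close>

text \<open>
  By the Cauchy--Schwarz inequality the product is at least
  \<open>(|a|\<^sup>p\<^sup>-\<^sup>1 - |b|\<^sup>p\<^sup>-\<^sup>1) (|a| - |b|)\<close>, and both factors have the same sign.
\<close>

lemma p_Laplace_field_monotone:
  fixes a b :: "'a::real_inner"
  assumes p: "1 < p"
  shows "0 \<le> (norm a powr (p - 2) *\<^sub>R a - norm b powr (p - 2) *\<^sub>R b) \<bullet> (a - b)"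
proof -
  define P where "P y = norm y powr (p - 2)" for y :: 'a
  have P0: "0 \<le> P y" for y by (simp add: P_def)
  have Pm: "P y * norm y = norm y powr (p - 1)" for y
    by (cases "y = 0") (auto simp: P_def powr_diff power2_eq_square)
  have mono: "0 \<le> (norm a powr (p - 1) - norm b powr (p - 1)) * (norm a - norm b)"
  proof (cases "norm a \<le> norm b")
    case True
    then have "norm a powr (p - 1) \<le> norm b powr (p - 1)" using p by (intro powr_mono2) auto
    with True show ?thesis by (intro mult_nonpos_nonpos) auto
  next
    case False
    then have "norm b powr (p - 1) \<le> norm a powr (p - 1)" using p by (intro powr_mono2) auto
    with False show ?thesis by (intro mult_nonneg_nonneg) auto
  qed
  also have "\<dots> = (P a * norm a - P b * norm b) * (norm a - norm b)" by (simp only: Pm)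
  also have "\<dots> = P a * (a \<bullet> a) + P b * (b \<bullet> b) - (P a + P b) * (norm a * norm b)"
    by (simp add: algebra_simps power2_norm_eq_inner[symmetric] power2_eq_square)
  also have "\<dots> \<le> P a * (a \<bullet> a) + P b * (b \<bullet> b) - (P a + P b) * (a \<bullet> b)"
    using P0[of a] P0[of b] norm_cauchy_schwarz[of a b] by (intro diff_left_mono mult_left_mono) auto
  also have "\<dots> = (P a *\<^sub>R a - P b *\<^sub>R b) \<bullet> (a - b)"
    by (simp add: inner_diff_left inner_diff_right inner_commute[of b a] algebra_simps)
  finally show ?thesis by (simp only: P_def)
qed

text \<open>
  A \<open>C\<^sup>1\<close> substitute for the positive part: same sign, smaller values, and a derivative between 0 and 1.
\<close>

definition soft_pos :: "real \<Rightarrow> real" where "soft_pos t = (max 0 t)\<^sup>2 / (1 + max 0 t)"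
definition soft_pos_deriv :: "real \<Rightarrow> real" where "soft_pos_deriv t = 1 - 1 / (1 + max 0 t)\<^sup>2"

lemma soft_pos_eq_0: "t \<le> 0 \<Longrightarrow> soft_pos t = 0" "t \<le> 0 \<Longrightarrow> soft_pos_deriv t = 0"
  by (simp_all add: soft_pos_def soft_pos_deriv_def)

lemma soft_pos_pos: "0 < t \<Longrightarrow> 0 < soft_pos t"
  by (simp add: soft_pos_def)

lemma soft_pos_bounds: "0 \<le> soft_pos t" "soft_pos t \<le> max 0 t" "0 \<le> soft_pos_deriv t" "soft_pos_deriv t \<le> 1"
proof -
  define y where "y = max 0 t"
  have y: "0 \<le> y" by (simp add: y_def)
  show "0 \<le> soft_pos t" using y by (simp add: soft_pos_def y_def[symmetric])
  have "y\<^sup>2 / (1 + y) \<le> y" using y by (simp add: divide_le_eq power2_eq_square distrib_left)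
  then show "soft_pos t \<le> max 0 t" by (simp add: soft_pos_def y_def)
  have "1 \<le> (1 + y)\<^sup>2" using y by (intro one_le_power) simp
  then have "1 / (1 + y)\<^sup>2 \<le> 1" by (simp add: divide_le_eq_1)
  then show "0 \<le> soft_pos_deriv t" by (simp add: soft_pos_deriv_def y_def)
  show "soft_pos_deriv t \<le> 1" by (simp add: soft_pos_deriv_def)
qed

lemma DERIV_soft_pos: "(soft_pos has_real_derivative soft_pos_deriv t) (at t)"
proof -
  consider "0 < t" | "t < 0" | "t = 0" by linarith
  then show ?thesis
  proof cases
    case 1
    have "((\<lambda>t. t\<^sup>2 / (1 + t)) has_real_derivative 1 - 1 / (1 + t)\<^sup>2) (at t)"
    proof -
      have "((\<lambda>t. t\<^sup>2 / (1 + t)) has_real_derivative (2 * t * (1 + t) - t\<^sup>2 * 1) / ((1 + t) * (1 + t))) (at t)"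
        using 1 by (intro DERIV_divide) (auto intro!: derivative_eq_intros)
      moreover have "2 * t * (1 + t) - t\<^sup>2 * 1 = (1 + t)\<^sup>2 - 1" by (simp add: power2_eq_square algebra_simps)
      moreover have "((1 + t)\<^sup>2 - 1) / ((1 + t) * (1 + t)) = 1 - 1 / (1 + t)\<^sup>2"
        using 1 by (simp add: diff_divide_distrib power2_eq_square)
      ultimately show ?thesis by (simp only:)
    qed
    then have "(soft_pos has_real_derivative 1 - 1 / (1 + t)\<^sup>2) (at t)"
      by (rule has_field_derivative_transform_within_open[of _ _ _ "{0<..}"])
        (use 1 in \<open>auto simp: soft_pos_def\<close>)
    with 1 show ?thesis by (simp add: soft_pos_deriv_def)
  next
    case 2
    have "((\<lambda>t. 0) has_real_derivative 0) (at t)" by simp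
    then have "(soft_pos has_real_derivative 0) (at t)"
      by (rule has_field_derivative_transform_within_open[of _ _ _ "{..<0}"])
        (use 2 in \<open>auto simp: soft_pos_def\<close>)
    with 2 show ?thesis by (simp add: soft_pos_deriv_def)
  next
    case 3
    have "((\<lambda>h. soft_pos h / h) \<longlongrightarrow> 0) (at 0)"
    proof (rule Lim_null_comparison)
      show "((\<lambda>h::real. \<bar>h\<bar>) \<longlongrightarrow> 0) (at 0)" by (intro tendsto_rabs_zero tendsto_ident_at)
      have "\<bar>soft_pos h\<bar> \<le> \<bar>h\<bar> * \<bar>h\<bar>" for h
      proof -
        define y where "y = max 0 h"
        have y: "0 \<le> y" "y \<le> \<bar>h\<bar>" by (auto simp: y_def)
        have "y\<^sup>2 / (1 + y) \<le> y\<^sup>2 / 1" using y by (intro divide_left_mono) auto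
        also have "\<dots> \<le> \<bar>h\<bar>\<^sup>2" using power_mono[OF y(2) y(1), of 2] by simp
        finally show ?thesis using y(1) by (simp add: soft_pos_def y_def[symmetric] power2_eq_square)
      qed
      then have "\<bar>soft_pos h / h\<bar> \<le> \<bar>h\<bar>" if "h \<noteq> 0" for h using that by (simp add: divide_le_eq)
      then show "\<forall>\<^sub>F h in at 0. norm (soft_pos h / h) \<le> \<bar>h\<bar>"
        by (simp add: eventually_at_filter)
    qed
    then show ?thesis using 3 by (simp add: DERIV_def soft_pos_eq_0)
  qed
qed

lemma continuous_soft_pos_deriv: "continuous_on UNIV soft_pos_deriv"
proof -
  have "(1 + max 0 t)\<^sup>2 \<noteq> 0" for t :: real by (simp add: max_def)
  then show ?thesis
    unfolding soft_pos_deriv_def[abs_def] by (intro continuous_intros ballI)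
qed

lemma integrable_continuous_times:
  fixes h c :: "'a::euclidean_space \<Rightarrow> real"
  assumes h: "integrable lebesgue h" "\<And>x. norm x > R \<Longrightarrow> h x = 0" and c: "continuous_on UNIV c"
  shows "integrable lebesgue (\<lambda>x. c x * h x)"
proof -
  have "compact (c ` cball 0 R)"
    using c by (intro compact_continuous_image) (auto intro: continuous_on_subset)
  then obtain B where B: "B > 0" "\<And>y. y \<in> c ` cball 0 R \<Longrightarrow> \<bar>y\<bar> \<le> B"
    using compact_imp_bounded bounded_pos by (metis real_norm_def)
  have cm: "c \<in> borel_measurable lebesgue"
    by (intro borel_measurable_lebesgueI borel_measurable_continuous_onI c)
  show ?thesis
  proof (rule Bochner_Integration.integrable_bound[OF integrable_mult_right[OF h(1), of B]])
    show "(\<lambda>x. c x * h x) \<in> borel_measurable lebesgue"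
      by (rule borel_measurable_times[OF cm borel_measurable_integrable[OF h(1)]])
    show "AE x in lebesgue. norm (c x * h x) \<le> norm (B * h x)"
    proof (rule AE_I2)
      fix x
      show "norm (c x * h x) \<le> norm (B * h x)"
      proof (cases "norm x > R")
        case False
        then have "\<bar>c x\<bar> \<le> \<bar>B\<bar>" using B(1) B(2)[of "c x"] by auto
        then show ?thesis by (simp add: abs_mult mult_right_mono)
      qed (simp add: h(2))
    qed
  qed
qed

lemma locally_integrable_imp_integrable:
  assumes "locally_integrable f" "\<And>x. norm x > R \<Longrightarrow> f x = 0"
  shows "integrable lebesgue f"
proof -
  have "integrable lebesgue (\<lambda>x. indicator (cball 0 R) x *\<^sub>R f x)"
    using assms(1) unfolding locally_integrable_def set_integrable_def by (metis compact_cball)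
  moreover have "indicator (cball 0 R) x *\<^sub>R f x = f x" for x
    using assms(2)[of x] by (auto simp: indicator_def)
  ultimately show ?thesis by (simp only:)
qed

text \<open>
  The bound follows from \<open>(a + M)\<^sup>p \<le> (2 a)\<^sup>p + (2 M)\<^sup>p\<close> and the finite measure of the ball.
\<close>

lemma L_pI:
  fixes f :: "'a::euclidean_space \<Rightarrow> 'b::{banach,second_countable_topology}"
    and h :: "'a \<Rightarrow> 'c::{banach,second_countable_topology}"
  assumes f: "f \<in> borel_measurable lebesgue" "\<And>x. norm x > R \<Longrightarrow> f x = 0"
    and h: "L_p_loc p h" and p: "0 < p"
    and le: "\<And>x. norm x \<le> R \<Longrightarrow> norm (f x) \<le> norm (h x) + M" and M: "0 \<le> M"
  shows "L_p p f"
proof -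
  have hm: "h \<in> borel_measurable lebesgue" and "set_integrable lebesgue (cball 0 R) (\<lambda>x. norm (h x) powr p)"
    using h by (auto simp: L_p_loc_def)
  then have ih: "integrable lebesgue (\<lambda>x. indicator (cball 0 R) x * norm (h x) powr p)"
    by (simp add: set_integrable_def)
  have i1: "integrable lebesgue (\<lambda>x::'a. indicator (cball 0 R) x :: real)"
    using fmeasurableD2[OF lmeasurable_cball[of 0 R]] by (simp add: integrable_indicator_iff top.not_eq_extremum)
  have "integrable lebesgue (\<lambda>x. norm (f x) powr p)"
  proof (rule Bochner_Integration.integrable_bound)
    show "integrable lebesgue (\<lambda>x. 2 powr p * (indicator (cball 0 R) x * norm (h x) powr p) + (2 * M) powr p * indicator (cball 0 R) x)"
      by (intro Bochner_Integration.integrable_add integrable_mult_right ih i1)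
    show "(\<lambda>x. norm (f x) powr p) \<in> borel_measurable lebesgue"
      using f(1) by measurable
    show "AE x in lebesgue. norm (norm (f x) powr p) \<le>
      norm (2 powr p * (indicator (cball 0 R) x * norm (h x) powr p) + (2 * M) powr p * indicator (cball 0 R) x)"
    proof (rule AE_I2)
      fix x
      have "norm (f x) powr p \<le> 2 powr p * (indicator (cball 0 R) x * norm (h x) powr p) + (2 * M) powr p * indicator (cball 0 R) x"
      proof (cases "norm x > R")
        case True
        then show ?thesis using p f(2) by simp
      next
        case False
        have "norm (f x) powr p \<le> (2 * max (norm (h x)) M) powr p"
          using le[of x] False p by (intro powr_mono2) auto
        also have "\<dots> \<le> (2 * norm (h x)) powr p + (2 * M) powr p"
          by (cases "norm (h x) \<le> M") (auto simp: max_def)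
        finally show ?thesis using False M by (simp add: powr_mult)
      qed
      then show "norm (norm (f x) powr p) \<le>
          norm (2 powr p * (indicator (cball 0 R) x * norm (h x) powr p) + (2 * M) powr p * indicator (cball 0 R) x)"
        by (smt (verit) powr_ge_zero real_norm_def)
    qed
  qed
  with f(1) show ?thesis by (simp add: L_p_def)
qed

section \<open>Comparison with the barrier\<close>

context barrier
begin

text \<open>
  With \<open>\<Psi> = f (u - v)\<close>, \<open>f = soft_pos\<close>, and \<open>D\<close> the divergence of the flux of \<open>v\<close>, the two weak
  formulations combine to \<open>\<integral> (D - |x|\<^sup>\<alpha> u\<^sup>m) \<Psi> = \<integral> f' (u - v) (|\<nabla>u|\<^sup>p\<^sup>-\<^sup>2 \<nabla>u - |\<nabla>v|\<^sup>p\<^sup>-\<^sup>2 \<nabla>v) \<bullet> (\<nabla>u - \<nabla>v) \<ge> 0\<close>.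
  Where \<open>u > v\<close> and \<open>x \<noteq> 0\<close>, however, \<open>D \<le> \<kappa> |x|\<^sup>\<alpha> v\<^sup>m < |x|\<^sup>\<alpha> u\<^sup>m\<close>, so the left integrand is negative there
  and zero elsewhere. Hence the set where \<open>u > v\<close> is a null set. The strictness \<open>\<kappa> < 1\<close> replaces a
  Poincare inequality.
\<close>

lemma weak_comparison:
  fixes u :: "'a::euclidean_space \<Rightarrow> real"
  assumes W: "W_1p_loc (q + 1) u G"
    and weak: "\<And>\<Psi> H. W_1p (q + 1) \<Psi> H \<Longrightarrow> compactly_supported \<Psi> \<Longrightarrow>
       integrable lebesgue (\<lambda>x. (norm (G x) powr (q - 1) *\<^sub>R G x) \<bullet> H x) \<and>
       integrable lebesgue (\<lambda>x. norm x powr \<alpha> * rpow z (u x) m * \<Psi> x) \<and>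
       (LINT x|lebesgue. (norm (G x) powr (q - 1) *\<^sub>R G x) \<bullet> H x)
         = - (LINT x|lebesgue. norm x powr \<alpha> * rpow z (u x) m * \<Psi> x)"
    and m: "0 \<le> m" and \<kappa>: "\<kappa> < 1"
    and super: "\<And>r. 0 < r \<Longrightarrow> real DIM('a) * k r + r * dk r \<le> \<kappa> * r powr \<alpha> * \<phi> r powr m"
    and outside: "\<And>x. norm x > R \<Longrightarrow> u x \<le> v x"
  shows "AE x in lebesgue. u x \<le> v x"
proof -
  have wgu: "has_weak_gradient u G" and Lu: "L_p_loc (q + 1) u" and LG: "L_p_loc (q + 1) G"
    using W by (auto simp: W_1p_loc_def)
  have um: "u \<in> borel_measurable lebesgue" and Gm: "G \<in> borel_measurable lebesgue"
    using Lu LG by (auto simp: L_p_loc_def)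
  have q1: "1 < q + 1" "0 < q + 1" using pos by auto
  obtain b0 :: 'a where b0: "b0 \<in> Basis" using nonempty_Basis by blast
  have vc: "continuous_on UNIV (v :: 'a \<Rightarrow> real)"
    using C1_along_v[OF b0] by (simp add: C1_along_def)
  have "continuous_on UNIV (\<lambda>x::'a. V x \<bullet> b)" if "b \<in> Basis" for b
    using C1_along_v[OF that] by (simp add: C1_along_def)
  then have Vc: "continuous_on UNIV (V :: 'a \<Rightarrow> 'a)"
    by (subst continuous_on_componentwise) blast
  have vm: "(v :: 'a \<Rightarrow> real) \<in> borel_measurable lebesgue" and Vm: "(V :: 'a \<Rightarrow> 'a) \<in> borel_measurable lebesgue"
    by (auto intro!: measurable_completion borel_measurable_continuous_onI vc Vc)
  have v0: "0 \<le> v x" for x :: 'a using pos by (simp add: v_def \<phi>_def)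
  define \<Psi> where "\<Psi> x = soft_pos (u x - v x)" for x
  define H where "H x = soft_pos_deriv (u x - v x) *\<^sub>R (G x - V x)" for x
  have wg: "has_weak_gradient \<Psi> H"
    unfolding \<Psi>_def[abs_def] H_def[abs_def]
    by (rule has_weak_gradient_compose_diff[OF wgu um Gm C1_along_v Vc DERIV_soft_pos continuous_soft_pos_deriv, of 1])
       (use soft_pos_bounds(3,4) in \<open>simp_all add: abs_le_iff order_trans[of _ 0]\<close>)
  have \<Psi>0: "\<Psi> x = 0" and H0: "H x = 0" if "u x \<le> v x" for x
    using that soft_pos_eq_0[of "u x - v x"] by (auto simp: \<Psi>_def H_def)
  have \<Psi>out: "\<And>x. norm x > R \<Longrightarrow> \<Psi> x = 0" and Hout: "\<And>x. norm x > R \<Longrightarrow> H x = 0"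
    using \<Psi>0 H0 outside by auto
  have uvm: "(\<lambda>x. u x - v x) \<in> borel_measurable lebesgue" by (rule borel_measurable_diff[OF um vm])
  have sm: "soft_pos \<in> borel_measurable borel" "soft_pos_deriv \<in> borel_measurable borel"
    using DERIV_isCont[OF DERIV_soft_pos] continuous_soft_pos_deriv
    by (auto intro!: borel_measurable_continuous_onI simp: continuous_on_eq_continuous_at)
  have \<Psi>m: "\<Psi> \<in> borel_measurable lebesgue"
    unfolding \<Psi>_def[abs_def] by (rule measurable_compose[OF uvm sm(1)])
  have Hm: "H \<in> borel_measurable lebesgue"
    unfolding H_def[abs_def]
    by (intro borel_measurable_scaleR borel_measurable_diff Gm Vm measurable_compose[OF uvm sm(2)])
  have "L_p (q + 1) \<Psi>"
  proof (rule L_pI[OF \<Psi>m \<Psi>out Lu q1(2), where M = 0])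
    fix x
    show "norm (\<Psi> x) \<le> norm (u x) + 0"
      using soft_pos_bounds(1,2)[of "u x - v x"] v0[of x] by (simp add: \<Psi>_def)
  qed simp_all
  moreover have "L_p (q + 1) H"
  proof -
    have "compact (V ` cball (0::'a) R)"
      using Vc by (intro compact_continuous_image) (auto intro: continuous_on_subset)
    then obtain M where M: "M > 0" "\<And>y. y \<in> V ` cball (0::'a) R \<Longrightarrow> norm y \<le> M"
      using compact_imp_bounded bounded_pos by metis
    show ?thesis
    proof (rule L_pI[OF Hm Hout LG q1(2), where M = M])
      fix x :: 'a assume x: "norm x \<le> R"
      have "norm (H x) = soft_pos_deriv (u x - v x) * norm (G x - V x)"
        using soft_pos_bounds(3)[of "u x - v x"] by (simp add: H_def)
      also have "\<dots> \<le> 1 * norm (G x - V x)" by (intro mult_right_mono soft_pos_bounds(4)) simp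
      also have "\<dots> \<le> norm (G x) + norm (V x)" using norm_triangle_ineq4[of "G x" "V x"] by simp
      also have "\<dots> \<le> norm (G x) + M" using M(2)[of "V x"] x by simp
      finally show "norm (H x) \<le> norm (G x) + M" .
    qed (use M in simp_all)
  qed
  ultimately have W\<Psi>: "W_1p (q + 1) \<Psi> H" using wg by (simp add: W_1p_def)
  have cs: "compactly_supported \<Psi>" using \<Psi>out by (rule compactly_supportedI)
  define \<rho> where "\<rho> x = norm x powr \<alpha> * rpow z (u x) m" for x :: 'a
  have iG: "integrable lebesgue (\<lambda>x. (norm (G x) powr (q - 1) *\<^sub>R G x) \<bullet> H x)"
    and i\<rho>: "integrable lebesgue (\<lambda>x. \<rho> x * \<Psi> x)"
    and eqG: "(LINT x|lebesgue. (norm (G x) powr (q - 1) *\<^sub>R G x) \<bullet> H x) = - (LINT x|lebesgue. \<rho> x * \<Psi> x)"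
    using weak[OF W\<Psi> cs] by (simp_all only: \<rho>_def)
  have i\<Psi>: "integrable lebesgue \<Psi>"
    using wg by (intro locally_integrable_imp_integrable[OF _ \<Psi>out]) (simp add: has_weak_gradient_def)
  have iH: "integrable lebesgue H"
    using wg by (intro locally_integrable_imp_integrable[OF _ Hout]) (simp add: has_weak_gradient_def)
  define A where "A b x = k (norm x) * (x \<bullet> b)" for b x :: 'a
  define A' where "A' b x = k (norm x) + dk (norm x) / norm x * (x \<bullet> b)\<^sup>2" for b x :: 'a
  have C1A: "C1_along b (A b) (A' b)" if "b \<in> Basis" for b
    unfolding A_def[abs_def] A'_def[abs_def] by (rule C1_along_flux[OF that])
  define D where "D x = (\<Sum>b\<in>Basis. A' b x)" for x
  have iA': "integrable lebesgue (\<lambda>x. A' b x * \<Psi> x)" and iA: "integrable lebesgue (\<lambda>x. A b x * (H x \<bullet> b))" if b: "b \<in> Basis" for b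
  proof -
    show "integrable lebesgue (\<lambda>x. A' b x * \<Psi> x)"
      using C1A[OF b] by (intro integrable_continuous_times[OF i\<Psi> \<Psi>out]) (simp_all add: C1_along_def)
    show "integrable lebesgue (\<lambda>x. A b x * (H x \<bullet> b))"
      using C1A[OF b] Hout by (intro integrable_continuous_times[where R = R] integrable_inner_left iH) (simp_all add: C1_along_def)
  qed
  have iD: "integrable lebesgue (\<lambda>x. D x * \<Psi> x)"
    unfolding D_def sum_distrib_right using iA' by (intro Bochner_Integration.integrable_sum)
  have F: "(norm (V x) powr (q - 1) *\<^sub>R V x) \<bullet> H x = (\<Sum>b\<in>Basis. A b x * (H x \<bullet> b))" for x
    unfolding flux_eq A_def by (subst euclidean_inner) simp
  have iF: "integrable lebesgue (\<lambda>x. (norm (V x) powr (q - 1) *\<^sub>R V x) \<bullet> H x)"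
    unfolding F using iA by (intro Bochner_Integration.integrable_sum)
  have eqF: "(LINT x|lebesgue. (norm (V x) powr (q - 1) *\<^sub>R V x) \<bullet> H x) = - (LINT x|lebesgue. D x * \<Psi> x)"
  proof -
    have "(LINT x|lebesgue. D x * \<Psi> x) = (\<Sum>b\<in>Basis. LINT x|lebesgue. A' b x * \<Psi> x)"
      unfolding D_def sum_distrib_right using iA' by (rule Bochner_Integration.integral_sum)
    also have "\<dots> = (\<Sum>b\<in>Basis. - (LINT x|lebesgue. A b x * (H x \<bullet> b)))"
      by (intro sum.cong refl has_weak_gradient_by_parts[OF wg \<Psi>m Hm \<Psi>out Hout _ C1A])
    also have "\<dots> = - (LINT x|lebesgue. (\<Sum>b\<in>Basis. A b x * (H x \<bullet> b)))"
      using iA by (simp add: sum_negf)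
    finally show ?thesis unfolding F by simp
  qed
  have "0 \<le> (LINT x|lebesgue. (norm (G x) powr (q - 1) *\<^sub>R G x) \<bullet> H x - (norm (V x) powr (q - 1) *\<^sub>R V x) \<bullet> H x)"
  proof (rule Bochner_Integration.integral_nonneg)
    fix x
    have "(norm (G x) powr (q - 1) *\<^sub>R G x) \<bullet> H x - (norm (V x) powr (q - 1) *\<^sub>R V x) \<bullet> H x =
        soft_pos_deriv (u x - v x) * ((norm (G x) powr (q - 1) *\<^sub>R G x - norm (V x) powr (q - 1) *\<^sub>R V x) \<bullet> (G x - V x))"
      by (simp add: H_def inner_diff_left right_diff_distrib)
    moreover have "0 \<le> (norm (G x) powr (q - 1) *\<^sub>R G x - norm (V x) powr (q - 1) *\<^sub>R V x) \<bullet> (G x - V x)"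
      using p_Laplace_field_monotone[OF q1(1), of "G x" "V x"] by simp
    ultimately show "0 \<le> (norm (G x) powr (q - 1) *\<^sub>R G x) \<bullet> H x - (norm (V x) powr (q - 1) *\<^sub>R V x) \<bullet> H x"
      using soft_pos_bounds(3) by simp
  qed
  also have "\<dots> = - (LINT x|lebesgue. \<rho> x * \<Psi> x - D x * \<Psi> x)"
    using iG iF i\<rho> iD eqG eqF by simp
  finally have le0: "(LINT x|lebesgue. \<rho> x * \<Psi> x - D x * \<Psi> x) \<le> 0" by simp
  have strict: "0 < \<rho> x * \<Psi> x - D x * \<Psi> x" if x: "x \<noteq> 0" and uv: "v x < u x" for x
  proof -
    have n: "0 < norm x" using x by simp
    have vp: "0 < v x" using \<phi>_pos[OF n] by (simp add: v_def)
    have "D x \<le> \<kappa> * (norm x powr \<alpha> * v x powr m)"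
      using divergence_flux[OF x] super[OF n] by (simp add: D_def A'_def v_def mult.assoc)
    also have "\<dots> < 1 * (norm x powr \<alpha> * v x powr m)"
      using \<kappa> n vp by (intro mult_strict_right_mono mult_pos_pos) auto
    also have "\<dots> \<le> norm x powr \<alpha> * u x powr m"
      using uv vp m by (simp add: mult_left_mono powr_mono2)
    also have "\<dots> = \<rho> x" using uv vp by (simp add: \<rho>_def rpow_def)
    finally have "D x < \<rho> x" .
    moreover have "0 < \<Psi> x" using uv by (simp add: \<Psi>_def soft_pos_pos)
    ultimately show ?thesis by (simp add: left_diff_distrib[symmetric])
  qed
  have ae0: "AE x in lebesgue. x \<noteq> (0::'a)"
    by (rule AE_completion[OF AE_lborel_singleton])
  then have nonneg: "AE x in lebesgue. 0 \<le> \<rho> x * \<Psi> x - D x * \<Psi> x"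
  proof eventually_elim
    case (elim x)
    then show ?case using strict[of x] \<Psi>0[of x] by (cases "u x \<le> v x") auto
  qed
  have int: "integrable lebesgue (\<lambda>x. \<rho> x * \<Psi> x - D x * \<Psi> x)" using i\<rho> iD by simp
  have "(LINT x|lebesgue. \<rho> x * \<Psi> x - D x * \<Psi> x) = 0"
    using le0 integral_nonneg_AE[OF nonneg] by simp
  then have "AE x in lebesgue. \<rho> x * \<Psi> x - D x * \<Psi> x = 0"
    using integral_nonneg_eq_0_iff_AE[OF int nonneg] by simp
  with ae0 show ?thesis
  proof eventually_elim
    case (elim x)
    then show ?case using strict[of x] by (cases "u x \<le> v x") auto
  qed
qed

end

section \<open>The Liouville theorem\<close>

text \<open>
  The last equation says that \<open>\<tau> |x|\<^sup>\<beta>\<close> satisfies the equation exactly: its left-hand side is the factor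
  \<open>\<kappa>\<close> of the lemma \<open>supersolution\<close> at \<open>c = \<tau>\<close>.
\<close>

lemma tau_scaling:
  fixes n :: nat and p m \<alpha> :: real
  assumes n: "1 \<le> n" and p: "1 < p" and m: "m < p - 1" "0 \<le> m" and \<alpha>: "\<alpha> + 1 + m > 0"
  defines "\<beta> \<equiv> 1 + (1 + \<alpha> + m) / (p - 1 - m)"
  shows "0 < tau n p m \<alpha>" and "1 < \<beta>" and "\<beta> * (p - 1 - m) = p + \<alpha>" and "0 < real n + (\<beta> - 1) * (p - 1) - 1"
    and "tau n p m \<alpha> powr (p - 1 - m) * \<beta> powr (p - 1) * (real n + (\<beta> - 1) * (p - 1) - 1) = 1"
proof -
  define e where "e = p - 1 - m"
  define K where "K = real n + (\<beta> - 1) * (p - 1) - 1"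
  have e: "0 < e" using m by (simp add: e_def)
  show \<beta>1: "1 < \<beta>" using \<alpha> m by (simp add: \<beta>_def)
  show \<beta>e: "\<beta> * (p - 1 - m) = p + \<alpha>" using e by (simp add: \<beta>_def e_def field_simps)
  have "0 < (\<beta> - 1) * (p - 1)" using \<beta>1 p by simp
  then show K: "0 < real n + (\<beta> - 1) * (p - 1) - 1" using n by linarith
  have Ke: "(1 + \<alpha> + m) * (p - 1) + (real n - 1) * e = K * e"
  proof -
    have "(\<beta> - 1) * e = 1 + \<alpha> + m" using e by (simp add: \<beta>_def e_def[symmetric])
    moreover have "K * e = real n * e + (\<beta> - 1) * e * (p - 1) - e" by (simp add: K_def algebra_simps)
    ultimately show ?thesis by (simp add: algebra_simps)
  qed
  have "e / ((1 + \<alpha> + m) * (p - 1) + (real n - 1) * e) = 1 / K"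
    unfolding Ke using e by simp
  moreover have "e / (p + \<alpha>) = 1 / \<beta>"
    unfolding \<beta>e[symmetric] e_def[symmetric] using e by simp
  ultimately have tau: "tau n p m \<alpha> = (1 / K) powr (1 / e) * (1 / \<beta>) powr ((p - 1) / e)"
    by (simp add: tau_def e_def)
  have K0: "0 < K" using K by (simp add: K_def)
  show "0 < tau n p m \<alpha>" using K0 \<beta>1 by (simp add: tau)
  have "tau n p m \<alpha> powr e = (1 / K) * (1 / \<beta>) powr (p - 1)"
    using e K0 \<beta>1 by (simp add: tau powr_mult powr_powr)
  then show "tau n p m \<alpha> powr (p - 1 - m) * \<beta> powr (p - 1) * (real n + (\<beta> - 1) * (p - 1) - 1) = 1"
    using K0 \<beta>1 by (simp add: e_def[symmetric] K_def[symmetric] powr_divide)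
qed

theorem theorem1p18:
  fixes u :: "real ^ 'n \<Rightarrow> real" and p m \<alpha> z :: real
  assumes "CARD('n) \<ge> 2"
    and "1 < p" and "0 \<le> m" and "m < p - 1" and "\<alpha> + 1 + m > 0"
    and "z \<in> {0, 1}"
    and "entire_weak_solution z p m \<alpha> u"
    and "AE x in lebesgue. 0 \<le> u x"
    and "Limsup at_infinity
           (\<lambda>x. ereal (u x / norm x powr (1 + (1 + \<alpha> + m) / (p - 1 - m))))
         < ereal (tau CARD('n) p m \<alpha>)"
  shows "AE x in lebesgue. u x = 0"
proof -
  define n where "n = CARD('n)"
  define q where "q = p - 1"
  define \<beta> where "\<beta> = 1 + (1 + \<alpha> + m) / (p - 1 - m)"
  define \<tau> where "\<tau> = tau n p m \<alpha>"
  define K where "K = real n + (\<beta> - 1) * q - 1"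
  have "1 \<le> n" using assms(1) by (simp add: n_def)
  note scaling = tau_scaling[OF this assms(2,4,3,5), folded \<beta>_def q_def \<tau>_def, folded K_def]
  have e: "0 < q - m" "0 < q" using assms(2,4) by (auto simp: q_def)
  obtain C0 where C0: "Limsup at_infinity (\<lambda>x. ereal (u x / norm x powr \<beta>)) < ereal C0" "C0 < \<tau>"
    using ereal_dense2[OF assms(9)] unfolding \<beta>_def \<tau>_def n_def by auto
  \<comment> \<open>The limit superior may be negative or \<open>-\<infinity>\<close>, so \<open>c\<close> has to be kept positive separately.\<close>
  define c where "c = (max C0 0 + \<tau>) / 2"
  have c: "0 < c" "C0 < c" "c < \<tau>" using C0(2) scaling(1) by (auto simp: c_def max_def)
  define \<kappa> where "\<kappa> = c powr (q - m) * \<beta> powr q * K"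
  have "\<kappa> < \<tau> powr (q - m) * \<beta> powr q * K"
    unfolding \<kappa>_def using c e scaling(2,4) by (intro mult_strict_right_mono powr_less_mono2) auto
  then have \<kappa>: "\<kappa> < 1" using scaling(5) by simp
  \<comment> \<open>The two bounds are those of the lemma \<open>supersolution\<close> and of the locale \<open>barrier\<close>, the latter halved to be strict.\<close>
  define s where "s = min (\<beta> * (q - m) / (q + q * \<beta> / K)) (q * \<beta> / (2 * (q + 1)))"
  have qK: "0 < q + q * \<beta> / K" using e scaling(2,4) by (intro add_pos_pos divide_pos_pos mult_pos_pos) auto
  have s0: "0 < s" unfolding s_def using e scaling(2) qK by simp
  have "s * (q + q * \<beta> / K) \<le> \<beta> * (q - m) / (q + q * \<beta> / K) * (q + q * \<beta> / K)"
    using qK by (intro mult_right_mono) (auto simp: s_def)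
  then have s1: "s * (q + q * \<beta> / K) \<le> \<beta> * (q - m)" using qK by simp
  have "s * (q + 1) \<le> q * \<beta> / (2 * (q + 1)) * (q + 1)"
    using e by (intro mult_right_mono) (auto simp: s_def)
  also have "\<dots> = q * \<beta> / 2" using e by (simp add: field_simps)
  also have "\<dots> < q * \<beta>" using e scaling(2) by simp
  finally have s2: "s * (q + 1) < q * \<beta>" .
  have comparison: "AE x in lebesgue. u x \<le> c * norm x powr \<beta> * exp (- (real (Suc j) * norm x powr (- s)))" for j
  proof -
    define \<delta> where "\<delta> = real (Suc j)"
    interpret barrier c \<beta> q s \<delta>
      by unfold_locales (use c scaling(2) e s0 s2 in \<open>auto simp: \<delta>_def\<close>)
    obtain G where W: "W_1p_loc p u G" and weak: "\<And>\<Psi> H. W_1p p \<Psi> H \<Longrightarrow> compactly_supported \<Psi> \<Longrightarrow>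
          integrable lebesgue (\<lambda>x. (norm (G x) powr (p - 2) *\<^sub>R G x) \<bullet> H x) \<and>
          integrable lebesgue (\<lambda>x. norm x powr \<alpha> * rpow z (u x) m * \<Psi> x) \<and>
          (LINT x|lebesgue. (norm (G x) powr (p - 2) *\<^sub>R G x) \<bullet> H x)
            = - (LINT x|lebesgue. norm x powr \<alpha> * rpow z (u x) m * \<Psi> x)"
      using assms(7) unfolding entire_weak_solution_def by blast
    have pq: "q + 1 = p" "q - 1 = p - 2" by (auto simp: q_def)
    have "\<forall>\<^sub>F x in at_infinity. u x / norm x powr \<beta> < C0"
      using Limsup_lessD[OF C0(1)] by simp
    then obtain R1 where R1: "\<And>x. norm x \<ge> R1 \<Longrightarrow> u x / norm x powr \<beta> < C0"
      unfolding eventually_at_infinity by blast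
    have "((\<lambda>r. c * exp (- (\<delta> * r powr (- s)))) \<longlongrightarrow> c * exp (- (\<delta> * 0))) at_top"
      using s0 by (intro tendsto_intros tendsto_neg_powr filterlim_ident) auto
    then have "\<forall>\<^sub>F r in at_top. C0 < c * exp (- (\<delta> * r powr (- s)))"
      using c(2) by (intro order_tendstoD(1)) auto
    then obtain R2 where R2: "\<And>r. r \<ge> R2 \<Longrightarrow> C0 < c * exp (- (\<delta> * r powr (- s)))"
      unfolding eventually_at_top_linorder by blast
    have "AE x in lebesgue. u x \<le> v x"
    proof (rule weak_comparison[where R = "max 0 (max R1 R2)" and G = G and m = m and \<alpha> = \<alpha> and z = z and \<kappa> = \<kappa>])
      show "W_1p_loc (q + 1) u G" using W by (simp only: pq)
      show "integrable lebesgue (\<lambda>x. (norm (G x) powr (q - 1) *\<^sub>R G x) \<bullet> H x) \<and>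
          integrable lebesgue (\<lambda>x. norm x powr \<alpha> * rpow z (u x) m * \<Psi> x) \<and>
          (LINT x|lebesgue. (norm (G x) powr (q - 1) *\<^sub>R G x) \<bullet> H x)
            = - (LINT x|lebesgue. norm x powr \<alpha> * rpow z (u x) m * \<Psi> x)"
        if "W_1p (q + 1) \<Psi> H" "compactly_supported \<Psi>" for \<Psi> H
        using that unfolding pq by (rule weak)
      show "real DIM(real ^ 'n) * k r + r * dk r \<le> \<kappa> * r powr \<alpha> * \<phi> r powr m" if r: "0 < r" for r
      proof -
        have "real n * k r + r * dk r \<le> \<kappa> * r powr \<alpha> * \<phi> r powr m"
          unfolding \<kappa>_def K_def
        proof (rule supersolution[OF r])
          show "\<beta> * (q - m) = q + 1 + \<alpha>" using scaling(3) by (simp add: q_def)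
        qed (use scaling(4) s1 in \<open>simp_all add: K_def\<close>)
        then show ?thesis by (simp add: n_def)
      qed
      fix x :: "real ^ 'n" assume x: "max 0 (max R1 R2) < norm x"
      then have n: "0 < norm x" "R1 \<le> norm x" "R2 \<le> norm x" by auto
      have "u x < C0 * norm x powr \<beta>" using R1[OF n(2)] n(1) by (simp add: divide_less_eq)
      also have "\<dots> \<le> (c * exp (- (\<delta> * norm x powr (- s)))) * norm x powr \<beta>"
        using R2[OF n(3)] by (intro mult_right_mono) auto
      finally show "u x \<le> v x" by (simp add: v_def \<phi>_def mult_ac)
    qed (use assms(3) \<kappa> in simp_all)
    then show ?thesis unfolding v_def \<phi>_def by (simp only: \<delta>_def)
  qed
  have "AE x in lebesgue. \<forall>j. u x \<le> c * norm x powr \<beta> * exp (- (real (Suc j) * norm x powr (- s)))"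
    unfolding AE_all_countable by (intro allI comparison)
  moreover have "AE x in lebesgue. x \<noteq> (0 :: real ^ 'n)"
    by (rule AE_completion[OF AE_lborel_singleton])
  ultimately show ?thesis using assms(8)
  proof eventually_elim
    case (elim x)
    define y where "y = norm x powr (- s)"
    have y: "0 < y" using elim(2) by (simp add: y_def)
    have "(\<lambda>j. exp (- y) ^ Suc j) \<longlonglongrightarrow> 0"
      using y by (intro LIMSEQ_Suc LIMSEQ_realpow_zero) auto
    then have "(\<lambda>j. c * norm x powr \<beta> * exp (- y) ^ Suc j) \<longlonglongrightarrow> c * norm x powr \<beta> * 0"
      by (intro tendsto_mult tendsto_const)
    moreover have "exp (- y) ^ Suc j = exp (- (real (Suc j) * y))" for j
      by (simp only: exp_of_nat_mult[symmetric] mult_minus_right)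
    ultimately have "(\<lambda>j. c * norm x powr \<beta> * exp (- (real (Suc j) * y))) \<longlonglongrightarrow> 0" by simp
    then have "u x \<le> 0"
      by (rule LIMSEQ_le_const) (use elim(1) in \<open>auto simp: y_def\<close>)
    with elim(3) show ?case by simp
  qed
qed

end
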